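(* Let $T$ be a Calderón-Zygmund singular integral operator on $\mathbb{R}^n$. Then for any $M$-pair $(p(\cdot),w)$ there is a constant $C$ such that $$\|Tf\|_{L^{p(\cdot)}(w)}\le C\|f\|_{L^{p(\cdot)}(w)}$$ for all $f\in L^{p(\cdot)}(w)$.
   Context: $\mathcal{P}$ is the set of measurable $p(\cdot):\mathbb{R}^n\to[1,\infty]$. The conjugate exponent $p'(\cdot)$ is defined pointwise by $1/p(x)+1/p'(x)=1$, $1/\infty=0$. With $\mathbb{R}^n_\infty=\{x:p(x)=\infty\}$, $$\|f\|_{p(\cdot)}=\inf\Big\{\lambda>0:\int_{\mathbb{R}^n\setminus\mathbb{R}^n_\infty}\Big(\frac{|f(x)|}{\lambda}\Big)^{p(x)}dx+\lambda^{-1}\|f\|_{L^\infty(\mathbb{R}^n_\infty)}\le1\Big\}.$$ A weight $w$ is a non-negative measurable function, here with $0<w<\infty$ a.e. $L^{p(\cdot)}(w)$ is the set of measurable $f$ with $\|f\|_{L^{p(\cdot)}(w)}:=\|fw\|_{p(\cdot)}<\infty$. $Mf(x)=\sup_{B\ni x}\frac1{|B|}\int_B|f(y)|\,dy$ (balls $B$); $M$ is bounded on $L^{p(\cdot)}(w)$ if $\|(Mf)w\|_{p(\cdot)}\le C\|fw\|_{p(\cdot)}$ for all $f\in L^{p(\cdot)}(w)$. $(p(\cdot),w)$, with $p(\cdot)\in\mathcal{P}$, is an $M$-pair if $M$ is bounded on both $L^{p(\cdot)}(w)$ and $L^{p'(\cdot)}(w^{-1})$. Calderón-Zygmund singular integral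 operators include convolution operators $Tf=K*f$, where $K$ is defined on $\mathbb{R}^n\setminus\{0\}$ and satisfies $\hat K\in L^\infty$, $|K(x)|\le C|x|^{-n}$, $|\nabla K(x)|\le C|x|^{-n-1}$, $x\ne0$; and, more generally, those of the type defined by Coifman and Meyer: linear $T$ bounded on $L^2(\mathbb{R}^n)$ with $Tf(x)=\int K(x,y)f(y)\,dy$ for $f\in L^\infty_c$ (bounded functions of compact support) and $x\notin\operatorname{supp}f$, where $|K(x,y)|\le C|x-y|^{-n}$ and $|K(x+h,y)-K(x,y)|+|K(x,y+h)-K(x,y)|\le C|h|^{\epsilon}|x-y|^{-n-\epsilon}$ for $|h|\le|x-y|/2$ and some $\epsilon\in(0,1]$. $T$ is initially defined on $L^\infty_c$, which is dense in $L^{p(\cdot)}(w)$, and on $L^{p(\cdot)}(w)$ is understood as the extension by density. *)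

theory Defs
  imports "HOL-Probability.Essential_Supremum"
begin

text \<open>
  The ambient space \<open>\<real>\<^sup>n\<close> is a type \<open>'a\<close> of class \<open>euclidean_space\<close>, with \<open>n = DIM('a)\<close>.
  Functions are complex valued and measurable means Lebesgue measurable. Exponents, weights and
  norms live in \<^typ>\<open>ennreal\<close>; a function has finite norm iff this is less than \<open>\<infinity>\<close>.
\<close>

section \<open>Weighted variable Lebesgue spaces\<close>

definition exponent :: "('a::euclidean_space \<Rightarrow> ennreal) \<Rightarrow> bool" where
  "exponent p \<longleftrightarrow> p \<in> borel_measurable lebesgue \<and> (\<forall>x. 1 \<le> p x)"

definition conj_exponent :: "('a::euclidean_space \<Rightarrow> ennreal) \<Rightarrow> 'a \<Rightarrow> ennreal" where
  "conj_exponent p x = inverse (1 - inverse (p x))"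

lemma conj_exponent_sum:
  assumes "exponent p"
  shows "inverse (p x) + inverse (conj_exponent p x) = 1"
proof -
  have "inverse (p x) \<le> 1"
    using assms[unfolded exponent_def, THEN conjunct2, rule_format, of x]
    by (cases "p x") (auto simp: inverse_ennreal inverse_le_1_iff)
  moreover have "inverse (inverse t) = t" for t :: ennreal
    by (cases t; cases "t = 0") (auto simp: inverse_ennreal)
  ultimately show ?thesis
    by (simp add: conj_exponent_def add_diff_inverse_ennreal)
qed

text \<open>Powers \<open>t\<^sup>r\<close> of \<open>t \<in> [0, \<infinity>]\<close> for a finite exponent \<open>r \<ge> 1\<close>.\<close>

definition epowr :: "ennreal \<Rightarrow> real \<Rightarrow> ennreal" where
  "epowr t r = (if t = \<infinity> then \<infinity> else ennreal (enn2real t powr r))"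

text \<open>
  The norm is a function of \<open>F = \<bar>f\<bar>\<close>, which may take the value \<open>\<infinity>\<close> so that it applies to
  maximal functions. It is \<open>\<infinity>\<close> if no \<open>\<lambda>\<close> is admissible.
\<close>

definition var_norm :: "('a::euclidean_space \<Rightarrow> ennreal) \<Rightarrow> ('a \<Rightarrow> ennreal) \<Rightarrow> ennreal" where
  "var_norm p F = Inf {ennreal l | l::real. 0 < l \<and>
     (\<integral>\<^sup>+x\<in>{x. p x \<noteq> \<infinity>}. epowr (F x / ennreal l) (enn2real (p x)) \<partial>lebesgue)
       + inverse (ennreal l) * esssup (restrict_space lebesgue {x. p x = \<infinity>}) F \<le> 1}"

definition weight :: "('a::euclidean_space \<Rightarrow> ennreal) \<Rightarrow> bool" where
  "weight w \<longleftrightarrow> w \<in> borel_measurable lebesgue \<and> (AE x in lebesgue. 0 < w x \<and> w x < \<infinity>)"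

definition wnorm :: "('a::euclidean_space \<Rightarrow> ennreal) \<Rightarrow> ('a \<Rightarrow> ennreal) \<Rightarrow> ('a \<Rightarrow> complex) \<Rightarrow> ennreal"
  where "wnorm p w f = var_norm p (\<lambda>x. ennreal (norm (f x)) * w x)"

definition wLp :: "('a::euclidean_space \<Rightarrow> ennreal) \<Rightarrow> ('a \<Rightarrow> ennreal) \<Rightarrow> ('a \<Rightarrow> complex) set" where
  "wLp p w = {f \<in> borel_measurable lebesgue. wnorm p w f < \<infinity>}"

section \<open>The maximal operator\<close>

definition maximal :: "('a::euclidean_space \<Rightarrow> complex) \<Rightarrow> 'a \<Rightarrow> ennreal" where
  "maximal f x = (SUP (c, r) \<in> {(c, r). 0 < r \<and> x \<in> ball c r}.
     (\<integral>\<^sup>+y\<in>ball c r. ennreal (norm (f y)) \<partial>lebesgue) / emeasure lebesgue (ball c r))"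

definition maximal_bounded :: "('a::euclidean_space \<Rightarrow> ennreal) \<Rightarrow> ('a \<Rightarrow> ennreal) \<Rightarrow> bool" where
  "maximal_bounded p w \<longleftrightarrow>
     (\<exists>C::real. \<forall>f\<in>wLp p w. var_norm p (\<lambda>x. maximal f x * w x) \<le> ennreal C * wnorm p w f)"

definition M_pair :: "('a::euclidean_space \<Rightarrow> ennreal) \<Rightarrow> ('a \<Rightarrow> ennreal) \<Rightarrow> bool" where
  "M_pair p w \<longleftrightarrow> exponent p \<and> weight w \<and> maximal_bounded p w \<and>
     maximal_bounded (conj_exponent p) (\<lambda>x. inverse (w x))"

section \<open>Calderon-Zygmund operators\<close>

definition L2 :: "('a::euclidean_space \<Rightarrow> complex) set" where
  "L2 = {f \<in> borel_measurable lebesgue. integrable lebesgue (\<lambda>x. (norm (f x))\<^sup>2)}"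

definition L2_norm :: "('a::euclidean_space \<Rightarrow> complex) \<Rightarrow> real" where
  "L2_norm f = sqrt (LINT x|lebesgue. (norm (f x))\<^sup>2)"

definition supp :: "('a::euclidean_space \<Rightarrow> complex) \<Rightarrow> 'a set" where
  "supp f = closure {x. f x \<noteq> 0}"

definition Linf_c :: "('a::euclidean_space \<Rightarrow> complex) set" where
  "Linf_c = {f \<in> borel_measurable lebesgue. bounded (range f) \<and> compact (supp f)}"

text \<open>
  Operators act on representatives, so identities between their values hold almost everywhere.
  Linearity together with boundedness makes the operator respect almost everywhere equality.
\<close>

definition L2_bounded_linear :: "(('a::euclidean_space \<Rightarrow> complex) \<Rightarrow> 'a \<Rightarrow> complex) \<Rightarrow> bool" where
  "L2_bounded_linear T \<longleftrightarrow>
     (\<forall>f\<in>L2. T f \<in> L2) \<and>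
     (\<forall>f\<in>L2. \<forall>g\<in>L2. AE x in lebesgue. T (\<lambda>y. f y + g y) x = T f x + T g x) \<and>
     (\<forall>f\<in>L2. \<forall>c. AE x in lebesgue. T (\<lambda>y. c * f y) x = c * T f x) \<and>
     (\<exists>A. \<forall>f\<in>L2. L2_norm (T f) \<le> A * L2_norm f)"

text \<open>The values of a kernel on the diagonal are irrelevant.\<close>

definition standard_kernel :: "('a::euclidean_space \<Rightarrow> 'a \<Rightarrow> complex) \<Rightarrow> bool" where
  "standard_kernel K \<longleftrightarrow>
     (\<exists>C \<epsilon>. 0 < \<epsilon> \<and> \<epsilon> \<le> 1 \<and>
       (\<forall>x y. x \<noteq> y \<longrightarrow> norm (K x y) \<le> C * norm (x - y) powr (- real DIM('a))) \<and>
       (\<forall>x y h. x \<noteq> y \<longrightarrow> norm h \<le> norm (x - y) / 2 \<longrightarrow>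
          norm (K (x + h) y - K x y) + norm (K x (y + h) - K x y)
            \<le> C * norm h powr \<epsilon> * norm (x - y) powr (- real DIM('a) - \<epsilon>)))"

definition has_kernel ::
  "(('a::euclidean_space \<Rightarrow> complex) \<Rightarrow> 'a \<Rightarrow> complex) \<Rightarrow> ('a \<Rightarrow> 'a \<Rightarrow> complex) \<Rightarrow> bool" where
  "has_kernel T K \<longleftrightarrow>
     (\<forall>f\<in>Linf_c. AE x in lebesgue. x \<notin> supp f \<longrightarrow> T f x = (LINT y|lebesgue. K x y * f y))"

definition calderon_zygmund :: "(('a::euclidean_space \<Rightarrow> complex) \<Rightarrow> 'a \<Rightarrow> complex) \<Rightarrow> bool" where
  "calderon_zygmund T \<longleftrightarrow> L2_bounded_linear T \<and> (\<exists>K. standard_kernel K \<and> has_kernel T K)"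

text \<open>
  The class contains the convolution operators \<open>T f = k * f\<close> with \<open>\<bar>k x\<bar> \<le> C \<bar>x\<bar>\<^sup>-\<^sup>n\<close> and
  \<open>\<bar>\<nabla> k x\<bar> \<le> C \<bar>x\<bar>\<^sup>-\<^sup>n\<^sup>-\<^sup>1\<close> for \<open>x \<noteq> 0\<close>; by Plancherel, boundedness of the Fourier transform
  of \<open>k\<close> means that \<open>T\<close> is bounded on \<open>L\<^sup>2\<close>.
\<close>

lemma standard_kernel_convolution:
  fixes k :: "'a::euclidean_space \<Rightarrow> complex"
  assumes size: "\<And>x. x \<noteq> 0 \<Longrightarrow> norm (k x) \<le> C * norm x powr (- real DIM('a))"
    and deriv: "\<And>x. x \<noteq> 0 \<Longrightarrow> (k has_derivative k' x) (at x)"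
    and grad: "\<And>x. x \<noteq> 0 \<Longrightarrow> onorm (k' x) \<le> C * norm x powr (- real DIM('a) - 1)"
  shows "standard_kernel (\<lambda>x y. k (x - y))"
proof -
  let ?n = "real DIM('a)"
  define D where "D = \<bar>C\<bar> * 2 powr (?n + 1)"
  have D: "\<bar>C\<bar> \<le> D" "0 \<le> D"
    by (auto simp: D_def mult_le_cancel_left1 ge_one_powr_ge_zero)
  have diff: "norm (k (z + h) - k z) \<le> D * norm h * norm z powr (- ?n - 1)"
    if "z \<noteq> 0" and h: "norm h \<le> norm z / 2" for z h
  proof -
    have far: "norm z / 2 \<le> norm u" if "u \<in> closed_segment z (z + h)" for u
    proof -
      from that have "norm (u - z) \<le> norm h"
        using segment_bound1[OF that] by simp
      moreover have "norm z \<le> norm u + norm (u - z)"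
        using norm_triangle_ineq4[of u "u - z"] by simp
      ultimately show ?thesis using h by linarith
    qed
    have "norm (k (z + h) - k z) \<le> (D * norm z powr (- ?n - 1)) * norm (z + h - z)"
    proof (rule differentiable_bound[where S = "closed_segment z (z + h)" and f' = k'])
      fix u assume u: "u \<in> closed_segment z (z + h)"
      have half: "norm z / 2 \<le> norm u" "0 < norm z / 2"
        using far[OF u] \<open>z \<noteq> 0\<close> by auto
      then have "u \<noteq> 0" by auto
      then show "(k has_derivative k' u) (at u within closed_segment z (z + h))"
        using deriv has_derivative_at_withinI by blast
      have "onorm (k' u) \<le> \<bar>C\<bar> * norm u powr (- ?n - 1)"
        by (rule order_trans[OF grad[OF \<open>u \<noteq> 0\<close>] mult_right_mono]) auto
      also have "\<dots> \<le> \<bar>C\<bar> * (norm z / 2) powr (- ?n - 1)"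
        using half by (intro mult_left_mono powr_mono2') auto
      also have "(norm z / 2) powr (- ?n - 1) = 2 powr (?n + 1) * norm z powr (- ?n - 1)"
        using powr_minus_divide[of 2 "?n + 1"] by (simp add: powr_divide)
      finally show "onorm (k' u) \<le> D * norm z powr (- ?n - 1)"
        by (simp add: D_def mult.assoc)
    qed auto
    then show ?thesis by (simp add: mult_ac)
  qed
  show ?thesis
    unfolding standard_kernel_def
  proof (rule exI[of _ "2 * D"], rule exI[of _ 1], intro conjI allI impI)
    fix x y :: 'a assume "x \<noteq> y"
    then have "norm (k (x - y)) \<le> C * norm (x - y) powr (- ?n)"
      using size by simp
    also have "\<dots> \<le> 2 * D * norm (x - y) powr (- ?n)"
      using D by (intro mult_right_mono) auto
    finally show "norm (k (x - y)) \<le> 2 * D * norm (x - y) powr (- ?n)" .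
  next
    fix x y h :: 'a assume "x \<noteq> y" and h: "norm h \<le> norm (x - y) / 2"
    have "norm (k (x - y + h) - k (x - y)) \<le> D * norm h * norm (x - y) powr (- ?n - 1)"
      and "norm (k (x - y + - h) - k (x - y)) \<le> D * norm (- h) * norm (x - y) powr (- ?n - 1)"
      using \<open>x \<noteq> y\<close> h diff[of "x - y" h] diff[of "x - y" "- h"] by simp_all
    then show "norm (k (x + h - y) - k (x - y)) + norm (k (x - (y + h)) - k (x - y))
        \<le> 2 * D * norm h powr 1 * norm (x - y) powr (- ?n - 1)"
      by (simp add: algebra_simps)
  qed auto
qed

section \<open>Extension by density\<close>

definition approximates ::
  "('a::euclidean_space \<Rightarrow> ennreal) \<Rightarrow> ('a \<Rightarrow> ennreal) \<Rightarrow> (nat \<Rightarrow> 'a \<Rightarrow> complex) \<Rightarrow> ('a \<Rightarrow> complex) \<Rightarrow> bool"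
  where "approximates p w \<phi> f \<longleftrightarrow>
     (\<forall>k. \<phi> k \<in> Linf_c) \<and> (\<lambda>k. wnorm p w (\<lambda>x. \<phi> k x - f x)) \<longlonglongrightarrow> 0"

text \<open>
  \<open>S\<close> is the extension of the restriction of \<open>T\<close> to \<^const>\<open>Linf_c\<close> to the whole space. The
  definition includes that \<^const>\<open>Linf_c\<close> is a dense subset, so that \<open>S f\<close> is determined almost
  everywhere by \<open>T\<close>. Constant sequences show that \<open>S\<close> agrees with \<open>T\<close> on \<^const>\<open>Linf_c\<close>.
\<close>

definition extension_by_density ::
  "('a::euclidean_space \<Rightarrow> ennreal) \<Rightarrow> ('a \<Rightarrow> ennreal) \<Rightarrow>
   (('a \<Rightarrow> complex) \<Rightarrow> 'a \<Rightarrow> complex) \<Rightarrow> (('a \<Rightarrow> complex) \<Rightarrow> 'a \<Rightarrow> complex) \<Rightarrow> bool" where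
  "extension_by_density p w T S \<longleftrightarrow>
     Linf_c \<subseteq> wLp p w \<and>
     (\<forall>f\<in>wLp p w. S f \<in> wLp p w \<and>
        (\<exists>\<phi>. approximates p w \<phi> f) \<and>
        (\<forall>\<phi>. approximates p w \<phi> f \<longrightarrow> (\<lambda>k. wnorm p w (\<lambda>x. T (\<phi> k) x - S f x)) \<longlonglongrightarrow> 0))"

end

theory Submission
  imports Defs
begin

text \<open>
  Since \<open>M\<close> is bounded on \<open>L\<^sup>p(w)\<close> and on the dual space, \<open>p\<close> stays away from \<open>1\<close> and \<open>\<infinity>\<close>. Hence bounded
  functions of compact support are dense, and the norm of \<open>T f\<close> is controlled by integrals
  \<open>\<integral> \<bar>T f\<bar> g\<close>. By Hoelder's inequality and the two bounds for \<open>M\<close> it is enough to show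
  \<open>\<integral> \<bar>T f\<bar> g \<le> C \<integral> M f \<cdot> M g\<close>. For this, \<open>T f\<close> differs on a dyadic cube \<open>Q\<close> from a constant
  \<open>c Q\<close> by at most \<open>C inf\<^sub>Q M f\<close> outside a small portion of \<open>Q\<close>: the part of \<open>f\<close> near \<open>Q\<close> is
  treated by the weak type \<open>(1,1)\<close> estimate and the other part by the regularity of the kernel. Iterating
  this on the maximal subcubes that meet the exceptional portion substantially, the main terms add up to
  \<open>\<integral> M f \<cdot> M g\<close>. On cubes that are large compared with the support of \<open>f\<close> one has \<open>c Q = 0\<close>.
\<close>

section \<open>Integrals and measures\<close>

text \<open>The estimate for the operator mentions neither \<open>p\<close> nor \<open>w\<close>;
  these enter only through Hoelder's inequality, duality and density, and each bound for M is used
  once there. The obstacle is that \<open>c Q\<close> changes from cube to cube. Two facts control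
  it. A cube and a selected subcube share a point that is exceptional for neither, so their
  constants differ by at most the two oscillation bounds. The selected subcubes fill at most half of
  their cube, so the main term of a cube can be charged to the rest of it, and these rests are
  disjoint over all generations. What survives k generations lives on a set of at most 2^-k times
  the original measure and vanishes in the limit because \<open>T f\<close> is square integrable.
  The duality argument tests with truncations, so finiteness of the norm of \<open>T f\<close> is a
  conclusion. That \<open>p\<close> avoids 1 reflects the logarithmic failure of M on L^1: N nested
  cubes make the integral of M over a set about N times too large. Applied to the conjugate
  exponent, the same fact keeps \<open>p\<close> bounded.\<close>

declare emeasure_completion [simp del]

lemma ident_borel_measurable_lebesgue [measurable]: "(\<lambda>x. x) \<in> borel_measurable lebesgue"
  by (rule measurable_completion) simp

lemma sets_lebesgue_ball [measurable]: "ball z r \<in> sets lebesgue"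
  by simp

lemma emeasure_lebesgue_ball:
  fixes z :: "'a::euclidean_space"
  assumes "0 \<le> r"
  shows "emeasure lebesgue (ball z r) = ennreal (unit_ball_vol (real DIM('a)) * r ^ DIM('a))"
  using emeasure_ball[OF assms, of z] by (simp add: emeasure_completion)

lemma emeasure_lebesgue_ball_pos:
  fixes z :: "'a::euclidean_space"
  assumes "0 < r"
  obtains m where "0 < m" "emeasure lebesgue (ball z r) = ennreal m" "m = unit_ball_vol (real DIM('a)) * r ^ DIM('a)"
  using assms by (intro that) (auto simp: emeasure_lebesgue_ball)

lemma ennreal_mult_mult:
  "0 \<le> a \<Longrightarrow> 0 \<le> b \<Longrightarrow> ennreal a * (ennreal b * x) = ennreal (a * b) * x"
  by (simp add: ennreal_mult mult.assoc)

lemma ennreal_divide_le_iff_le_mult: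
  assumes "0 < m"
  shows "X / ennreal m \<le> M \<longleftrightarrow> X \<le> M * ennreal m"
proof
  assume "X / ennreal m \<le> M"
  then have "X / ennreal m * ennreal m \<le> M * ennreal m" by (intro mult_right_mono) auto
  moreover have "X / ennreal m * ennreal m = X"
    using assms by (simp add: ennreal_divide_times)
  ultimately show "X \<le> M * ennreal m" by simp
next
  assume "X \<le> M * ennreal m"
  then have "X / ennreal m \<le> M * ennreal m / ennreal m" by (rule divide_right_mono_ennreal)
  then show "X / ennreal m \<le> M" using assms by (simp add: mult_divide_eq_ennreal)
qed

text \<open>Fits infima such as \<open>var_norm\<close>, where information is available only at real
  levels strictly above the value.\<close>

lemma ennreal_le_if_less_imp_le:
  fixes x y :: ennreal
  assumes "\<And>L. 0 < L \<Longrightarrow> y < ennreal L \<Longrightarrow> x \<le> ennreal L"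
  shows "x \<le> y"
proof (rule ccontr)
  assume "\<not> x \<le> y"
  then obtain z where z: "y < z" "z < x" using dense[of y x] by (auto simp: not_le)
  then obtain L where L: "z = ennreal L" "0 \<le> L" by (cases z) (auto simp: top_unique)
  with z have "0 < L" by (cases "L = 0") auto
  then have "x \<le> z" using assms[OF _ z(1)[unfolded L(1)]] unfolding L(1) by simp
  then show False using z(2) by simp
qed

lemma tendsto_zero_ennrealI:
  fixes X :: "'b \<Rightarrow> ennreal"
  assumes "\<And>e. 0 < e \<Longrightarrow> eventually (\<lambda>k. X k \<le> ennreal e) F"
  shows "(X \<longlongrightarrow> 0) F"
proof (rule order_tendstoI)
  fix l :: ennreal assume "0 < l"
  then obtain z where z: "0 < z" "z < l" using dense[of 0 l] by auto
  then obtain e where e: "z = ennreal e" "0 \<le> e" by (cases z) (auto simp: top_unique)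
  with z have "0 < e" by (cases "e = 0") auto
  from assms[OF this] show "eventually (\<lambda>k. X k < l) F"
    by eventually_elim (use z e in auto)
qed simp

text \<open>This is countable additivity of the measure with density \<open>u\<close>. The sum over
  the family is an integral over \<open>count_space\<close>, so that families of cubes need no
  enumeration.\<close>

lemma nn_integral_UN_disjoint_family:
  assumes I: "countable I" "disjoint_family_on X I" and X: "\<And>i. i \<in> I \<Longrightarrow> X i \<in> sets M"
    and u: "u \<in> borel_measurable M"
  shows "(\<integral>\<^sup>+x\<in>(\<Union>i\<in>I. X i). u x \<partial>M) = (\<integral>\<^sup>+i. (\<integral>\<^sup>+x\<in>X i. u x \<partial>M) \<partial>count_space I)"
proof -
  have U: "(\<Union>i\<in>I. X i) \<in> sets M"
    using assms by (intro sets.countable_UN') auto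
  have "emeasure (density M u) (\<Union>i\<in>I. X i) = (\<integral>\<^sup>+i. emeasure (density M u) (X i) \<partial>count_space I)"
    using assms by (intro emeasure_UN_countable) auto
  also have "\<dots> = (\<integral>\<^sup>+i. (\<integral>\<^sup>+x\<in>X i. u x \<partial>M) \<partial>count_space I)"
    using X u by (intro nn_integral_cong) (auto simp: emeasure_density)
  finally show ?thesis
    using U u by (simp add: emeasure_density)
qed

lemma nn_integral_UN_disjoint_sets:
  assumes "countable P" "disjoint P" "\<And>Q. Q \<in> P \<Longrightarrow> Q \<in> sets M" and "u \<in> borel_measurable M"
  shows "(\<integral>\<^sup>+x\<in>\<Union>P. u x \<partial>M) = (\<integral>\<^sup>+Q. (\<integral>\<^sup>+x\<in>Q. u x \<partial>M) \<partial>count_space P)"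
  using nn_integral_UN_disjoint_family[of P "\<lambda>Q. Q" M u] assms
  by (simp add: disjoint_family_on_def disjoint_def)

lemma emeasure_Union_disjoint_sets:
  assumes "countable P" "disjoint P" "\<And>Q. Q \<in> P \<Longrightarrow> Q \<in> sets M"
  shows "emeasure M (\<Union>P) = (\<integral>\<^sup>+Q. emeasure M Q \<partial>count_space P)"
proof -
  have U: "\<Union>P \<in> sets M"
    using assms by (intro sets.countable_Union) auto
  have "emeasure M (\<Union>P) = (\<integral>\<^sup>+x\<in>\<Union>P. 1 \<partial>M)"
    using U by simp
  also have "\<dots> = (\<integral>\<^sup>+Q. (\<integral>\<^sup>+x\<in>Q. 1 \<partial>M) \<partial>count_space P)"
    using assms by (intro nn_integral_UN_disjoint_sets) auto
  also have "\<dots> = (\<integral>\<^sup>+Q. emeasure M Q \<partial>count_space P)"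
    using assms by (intro nn_integral_cong) auto
  finally show ?thesis .
qed

lemma nn_integral_disjoint_union:
  assumes [measurable]: "u \<in> borel_measurable M" "A \<in> sets M" "B \<in> sets M" and "A \<inter> B = {}"
  shows "(\<integral>\<^sup>+x\<in>A \<union> B. u x \<partial>M) = (\<integral>\<^sup>+x\<in>A. u x \<partial>M) + (\<integral>\<^sup>+x\<in>B. u x \<partial>M)"
proof -
  have "(\<integral>\<^sup>+x\<in>A \<union> B. u x \<partial>M) = (\<integral>\<^sup>+x. u x * indicator A x + u x * indicator B x \<partial>M)"
    using assms(4) by (intro nn_integral_cong) (auto simp: indicator_def)
  then show ?thesis by (simp add: nn_integral_add)
qed

lemma nn_integral_set_mono: "A \<subseteq> B \<Longrightarrow> (\<integral>\<^sup>+x\<in>A. u x \<partial>M) \<le> (\<integral>\<^sup>+x\<in>B. u x \<partial>M)"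
  by (intro nn_integral_mono) (auto simp: indicator_def)

text \<open>Subadditivity for \<open>A \<subseteq> (A - B) \<union> B\<close>, where
  \<open>B\<close> may stick out of \<open>A\<close>. The bounds are real numbers, so the
  subtraction is not truncated.\<close>

lemma emeasure_Diff_ge_real:
  assumes "A \<in> sets M" "B \<in> sets M" "emeasure M A = ennreal q" "emeasure M B \<le> ennreal b" "0 \<le> b" "b \<le> q"
  shows "ennreal (q - b) \<le> emeasure M (A - B)"
proof (cases "emeasure M (A - B)")
  case (real r)
  have "emeasure M A \<le> emeasure M ((A - B) \<union> B)"
    using assms by (intro emeasure_mono) auto
  also have "\<dots> \<le> emeasure M (A - B) + emeasure M B"
    using assms by (intro emeasure_subadditive) auto
  also have "\<dots> \<le> ennreal r + ennreal b"
    using assms real by (intro add_mono) auto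
  also have "\<dots> = ennreal (r + b)"
    using assms real by (intro ennreal_plus[symmetric]) auto
  finally have "ennreal q \<le> ennreal (r + b)"
    unfolding assms(3) .
  then have "q \<le> r + b"
    using assms(5) real by (subst (asm) ennreal_le_iff) auto
  then show ?thesis
    using real by (simp add: ennreal_leI)
qed auto

lemma emeasure_Diff_ge_half:
  assumes "A \<in> sets M" "B \<in> sets M" "emeasure M A = ennreal q" "0 \<le> q"
    and "emeasure M B \<le> ennreal (1 / 2) * emeasure M A"
  shows "ennreal (q / 2) \<le> emeasure M (A - B)"
proof -
  have "ennreal (1 / 2) * ennreal q = ennreal (1 / 2 * q)"
    using assms by (intro ennreal_mult[symmetric]) auto
  then have "emeasure M B \<le> ennreal (q / 2)"
    using assms(3,5) by simp
  then have "ennreal (q - q / 2) \<le> emeasure M (A - B)"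
    using assms by (intro emeasure_Diff_ge_real) auto
  then show ?thesis by simp
qed

text \<open>Continuity from above for the differences with the first n members. It allows an
  operator that is additive for finite sums only to act on Calderon-Zygmund pieces.\<close>

lemma finite_subfamily_approx:
  assumes F: "countable F" "\<And>Q. Q \<in> F \<Longrightarrow> Q \<in> sets M" and fin: "emeasure M (\<Union>F) < \<infinity>" and \<eta>: "0 < \<eta>"
  obtains G where "finite G" "G \<subseteq> F" "emeasure M (\<Union>F - \<Union>G) < ennreal \<eta>"
proof (cases "F = {}")
  case True
  then show ?thesis using that[of "{}"] \<eta> by simp
next
  case False
  define G where "G n = from_nat_into F ` {..<n}" for n
  have G: "G n \<subseteq> F" for n
    using from_nat_into[OF False] by (auto simp: G_def)
  have UF: "\<Union>F \<in> sets M" using F by (intro sets.countable_Union) auto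
  have UG: "\<Union>(G n) \<in> sets M" for n using F G[of n] by (intro sets.finite_Union) (auto simp: G_def)
  have lim: "(\<lambda>n. emeasure M (\<Union>F - \<Union>(G n))) \<longlonglongrightarrow> emeasure M (\<Inter>n. \<Union>F - \<Union>(G n))"
  proof (rule Lim_emeasure_decseq)
    show "range (\<lambda>n. \<Union>F - \<Union>(G n)) \<subseteq> sets M" using UF UG by auto
    show "decseq (\<lambda>n. \<Union>F - \<Union>(G n))" by (force simp: decseq_def G_def)
    show "emeasure M (\<Union>F - \<Union>(G n)) \<noteq> \<infinity>" for n
      using emeasure_mono[of "\<Union>F - \<Union>(G n)" "\<Union>F" M] UF fin by (auto simp: top_unique)
  qed
  have empty: "(\<Inter>n. \<Union>F - \<Union>(G n)) = {}"
  proof -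
    have "x \<in> \<Union>(G (Suc (to_nat_on F Q)))" if "x \<in> Q" "Q \<in> F" for x Q
      using that F(1) by (auto simp: G_def intro!: exI[of _ "to_nat_on F Q"] bexI[of _ "to_nat_on F Q"])
    then show ?thesis by fastforce
  qed
  have "eventually (\<lambda>n. emeasure M (\<Union>F - \<Union>(G n)) < ennreal \<eta>) sequentially"
    using \<eta> by (intro order_tendstoD(2)[OF lim[unfolded empty]]) auto
  then obtain n where "emeasure M (\<Union>F - \<Union>(G n)) < ennreal \<eta>"
    by (auto simp: eventually_sequentially)
  then show ?thesis
    using that[of "G n"] G[of n] by (simp add: G_def)
qed

text \<open>Chebyshev's inequality, localised to \<open>S\<close>.\<close>

lemma emeasure_norm_greater_le:
  fixes h :: "'a \<Rightarrow> 'b::{banach, second_countable_topology}"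
  assumes [measurable]: "h \<in> borel_measurable M" "S \<in> sets M" and c: "0 < c"
  shows "emeasure M {x \<in> S. c < norm (h x)} \<le> ennreal (1 / c) * (\<integral>\<^sup>+x\<in>S. norm (h x) \<partial>M)"
proof -
  have eq: "{x \<in> S. c < norm (h x)} = S \<inter> {x \<in> space M. c < norm (h x)}"
    using sets.sets_into_space[OF assms(2)] by auto
  have m: "{x \<in> S. c < norm (h x)} \<in> sets M"
    unfolding eq by measurable
  have "emeasure M {x \<in> S. c < norm (h x)} = (\<integral>\<^sup>+x. indicator {x \<in> S. c < norm (h x)} x \<partial>M)"
    using m by simp
  also have "\<dots> \<le> (\<integral>\<^sup>+x. ennreal (1 / c) * (ennreal (norm (h x)) * indicator S x) \<partial>M)"
  proof (intro nn_integral_mono)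
    fix x
    show "indicator {x \<in> S. c < norm (h x)} x \<le> ennreal (1 / c) * (ennreal (norm (h x)) * indicator S x)"
    proof (cases "x \<in> S \<and> c < norm (h x)")
      case True
      then have "1 \<le> 1 / c * norm (h x)" using c by (simp add: field_simps)
      then show ?thesis
        using True ennreal_leI[of 1] c by (simp add: indicator_def flip: ennreal_mult)
    qed auto
  qed
  also have "\<dots> = ennreal (1 / c) * (\<integral>\<^sup>+x\<in>S. norm (h x) \<partial>M)"
    by (intro nn_integral_cmult) measurable
  finally show ?thesis .
qed

lemma sum_indicator_disjoint:
  assumes "finite G" "disjoint G"
  shows "(\<Sum>Q\<in>G. indicator Q y) = (indicator (\<Union>G) y :: 'b::semiring_1)"
proof (cases "y \<in> \<Union>G")
  case True
  then obtain Q where Q: "Q \<in> G" "y \<in> Q" by blast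
  then have "indicator Q' y = (0::'b)" if "Q' \<in> G - {Q}" for Q'
    using assms(2) that by (auto simp: disjoint_def indicator_def)
  then show ?thesis
    using Q True by (simp add: sum.remove[OF assms(1) Q(1)])
next
  case False
  then have "indicator Q y = (0::'b)" if "Q \<in> G" for Q
    using that by (auto simp: indicator_def)
  then show ?thesis using False by simp
qed

section \<open>Dyadic cubes\<close>

text \<open>The half-open cube of side \<open>t\<close> that contains \<open>x\<close> in the grid
  through the origin. As a class of a floor condition it is determined by any of its points, which
  turns disjointness and nesting into arithmetic.\<close>

definition grid_cube :: "real \<Rightarrow> 'a::euclidean_space \<Rightarrow> 'a set" where
  "grid_cube t x = {y. \<forall>i\<in>Basis. \<lfloor>(y \<bullet> i) / t\<rfloor> = \<lfloor>(x \<bullet> i) / t\<rfloor>}"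

lemma grid_cube_self [simp]: "x \<in> grid_cube t x"
  by (simp add: grid_cube_def)

lemma grid_cube_eq: "y \<in> grid_cube t x \<Longrightarrow> grid_cube t y = grid_cube t x"
  by (auto simp: grid_cube_def)

lemma floor_eq_iff_bounds:
  assumes "0 < t"
  shows "\<lfloor>a / t\<rfloor> = m \<longleftrightarrow> of_int m * t \<le> a \<and> a < of_int m * t + (t::real)"
proof -
  have "\<lfloor>a / t\<rfloor> = m \<longleftrightarrow> of_int m \<le> a / t \<and> a / t < of_int m + 1"
    by linarith
  then show ?thesis
    using assms by (simp add: field_simps)
qed

lemma grid_cube_bounds:
  assumes "0 < t"
  shows "grid_cube t x = {y. \<forall>i\<in>Basis. of_int \<lfloor>(x \<bullet> i) / t\<rfloor> * t \<le> y \<bullet> i \<and>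
    y \<bullet> i < of_int \<lfloor>(x \<bullet> i) / t\<rfloor> * t + t}"
  using assms by (simp add: grid_cube_def floor_eq_iff_bounds)

lemma sets_grid_cube [measurable]: "grid_cube t x \<in> sets lebesgue"
proof -
  have "{y. \<forall>i\<in>Basis. \<lfloor>(y \<bullet> i) / t\<rfloor> = \<lfloor>(x \<bullet> i) / t\<rfloor>} \<in> sets (borel :: 'a measure)"
    by measurable
  then show ?thesis
    by (simp add: grid_cube_def)
qed

text \<open>The cube lies between an open and a closed box of the same volume.\<close>

lemma emeasure_grid_cube:
  fixes x :: "'a::euclidean_space"
  assumes "0 < t"
  shows "emeasure lebesgue (grid_cube t x) = ennreal (t ^ DIM('a))"
proof -
  define a where "a = (\<Sum>i\<in>Basis. (of_int \<lfloor>(x \<bullet> i) / t\<rfloor> * t) *\<^sub>R i)"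
  define b where "b = a + (\<Sum>i\<in>Basis. t *\<^sub>R i)"
  have ab: "a \<bullet> i = of_int \<lfloor>(x \<bullet> i) / t\<rfloor> * t" "b \<bullet> i = a \<bullet> i + t" if "i \<in> Basis" for i
    using that by (auto simp: a_def b_def inner_simps inner_sum_left_Basis)
  have sub: "box a b \<subseteq> grid_cube t x" "grid_cube t x \<subseteq> cbox a b"
    using ab by (auto simp: grid_cube_bounds[OF assms] mem_box less_imp_le)
  have "emeasure lborel (box a b) = ennreal (t ^ DIM('a))" "emeasure lborel (cbox a b) = ennreal (t ^ DIM('a))"
    using assms ab by (auto simp: emeasure_lborel_box_eq emeasure_lborel_cbox_eq inner_diff_left)
  then have "emeasure lebesgue (box a b) = ennreal (t ^ DIM('a))" "emeasure lebesgue (cbox a b) = ennreal (t ^ DIM('a))"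
    by (auto simp: emeasure_completion)
  then show ?thesis
    using sub emeasure_mono[of "box a b" "grid_cube t x" lebesgue] emeasure_mono[of "grid_cube t x" "cbox a b" lebesgue]
    by auto
qed

text \<open>Summing coordinates gives the factor n rather than its square root. Hence the ball of
  radius n times the side around any point of a cube contains the cube, a fact used for all
  comparisons of cubes with balls.\<close>

lemma norm_diff_grid_cube:
  fixes x y z :: "'a::euclidean_space"
  assumes "0 < t" "x \<in> grid_cube t z" "y \<in> grid_cube t z"
  shows "norm (x - y) < real DIM('a) * t"
proof -
  have "norm (x - y) \<le> (\<Sum>i\<in>Basis. \<bar>(x - y) \<bullet> i\<bar>)"
    by (rule norm_le_l1)
  also have "\<dots> < (\<Sum>i\<in>(Basis::'a set). t)"
  proof (rule sum_strict_mono)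
    fix i :: 'a assume "i \<in> Basis"
    then show "\<bar>(x - y) \<bullet> i\<bar> < t"
      using assms by (auto simp: grid_cube_bounds[OF assms(1)] inner_diff_left abs_if dest!: bspec)
  qed auto
  finally show ?thesis by simp
qed

text \<open>Every cube contains a non-empty open box, hence a point of a countable dense set, and it
  is the cube of that point.\<close>

lemma countable_grid_cubes:
  assumes "0 < t"
  shows "countable (range (grid_cube t :: 'a::euclidean_space \<Rightarrow> _))"
proof -
  obtain D :: "'a set" where D: "countable D" "\<And>X. open X \<Longrightarrow> X \<noteq> {} \<Longrightarrow> \<exists>d\<in>D. d \<in> X"
    using countable_dense_setE by blast
  have "range (grid_cube t) \<subseteq> grid_cube t ` D"
  proof (safe)
    fix x :: 'a
    define a where "a = (\<Sum>i\<in>Basis. (of_int \<lfloor>(x \<bullet> i) / t\<rfloor> * t) *\<^sub>R i)"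
    define b where "b = a + (\<Sum>i\<in>Basis. t *\<^sub>R i)"
    have ab: "a \<bullet> i = of_int \<lfloor>(x \<bullet> i) / t\<rfloor> * t" "b \<bullet> i = a \<bullet> i + t" if "i \<in> Basis" for i
      using that by (auto simp: a_def b_def inner_simps inner_sum_left_Basis)
    have "box a b \<subseteq> grid_cube t x"
      using ab by (auto simp: grid_cube_bounds[OF assms] mem_box less_imp_le)
    moreover have "box a b \<noteq> {}"
      using ab assms by (simp add: box_ne_empty)
    ultimately obtain d where "d \<in> D" "d \<in> grid_cube t x"
      using D(2)[of "box a b"] by auto
    then show "grid_cube t x \<in> grid_cube t ` D"
      using grid_cube_eq by blast
  qed
  then show ?thesis
    using D(1) by (meson countable_image countable_subset)
qed

text \<open>The largest side \<open>s\<close> is a parameter and \<open>j\<close> a natural number: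
  each chain of cubes through a point has a top, so maximal cubes exist without any growth
  condition, and \<open>s\<close> can be adapted to the support of a function.\<close>

abbreviation dcube :: "real \<Rightarrow> nat \<Rightarrow> 'a::euclidean_space \<Rightarrow> 'a set" where
  "dcube s j \<equiv> grid_cube (s / 2 ^ j)"

lemma dcube_mono:
  assumes "i \<le> j"
  shows "dcube s j x \<subseteq> dcube s i x"
proof
  fix y assume y: "y \<in> dcube s j x"
  \<comment> \<open>The floor at the coarser scale is an integer quotient of the floor at the finer
    scale, so agreement at the finer scale passes to the coarser one.\<close>
  have fl: "\<lfloor>a / (s / 2 ^ i)\<rfloor> = \<lfloor>a / (s / 2 ^ j)\<rfloor> div 2 ^ (j - i)" for a
  proof -
    have "(2::real) ^ j = 2 ^ i * 2 ^ (j - i)"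
      using assms by (simp flip: power_add)
    then have "a / (s / 2 ^ i) = (a / (s / 2 ^ j)) / of_int (2 ^ (j - i))"
      by simp
    then show ?thesis
      by (metis floor_divide_real_eq_div zero_le_numeral zero_le_power)
  qed
  show "y \<in> dcube s i x"
    using y unfolding grid_cube_def mem_Collect_eq fl by simp
qed

text \<open>Through each point take the cube with the first \<open>j\<close> for which
  \<open>P\<close> holds. Two such cubes with a common point are nested, and minimality for the
  smaller one forbids a proper ancestor with \<open>P\<close>, so they coincide.\<close>

lemma maximal_dcubes:
  fixes P :: "'a::euclidean_space set \<Rightarrow> bool"
  assumes "0 < s"
  obtains F where "countable F" "disjoint F" "\<Union>F = {x. \<exists>j. P (dcube s j x)}"
    "\<And>Q. Q \<in> F \<Longrightarrow> P Q \<and> (\<exists>j x. Q = dcube s j x \<and> (\<forall>i<j. \<not> P (dcube s i x)))"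
proof
  define F where "F = {dcube s j x | j x. P (dcube s j x) \<and> (\<forall>i<j. \<not> P (dcube s i x))}"
  show "countable F"
    using assms by (intro countable_subset[of F "\<Union>j. range (dcube s j)"])
      (auto simp: F_def intro!: countable_UN countable_grid_cubes)
  show "disjoint F"
    unfolding disjoint_def
  proof (intro ballI impI, rule ccontr)
    fix Q R assume "Q \<in> F" "R \<in> F" "Q \<noteq> R" "Q \<inter> R \<noteq> {}"
    then obtain z where z: "z \<in> Q" "z \<in> R" by blast
    obtain j x where Q: "Q = dcube s j x" "P Q" "\<forall>i<j. \<not> P (dcube s i x)"
      using \<open>Q \<in> F\<close> by (auto simp: F_def)
    obtain i y where R: "R = dcube s i y" "P R" "\<forall>k<i. \<not> P (dcube s k y)"
      using \<open>R \<in> F\<close> by (auto simp: F_def)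
    note * = Q R z
    have **: "dcube s k z = dcube s k x" if "k \<le> j" for k
      using *(1,7) dcube_mono[OF that, of s x] by (intro grid_cube_eq) auto
    have ***: "dcube s k z = dcube s k y" if "k \<le> i" for k
      using *(4,8) dcube_mono[OF that, of s y] by (intro grid_cube_eq) auto
    have "\<not> i < j" "\<not> j < i"
      using * **[of i] ***[of i] **[of j] ***[of j] by auto
    then have "i = j" by simp
    then show False
      using * **[of j] ***[of j] \<open>Q \<noteq> R\<close> by simp
  qed
  show "\<Union>F = {x. \<exists>j. P (dcube s j x)}"
  proof safe
    fix x Q assume "x \<in> Q" "Q \<in> F"
    then show "\<exists>j. P (dcube s j x)"
      using grid_cube_eq[of x] by (auto simp: F_def) metis
  next
    fix x j assume "P (dcube s j x)"
    then have "dcube s (LEAST j. P (dcube s j x)) x \<in> F"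
      using LeastI[of "\<lambda>j. P (dcube s j x)"] not_less_Least[of _ "\<lambda>j. P (dcube s j x)"]
      by (auto simp: F_def)
    then show "x \<in> \<Union>F"
      by (meson UnionI grid_cube_self)
  qed
  show "\<And>Q. Q \<in> F \<Longrightarrow> P Q \<and> (\<exists>j x. Q = dcube s j x \<and> (\<forall>i<j. \<not> P (dcube s i x)))"
    by (auto simp: F_def)
qed

lemma emeasure_dcube_Suc:
  fixes x :: "'a::euclidean_space"
  assumes "0 < s"
  shows "emeasure lebesgue (dcube s j x) = ennreal (2 ^ DIM('a)) * emeasure lebesgue (dcube s (Suc j) x)"
  using assms by (simp add: emeasure_grid_cube power_divide power_mult_distrib flip: ennreal_mult)

lemma dcube_subset_ball:
  fixes x :: "'a::euclidean_space"
  assumes "0 < s" "0 < e"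
  shows "\<exists>j. dcube s j x \<subseteq> ball x e"
proof -
  have "(\<lambda>j. real DIM('a) * s * (1 / 2) ^ j) \<longlonglongrightarrow> real DIM('a) * s * 0"
    by (intro tendsto_mult tendsto_const LIMSEQ_power_zero) auto
  then have "eventually (\<lambda>j. real DIM('a) * s * (1 / 2) ^ j < e) sequentially"
    using assms by (intro order_tendstoD(2)) auto
  then obtain j where "real DIM('a) * s * (1 / 2) ^ j < e"
    by (auto simp: eventually_sequentially)
  then have j: "real DIM('a) * (s / 2 ^ j) < e"
    by (simp add: power_divide)
  have "dcube s j x \<subseteq> ball x e"
  proof
    fix y assume "y \<in> dcube s j x"
    from norm_diff_grid_cube[OF _ grid_cube_self this] assms j show "y \<in> ball x e"
      by (simp add: dist_norm)
  qed
  then show ?thesis ..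
qed

text \<open>These are the maximal cubes inside \<open>U\<close>. Every point of \<open>U\<close>
  lies in one because the cubes through it shrink to it.\<close>

lemma open_eq_Union_dcubes:
  fixes U :: "'a::euclidean_space set"
  assumes "0 < s" "open U"
  obtains F where "countable F" "disjoint F" "\<Union>F = U" "\<And>Q. Q \<in> F \<Longrightarrow> \<exists>j x. Q = dcube s j x"
proof -
  obtain F where F: "countable F" "disjoint F" "\<Union>F = {x. \<exists>j. dcube s j x \<subseteq> U}"
    "\<And>Q. Q \<in> F \<Longrightarrow> Q \<subseteq> U \<and> (\<exists>j x. Q = dcube s j x \<and> (\<forall>i<j. \<not> dcube s i x \<subseteq> U))"
    by (rule maximal_dcubes[OF assms(1), where P = "\<lambda>Q. Q \<subseteq> U"]) (rule that)
  have "{x. \<exists>j. dcube s j x \<subseteq> U} = U"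
  proof safe
    fix x j assume "dcube s j x \<subseteq> U"
    then show "x \<in> U" using grid_cube_self by blast
  next
    fix x assume "x \<in> U"
    then obtain e where "0 < e" "ball x e \<subseteq> U"
      using assms(2) openE by blast
    then show "\<exists>j. dcube s j x \<subseteq> U"
      using dcube_subset_ball[OF assms(1)] by (meson order_trans)
  qed
  then show ?thesis
    using F(1,2,3) F(4) by (intro that[of F]) (blast | simp)+
qed

text \<open>Takes the place of Lebesgue differentiation and rests on outer regularity: if
  \<open>u\<close> exceeded some \<beta> > \<alpha> on a bounded part \<open>W\<close> of
  \<open>Z\<close> with positive measure, a slightly larger open set \<open>U\<close>, cut into
  cubes, would give \<beta> |W| \<le> \<alpha> |U| < \<beta> |W|.\<close>

lemma AE_le_if_dcube_averages_le:
  fixes u :: "'a::euclidean_space \<Rightarrow> ennreal"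
  assumes s: "0 < s" and \<alpha>: "0 < \<alpha>" and u [measurable]: "u \<in> borel_measurable lebesgue"
    and Z [measurable]: "Z \<in> sets lebesgue"
    and avg: "\<And>x j. x \<in> Z \<Longrightarrow> (\<integral>\<^sup>+y\<in>dcube s j x. u y \<partial>lebesgue) \<le> ennreal \<alpha> * emeasure lebesgue (dcube s j x)"
  shows "AE x in lebesgue. x \<in> Z \<longrightarrow> u x \<le> ennreal \<alpha>"
proof -
  have null: "emeasure lebesgue (Z \<inter> {x \<in> space lebesgue. ennreal \<beta> < u x \<and> norm x \<le> R}) = 0" if \<beta>: "\<alpha> < \<beta>" for \<beta> R
  proof (rule ccontr)
    define W where "W = (Z \<inter> {x \<in> space lebesgue. ennreal \<beta> < u x \<and> norm x \<le> R})"
    assume "emeasure lebesgue (Z \<inter> {x \<in> space lebesgue. ennreal \<beta> < u x \<and> norm x \<le> R}) \<noteq> 0"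
    then have pos: "emeasure lebesgue W \<noteq> 0" by (simp add: W_def)
    have W [measurable]: "W \<in> sets lebesgue"
      unfolding W_def by measurable
    have "emeasure lebesgue W \<le> emeasure lebesgue (cball (0::'a) R)"
      by (intro emeasure_mono) (use W_def in auto)
    also have "\<dots> < \<infinity>"
      using emeasure_lborel_cball_finite[of "0::'a" R] by (simp add: emeasure_completion)
    finally obtain m where m: "emeasure lebesgue W = ennreal m" "0 \<le> m"
      by (cases "emeasure lebesgue W") auto
    with pos have m0: "0 < m" by (cases "m = 0") auto
    \<comment> \<open>With this excess \<alpha> (m + e) = \<beta> m, which makes the covering
      estimate contradictory.\<close>
    define e where "e = (\<beta> / \<alpha> - 1) * m"
    have "0 < e" using \<alpha> \<beta> m0 by (simp add: e_def)
    obtain U where U: "open U" "W \<subseteq> U" "emeasure lebesgue (U - W) < ennreal e"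
      using sets_lebesgue_outer_open[OF W \<open>0 < e\<close>] by metis
    have Um [measurable]: "U \<in> sets lebesgue" using U(1) by (metis borel_open sets_completionI_sets sets_lborel)
    obtain F where F: "countable F" "disjoint F" "\<Union>F = U" "\<And>Q. Q \<in> F \<Longrightarrow> \<exists>j x. Q = dcube s j x"
      using open_eq_Union_dcubes[OF s U(1)] by metis
    have Fm: "Q \<in> sets lebesgue" if "Q \<in> F" for Q using F(4)[OF that] by auto
    \<comment> \<open>A cube that misses \<open>W\<close> contributes nothing; any other is the cube
      of a point of \<open>W\<close>, hence of \<open>Z\<close>, where the hypothesis on averages
      applies.\<close>
    have cube: "(\<integral>\<^sup>+y\<in>Q. (u y * indicator W y) \<partial>lebesgue) \<le> ennreal \<alpha> * emeasure lebesgue Q" if "Q \<in> F" for Q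
    proof (cases "Q \<inter> W = {}")
      case True
      then have "(\<integral>\<^sup>+y\<in>Q. (u y * indicator W y) \<partial>lebesgue) = nn_integral lebesgue (\<lambda>y::'a. 0)"
        by (intro nn_integral_cong) (auto simp: indicator_def)
      then show ?thesis by simp
    next
      case False
      then obtain y where y: "y \<in> Q" "y \<in> W" by auto
      obtain j x where "Q = dcube s j x" using F(4)[OF \<open>Q \<in> F\<close>] by auto
      with y have Q: "Q = dcube s j y" using grid_cube_eq by blast
      have "(\<integral>\<^sup>+y\<in>Q. (u y * indicator W y) \<partial>lebesgue) \<le> (\<integral>\<^sup>+y\<in>Q. u y \<partial>lebesgue)"
        by (intro nn_integral_mono) (auto simp: indicator_def)
      also have "\<dots> \<le> ennreal \<alpha> * emeasure lebesgue Q"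
        using avg[of y j] y Q by (simp add: W_def)
      finally show ?thesis .
    qed
    have "ennreal \<beta> * ennreal m = (\<integral>\<^sup>+y\<in>W. ennreal \<beta> \<partial>lebesgue)"
      using m by (simp add: nn_integral_cmult_indicator)
    also have "\<dots> \<le> (\<integral>\<^sup>+y\<in>U. (u y * indicator W y) \<partial>lebesgue)"
      using U(2) by (intro nn_integral_mono) (auto simp: indicator_def W_def)
    also have "\<dots> = (\<integral>\<^sup>+Q. (\<integral>\<^sup>+y\<in>Q. (u y * indicator W y) \<partial>lebesgue) \<partial>count_space F)"
      unfolding F(3)[symmetric] using F Fm by (intro nn_integral_UN_disjoint_sets) auto
    also have "\<dots> \<le> (\<integral>\<^sup>+Q. ennreal \<alpha> * emeasure lebesgue Q \<partial>count_space F)"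
      using cube by (intro nn_integral_mono) auto
    also have "\<dots> = ennreal \<alpha> * emeasure lebesgue U"
      using emeasure_Union_disjoint_sets[OF F(1,2) Fm] F(3) by (simp add: nn_integral_cmult)
    also have "emeasure lebesgue U = emeasure lebesgue W + emeasure lebesgue (U - W)"
      using U(2) by (simp add: plus_emeasure Un_absorb1)
    also have "ennreal \<alpha> * \<dots> < ennreal \<alpha> * (ennreal m + ennreal e)"
      using U(3) m \<alpha> by (intro ennreal_mult_strict_left_mono) (auto simp: ennreal_add_left_cancel_less)
    also have "\<dots> = ennreal (\<alpha> * (m + e))"
      using \<alpha> m0 \<open>0 < e\<close> by (simp add: ennreal_mult)
    also have "\<alpha> * (m + e) = \<beta> * m"
      using \<alpha> by (simp add: e_def field_simps)
    finally show False
      using \<alpha> \<beta> m0 by (simp add: ennreal_mult)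
  qed
  \<comment> \<open>The levels \<alpha> + 1/(k+1) together with the radii k exhaust the set where
    \<open>u\<close> exceeds \<alpha>.\<close>
  have "AE x in lebesgue. \<forall>k::nat. \<not> (x \<in> Z \<and> ennreal (\<alpha> + 1 / real (Suc k)) < u x \<and> norm x \<le> real k)"
    unfolding AE_all_countable
  proof
    fix k :: nat
    have "Z \<inter> {x \<in> space lebesgue. ennreal (\<alpha> + 1 / real (Suc k)) < u x \<and> norm x \<le> real k} \<in> sets lebesgue"
      by measurable
    then have "Z \<inter> {x \<in> space lebesgue. ennreal (\<alpha> + 1 / real (Suc k)) < u x \<and> norm x \<le> real k} \<in> null_sets lebesgue"
      using null[of "\<alpha> + 1 / real (Suc k)" "real k"] by auto
    from AE_not_in[OF this] show "AE x in lebesgue. \<not> (x \<in> Z \<and> ennreal (\<alpha> + 1 / real (Suc k)) < u x \<and> norm x \<le> real k)"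
      by simp
  qed
  then show ?thesis
  proof eventually_elim
    case (elim x)
    show ?case
    proof
    assume "x \<in> Z"
    have "u x \<le> ennreal (\<alpha> + 1 / real (Suc k))" if "real k \<ge> norm x" for k
      using elim that \<open>x \<in> Z\<close> by (auto simp: not_less)
    moreover obtain k0 :: nat where "norm x \<le> real k0"
      using real_arch_simple by blast
    ultimately have ev: "eventually (\<lambda>k. u x \<le> ennreal (\<alpha> + 1 / real (Suc k))) sequentially"
      by (auto simp: eventually_sequentially intro!: exI[of _ k0])
    have "(\<lambda>k. ennreal (\<alpha> + 1 / real (Suc k))) \<longlonglongrightarrow> ennreal (\<alpha> + 0)"
      by (intro tendsto_ennrealI tendsto_add tendsto_const LIMSEQ_Suc[OF lim_1_over_n])
    then show "u x \<le> ennreal \<alpha>"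
      using ev by (intro tendsto_lowerbound[of _ _ sequentially]) auto
    qed
  qed
qed

text \<open>The Calderon-Zygmund decomposition at height \<alpha>, stopping at the first cube with a
  large average. The hypothesis \<open>top\<close> excludes j = 0, so a selected cube has a parent
  with average at most \<alpha>, whence the factor 2^n.\<close>

lemma calderon_zygmund_cubes:
  fixes u :: "'a::euclidean_space \<Rightarrow> ennreal"
  assumes s: "0 < s" and \<alpha>: "0 < \<alpha>" and u [measurable]: "u \<in> borel_measurable lebesgue"
    and top: "\<And>x. (\<integral>\<^sup>+y\<in>dcube s 0 x. u y \<partial>lebesgue) \<le> ennreal \<alpha> * emeasure lebesgue (dcube s 0 x)"
  obtains F where "countable F" "disjoint F"
    "\<And>Q. Q \<in> F \<Longrightarrow> (\<exists>j x. Q = dcube s j x) \<and>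
       ennreal \<alpha> * emeasure lebesgue Q < (\<integral>\<^sup>+y\<in>Q. u y \<partial>lebesgue) \<and>
       (\<integral>\<^sup>+y\<in>Q. u y \<partial>lebesgue) \<le> ennreal (2 ^ DIM('a) * \<alpha>) * emeasure lebesgue Q"
    "AE x in lebesgue. x \<notin> \<Union>F \<longrightarrow> u x \<le> ennreal \<alpha>"
proof -
  define P where "P Q \<longleftrightarrow> ennreal \<alpha> * emeasure lebesgue Q < (\<integral>\<^sup>+y\<in>Q. u y \<partial>lebesgue)" for Q
  obtain F where F: "countable F" "disjoint F" "\<Union>F = {x. \<exists>j. P (dcube s j x)}"
    "\<And>Q. Q \<in> F \<Longrightarrow> P Q \<and> (\<exists>j x. Q = dcube s j x \<and> (\<forall>i<j. \<not> P (dcube s i x)))"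
    by (rule maximal_dcubes[OF s, where P = P]) (rule that)
  have Fm: "Q \<in> sets lebesgue" if "Q \<in> F" for Q using F(4)[OF that] by auto
  have "\<Union>F \<in> sets lebesgue"
    using F(1) Fm by (intro sets.countable_Union) auto
  then have Z: "- \<Union>F \<in> sets lebesgue"
    using sets.compl_sets[of "\<Union>F" lebesgue] by (simp add: Compl_eq_Diff_UNIV)
  show ?thesis
  proof (rule that[of F])
    show "AE x in lebesgue. x \<notin> \<Union>F \<longrightarrow> u x \<le> ennreal \<alpha>"
    proof -
      have "\<not> P (dcube s j x)" if "x \<in> - \<Union>F" for x j
        using that unfolding F(3) by blast
      then have "AE x in lebesgue. x \<in> - \<Union>F \<longrightarrow> u x \<le> ennreal \<alpha>"
        by (intro AE_le_if_dcube_averages_le[OF s \<alpha> u Z]) (simp add: P_def not_less)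
      then show ?thesis by simp
    qed
  next
    fix Q assume "Q \<in> F"
    then obtain j x where Q: "P Q" "Q = dcube s j x" "\<forall>i<j. \<not> P (dcube s i x)"
      using F(4) by metis
    have "j \<noteq> 0"
      using Q(1,2) top[of x] by (metis P_def not_le)
    then obtain i where j: "j = Suc i"
      by (cases j) auto
    have "(\<integral>\<^sup>+y\<in>Q. u y \<partial>lebesgue) \<le> (\<integral>\<^sup>+y\<in>dcube s i x. u y \<partial>lebesgue)"
      using dcube_mono[of i j s x] Q(2) j by (intro nn_integral_mono) (auto simp: indicator_def)
    also have "\<dots> \<le> ennreal \<alpha> * emeasure lebesgue (dcube s i x)"
      using Q(3) j by (auto simp: P_def not_less)
    also have "\<dots> = ennreal (2 ^ DIM('a) * \<alpha>) * emeasure lebesgue Q"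
      using emeasure_dcube_Suc[OF s, of i x] \<alpha> Q(2) j by (simp add: ennreal_mult mult_ac)
    finally show "(\<exists>j x. Q = dcube s j x) \<and>
       ennreal \<alpha> * emeasure lebesgue Q < (\<integral>\<^sup>+y\<in>Q. u y \<partial>lebesgue) \<and>
       (\<integral>\<^sup>+y\<in>Q. u y \<partial>lebesgue) \<le> ennreal (2 ^ DIM('a) * \<alpha>) * emeasure lebesgue Q"
      using Q by (auto simp: P_def)
  qed (rule F(1) F(2))+
qed

section \<open>Singular integrals of bounded functions\<close>

lemma ex_dyadic_annulus:
  fixes d R :: real
  assumes "0 < R" "R \<le> d"
  obtains j where "2 ^ j * R \<le> d" "d < 2 ^ Suc j * R"
proof -
  obtain k where "d / R < 2 ^ k"
    using real_arch_pow[of 2 "d / R"] by auto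
  then have k: "d < 2 ^ k * R"
    using assms by (simp add: field_simps)
  define m where "m = (LEAST k. d < 2 ^ k * R)"
  have m: "d < 2 ^ m * R" "\<And>i. i < m \<Longrightarrow> \<not> d < 2 ^ i * R"
    using LeastI[of "\<lambda>k. d < 2 ^ k * R", OF k] not_less_Least unfolding m_def by blast+
  with assms obtain j where "m = Suc j"
    by (cases m) auto
  with m show ?thesis
    by (intro that[of j]) (auto simp: not_less)
qed

text \<open>The geometric series 2^n times the sum of 2^(-j \<epsilon>): one term for each annulus,
  with 2^n as the price of replacing an annulus by the ball around it.\<close>

definition tail_const :: "nat \<Rightarrow> real \<Rightarrow> real" where
  "tail_const n \<epsilon> = 2 ^ n / (1 - 2 powr - \<epsilon>)"

lemma tail_const_nonneg: "0 < \<epsilon> \<Longrightarrow> 0 \<le> tail_const n \<epsilon>"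
  using powr_mono[of "- \<epsilon>" 0 2] by (simp add: tail_const_def)

text \<open>On the annulus between the radii 2^j R and 2^(j+1) R the weight is at most 2^(-j
  \<epsilon>) (2^j R)^(-n), while the hypothesis bounds the mass of \<open>u\<close> there by m
  (2^(j+1) R)^n.\<close>

lemma nn_integral_tail_le:
  fixes u :: "'a::euclidean_space \<Rightarrow> ennreal" and z :: 'a
  assumes \<epsilon>: "0 < \<epsilon>" and R: "0 < R" and u [measurable]: "u \<in> borel_measurable lebesgue"
    and ball: "\<And>\<rho>. R \<le> \<rho> \<Longrightarrow> (\<integral>\<^sup>+y\<in>ball z \<rho>. u y \<partial>lebesgue) \<le> m * ennreal (\<rho> ^ DIM('a))"
  shows "(\<integral>\<^sup>+y\<in>- ball z R. (ennreal (R powr \<epsilon> * norm (z - y) powr (- real DIM('a) - \<epsilon>)) * u y) \<partial>lebesgue)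
    \<le> ennreal (tail_const DIM('a) \<epsilon>) * m"
proof -
  let ?n = "DIM('a)"
  define c where "c j = (2 powr - \<epsilon>) ^ j / (2 ^ j * R) ^ ?n" for j :: nat
  have c0: "0 \<le> c j" for j using R by (simp add: c_def)
  have pw: "ennreal (R powr \<epsilon> * norm (z - y) powr (- real ?n - \<epsilon>)) * u y * indicator (- ball z R) y
    \<le> (\<Sum>j. ennreal (c j) * (u y * indicator (ball z (2 ^ Suc j * R)) y))" for y
  proof (cases "y \<in> ball z R")
    case False
    then have "R \<le> norm (z - y)" by (simp add: dist_norm)
    from ex_dyadic_annulus[OF R this] obtain j where
      j: "2 ^ j * R \<le> norm (z - y)" "norm (z - y) < 2 ^ Suc j * R" by blast
    have jR: "0 < 2 ^ j * R" using R by simp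
    have "R powr \<epsilon> * norm (z - y) powr (- real ?n - \<epsilon>) \<le> R powr \<epsilon> * (2 ^ j * R) powr (- real ?n - \<epsilon>)"
      using j R \<epsilon> by (intro mult_left_mono powr_mono2') auto
    also have "(2 ^ j * R) powr (- real ?n - \<epsilon>) = (2 ^ j * R) powr (- \<epsilon>) * (2 ^ j * R) powr (- real ?n)"
      using powr_add[of "2 ^ j * R" "- \<epsilon>" "- real ?n"] by (simp add: minus_diff_commute)
    also have "(2 ^ j * R) powr (- real ?n) = 1 / (2 ^ j * R) ^ ?n"
      using jR by (simp add: powr_minus_divide powr_realpow)
    also have "(2 ^ j * R) powr (- \<epsilon>) = (2 powr - \<epsilon>) ^ j * R powr (- \<epsilon>)"
      using R by (simp add: powr_mult powr_powr mult.commute flip: powr_realpow)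
    also have "R powr \<epsilon> * ((2 powr - \<epsilon>) ^ j * R powr (- \<epsilon>) * (1 / (2 ^ j * R) ^ ?n)) = c j"
      using R by (simp add: c_def powr_minus field_simps)
    finally have "ennreal (R powr \<epsilon> * norm (z - y) powr (- real ?n - \<epsilon>)) * u y * indicator (- ball z R) y
      \<le> ennreal (c j) * (u y * indicator (ball z (2 ^ Suc j * R)) y)"
      using False j by (auto simp: indicator_def dist_norm intro!: mult_right_mono ennreal_leI)
    also have "\<dots> \<le> (\<Sum>j. ennreal (c j) * (u y * indicator (ball z (2 ^ Suc j * R)) y))"
      using sum_le_suminf[of "\<lambda>j. ennreal (c j) * (u y * indicator (ball z (2 ^ Suc j * R)) y)" "{j}"]
      by auto
    finally show ?thesis .
  qed auto
  have "(\<integral>\<^sup>+y\<in>- ball z R. (ennreal (R powr \<epsilon> * norm (z - y) powr (- real ?n - \<epsilon>)) * u y) \<partial>lebesgue)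
    \<le> (\<integral>\<^sup>+y. (\<Sum>j. ennreal (c j) * (u y * indicator (ball z (2 ^ Suc j * R)) y)) \<partial>lebesgue)"
    by (intro nn_integral_mono pw)
  also have "\<dots> = (\<Sum>j. \<integral>\<^sup>+y. ennreal (c j) * (u y * indicator (ball z (2 ^ Suc j * R)) y) \<partial>lebesgue)"
    by (intro nn_integral_suminf) measurable
  also have "\<dots> = (\<Sum>j. ennreal (c j) * (\<integral>\<^sup>+y\<in>ball z (2 ^ Suc j * R). u y \<partial>lebesgue))"
    by (intro suminf_cong nn_integral_cmult) measurable
  also have "\<dots> \<le> (\<Sum>j. ennreal (2 ^ ?n * (2 powr - \<epsilon>) ^ j) * m)"
  proof (intro suminf_le summableI)
    fix j
    have "R \<le> 2 ^ Suc j * R"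
      using R by (metis less_imp_le mult.commute mult_left_le_one_le mult_le_cancel_right1 not_le one_le_power one_le_numeral)
    then have "ennreal (c j) * (\<integral>\<^sup>+y\<in>ball z (2 ^ Suc j * R). u y \<partial>lebesgue)
      \<le> ennreal (c j) * (m * ennreal ((2 ^ Suc j * R) ^ ?n))"
      by (intro mult_left_mono ball) auto
    also have "\<dots> = ennreal (c j * (2 ^ Suc j * R) ^ ?n) * m"
      using c0[of j] R by (simp add: ennreal_mult mult_ac)
    also have "c j * (2 ^ Suc j * R) ^ ?n = 2 ^ ?n * (2 powr - \<epsilon>) ^ j"
      using R by (simp add: c_def power_mult_distrib field_simps)
    finally show "ennreal (c j) * (\<integral>\<^sup>+y\<in>ball z (2 ^ Suc j * R). u y \<partial>lebesgue)
      \<le> ennreal (2 ^ ?n * (2 powr - \<epsilon>) ^ j) * m" .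
  qed
  also have "\<dots> = ennreal (tail_const ?n \<epsilon>) * m"
  proof -
    have q: "norm (2 powr - \<epsilon>) < 1"
      using \<epsilon> by (simp add: powr_minus_divide divide_simps)
    have "(\<lambda>j. 2 ^ ?n * (2 powr - \<epsilon>) ^ j) sums (2 ^ ?n * (1 / (1 - 2 powr - \<epsilon>)))"
      by (intro sums_mult geometric_sums q)
    then have "(\<lambda>j. 2 ^ ?n * (2 powr - \<epsilon>) ^ j) sums tail_const ?n \<epsilon>"
      by (simp add: tail_const_def)
    then have "(\<Sum>j. ennreal (2 ^ ?n * (2 powr - \<epsilon>) ^ j)) = ennreal (tail_const ?n \<epsilon>)"
      by (intro suminf_ennreal_eq) auto
    then show ?thesis
      by simp
  qed
  finally show ?thesis .
qed

section \<open>Square-integrable functions and bounded functions of compact support\<close>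

lemma L2_iff:
  "f \<in> L2 \<longleftrightarrow> f \<in> borel_measurable lebesgue \<and> (\<integral>\<^sup>+x. ennreal ((norm (f x))\<^sup>2) \<partial>lebesgue) < \<infinity>"
  unfolding L2_def by (auto simp: integrable_iff_bounded)

lemma nn_integral_eq_L2_norm:
  assumes "f \<in> L2"
  shows "(\<integral>\<^sup>+x. ennreal ((norm (f x))\<^sup>2) \<partial>lebesgue) = ennreal ((L2_norm f)\<^sup>2)"
proof -
  have "integrable lebesgue (\<lambda>x. (norm (f x))\<^sup>2)"
    using assms by (simp add: L2_def)
  then show ?thesis
    by (simp add: nn_integral_eq_integral L2_norm_def)
qed

lemma Linf_cD:
  assumes "f \<in> Linf_c"
  shows "f \<in> borel_measurable lebesgue" "\<exists>B\<ge>0. \<forall>x. norm (f x) \<le> B" "\<exists>R>0. \<forall>x. f x \<noteq> 0 \<longrightarrow> norm x < R"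
proof -
  show "f \<in> borel_measurable lebesgue"
    using assms by (simp add: Linf_c_def)
  obtain B where "\<forall>x. norm (f x) \<le> B"
    using assms by (auto simp: Linf_c_def bounded_iff)
  then show "\<exists>B\<ge>0. \<forall>x. norm (f x) \<le> B"
    using norm_ge_zero order_trans by blast
  obtain R where R: "\<forall>x\<in>supp f. norm x \<le> R"
    using assms by (auto simp: Linf_c_def dest!: compact_imp_bounded simp: bounded_iff)
  have "norm x < max 1 (R + 1)" if "f x \<noteq> 0" for x
  proof -
    have "x \<in> supp f"
      using that closure_subset unfolding supp_def by fastforce
    with R show ?thesis by fastforce
  qed
  then show "\<exists>R>0. \<forall>x. f x \<noteq> 0 \<longrightarrow> norm x < R"
    by (intro exI[of _ "max 1 (R + 1)"]) auto
qed

lemma Linf_cI: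
  assumes "f \<in> borel_measurable lebesgue" "\<And>x. norm (f x) \<le> B" "\<And>x. f x \<noteq> 0 \<Longrightarrow> norm x \<le> R"
  shows "f \<in> Linf_c"
proof -
  have "supp f \<subseteq> cball 0 R"
    unfolding supp_def using assms(3) by (intro closure_minimal) auto
  then have "compact (supp f)"
    by (auto simp: supp_def compact_eq_bounded_closed intro: bounded_subset[OF bounded_cball])
  then show ?thesis
    using assms by (auto simp: Linf_c_def bounded_iff)
qed

lemma Linf_c_dominated:
  assumes "f \<in> Linf_c" "g \<in> borel_measurable lebesgue" "\<And>x. norm (g x) \<le> c * norm (f x)"
  shows "g \<in> Linf_c"
proof -
  obtain B R where B: "0 \<le> B" "\<And>x. norm (f x) \<le> B" and R: "\<And>x. f x \<noteq> 0 \<Longrightarrow> norm x < R"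
    using Linf_cD[OF assms(1)] by metis
  show ?thesis
  proof (rule Linf_cI[of g "\<bar>c\<bar> * B" R])
    show "norm (g x) \<le> \<bar>c\<bar> * B" for x
    proof -
      have "norm (g x) \<le> c * norm (f x)" by fact
      also have "\<dots> \<le> \<bar>c\<bar> * B" using B by (intro mult_mono) auto
      finally show ?thesis .
    qed
    show "norm x \<le> R" if "g x \<noteq> 0" for x
      using assms(3)[of x] R[of x] that by (cases "f x = 0") auto
  qed fact
qed

lemma Linf_c_add:
  assumes f: "f \<in> Linf_c" and g: "g \<in> Linf_c"
  shows "(\<lambda>y. f y + g y) \<in> Linf_c"
proof -
  obtain B1 R1 where 1: "\<And>x. norm (f x) \<le> B1" "\<And>x. f x \<noteq> 0 \<Longrightarrow> norm x < R1"
    using Linf_cD[OF f] by metis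
  obtain B2 R2 where 2: "\<And>x. norm (g x) \<le> B2" "\<And>x. g x \<noteq> 0 \<Longrightarrow> norm x < R2"
    using Linf_cD[OF g] by metis
  have [measurable]: "f \<in> borel_measurable lebesgue" "g \<in> borel_measurable lebesgue"
    using f g by (auto simp: Linf_c_def)
  show ?thesis
  proof (rule Linf_cI)
    show "norm (f x + g x) \<le> B1 + B2" for x
      using 1 2 by (meson add_mono norm_triangle_le)
    show "norm x \<le> max R1 R2" if "f x + g x \<noteq> 0" for x
      using 1(2)[of x] 2(2)[of x] that by (cases "f x = 0") (auto simp: le_max_iff_disj)
  qed measurable
qed

lemma Linf_c_zero: "(\<lambda>_. 0) \<in> Linf_c"
  by (rule Linf_cI[of _ 0 0]) auto

lemma Linf_c_sum:
  assumes "finite F" "\<And>i. i \<in> F \<Longrightarrow> f i \<in> Linf_c"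
  shows "(\<lambda>y. \<Sum>i\<in>F. f i y) \<in> Linf_c"
  using assms by (induction F rule: finite_induct) (auto simp: Linf_c_zero intro: Linf_c_add)

lemma Linf_c_indicator:
  assumes "f \<in> Linf_c" "S \<in> sets lebesgue"
  shows "(\<lambda>x. f x * indicator S x) \<in> Linf_c"
proof (rule Linf_c_dominated[OF assms(1), where c = 1])
  have [measurable]: "f \<in> borel_measurable lebesgue" "S \<in> sets lebesgue"
    using assms by (auto simp: Linf_c_def)
  show "(\<lambda>x. f x * indicator S x) \<in> borel_measurable lebesgue"
    by measurable
qed (auto simp: indicator_def)

lemma nn_integral_norm_Linf_c:
  fixes f :: "'a::euclidean_space \<Rightarrow> complex"
  assumes "f \<in> Linf_c"
  shows "(\<integral>\<^sup>+x. ennreal (norm (f x)) \<partial>lebesgue) < \<infinity>"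
proof -
  obtain B R where B: "0 \<le> B" "\<And>x. norm (f x) \<le> B" and R: "0 < R" "\<And>x. f x \<noteq> 0 \<Longrightarrow> norm x < R"
    using Linf_cD[OF assms] by metis
  have "(\<integral>\<^sup>+x. ennreal (norm (f x)) \<partial>lebesgue) \<le> (\<integral>\<^sup>+x. ennreal B * indicator (ball (0::'a) R) x \<partial>lebesgue)"
    using B R by (intro nn_integral_mono) (auto simp: indicator_def intro: ennreal_leI)
  also have "\<dots> = ennreal B * emeasure lebesgue (ball (0::'a) R)"
    by (simp add: nn_integral_cmult_indicator)
  also have "\<dots> < \<infinity>"
    using R by (simp add: emeasure_lebesgue_ball ennreal_mult_less_top)
  finally show ?thesis .
qed

lemma integrable_Linf_c: "f \<in> Linf_c \<Longrightarrow> integrable lebesgue f"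
  using nn_integral_norm_Linf_c[of f] Linf_cD(1)[of f] by (auto simp: integrable_iff_bounded)

lemma Linf_c_subset_L2: "f \<in> Linf_c \<Longrightarrow> f \<in> L2"
proof -
  assume f: "f \<in> Linf_c"
  then obtain B where B: "0 \<le> B" "\<And>x. norm (f x) \<le> B"
    using Linf_cD by metis
  have [measurable]: "f \<in> borel_measurable lebesgue"
    using f by (simp add: Linf_c_def)
  have "(\<integral>\<^sup>+x. ennreal ((norm (f x))\<^sup>2) \<partial>lebesgue) \<le> (\<integral>\<^sup>+x. ennreal B * ennreal (norm (f x)) \<partial>lebesgue)"
    using B by (intro nn_integral_mono) (auto simp: power2_eq_square mult_right_mono simp flip: ennreal_mult intro!: ennreal_leI)
  also have "\<dots> = ennreal B * (\<integral>\<^sup>+x. ennreal (norm (f x)) \<partial>lebesgue)"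
    by (intro nn_integral_cmult) measurable
  also have "\<dots> < \<infinity>"
    using nn_integral_norm_Linf_c[OF f] by (simp add: ennreal_mult_less_top)
  finally show "f \<in> L2"
    by (simp add: L2_iff)
qed

section \<open>Calderon-Zygmund operators with a fixed kernel and fixed constants\<close>

locale cz_operator =
  fixes T :: "('a::euclidean_space \<Rightarrow> complex) \<Rightarrow> 'a \<Rightarrow> complex"
    and K :: "'a \<Rightarrow> 'a \<Rightarrow> complex" and A C \<epsilon> :: real
  assumes T_L2: "f \<in> L2 \<Longrightarrow> T f \<in> L2"
    and T_add: "f \<in> L2 \<Longrightarrow> g \<in> L2 \<Longrightarrow> AE x in lebesgue. T (\<lambda>y. f y + g y) x = T f x + T g x"
    and T_cmult: "f \<in> L2 \<Longrightarrow> AE x in lebesgue. T (\<lambda>y. c * f y) x = c * T f x"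
    and T_bound: "f \<in> L2 \<Longrightarrow> L2_norm (T f) \<le> A * L2_norm f"
    and A: "0 \<le> A" and C: "0 \<le> C" and \<epsilon>: "0 < \<epsilon>"
    and K_size: "x \<noteq> y \<Longrightarrow> norm (K x y) \<le> C * norm (x - y) powr (- real DIM('a))"
    and K_smooth: "x \<noteq> y \<Longrightarrow> norm h \<le> norm (x - y) / 2 \<Longrightarrow>
          norm (K (x + h) y - K x y) + norm (K x (y + h) - K x y)
            \<le> C * norm h powr \<epsilon> * norm (x - y) powr (- real DIM('a) - \<epsilon>)"
    and T_kernel: "f \<in> Linf_c \<Longrightarrow> AE x in lebesgue. x \<notin> supp f \<longrightarrow> T f x = (LINT y|lebesgue. K x y * f y)"

text \<open>The constants hidden in the definitions may be negative; passing to absolute values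
  preserves the bounds and makes them non-negative.\<close>

lemma calderon_zygmund_imp_cz_operator:
  assumes "calderon_zygmund T"
  obtains K A C \<epsilon> where "cz_operator T K A C \<epsilon>"
proof -
  obtain K where K: "L2_bounded_linear T" "standard_kernel K" "has_kernel T K"
    using assms by (auto simp: calderon_zygmund_def)
  obtain A where A: "\<forall>f\<in>L2. L2_norm (T f) \<le> A * L2_norm f"
    using K(1) by (auto simp: L2_bounded_linear_def)
  obtain C \<epsilon> where C: "0 < \<epsilon>"
    "\<forall>x y. x \<noteq> y \<longrightarrow> norm (K x y) \<le> C * norm (x - y) powr (- real DIM('a))"
    "\<forall>x y h. x \<noteq> y \<longrightarrow> norm h \<le> norm (x - y) / 2 \<longrightarrow>
          norm (K (x + h) y - K x y) + norm (K x (y + h) - K x y)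
            \<le> C * norm h powr \<epsilon> * norm (x - y) powr (- real DIM('a) - \<epsilon>)"
    using K(2) by (auto simp: standard_kernel_def)
  have "cz_operator T K \<bar>A\<bar> \<bar>C\<bar> \<epsilon>"
  proof
    fix f assume "f \<in> (L2 :: ('a \<Rightarrow> complex) set)"
    then have "L2_norm (T f) \<le> A * L2_norm f" using A by auto
    also have "\<dots> \<le> \<bar>A\<bar> * L2_norm f"
      by (intro mult_right_mono) (auto simp: L2_norm_def)
    finally show "L2_norm (T f) \<le> \<bar>A\<bar> * L2_norm f" .
  next
    fix x y :: 'a assume xy: "x \<noteq> y"
    have "norm (K x y) \<le> C * norm (x - y) powr (- real DIM('a))" using C(2) xy by blast
    also have "\<dots> \<le> \<bar>C\<bar> * norm (x - y) powr (- real DIM('a))"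
      by (intro mult_right_mono) auto
    finally show "norm (K x y) \<le> \<bar>C\<bar> * norm (x - y) powr (- real DIM('a))" .
    fix h :: 'a assume h: "norm h \<le> norm (x - y) / 2"
    have "norm (K (x + h) y - K x y) + norm (K x (y + h) - K x y)
            \<le> C * norm h powr \<epsilon> * norm (x - y) powr (- real DIM('a) - \<epsilon>)" using C(3) xy h by blast
    also have "\<dots> \<le> \<bar>C\<bar> * norm h powr \<epsilon> * norm (x - y) powr (- real DIM('a) - \<epsilon>)"
      by (intro mult_right_mono) auto
    finally show "norm (K (x + h) y - K x y) + norm (K x (y + h) - K x y)
            \<le> \<bar>C\<bar> * norm h powr \<epsilon> * norm (x - y) powr (- real DIM('a) - \<epsilon>)" .
  qed (use K C(1) in \<open>auto simp: L2_bounded_linear_def has_kernel_def\<close>)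
  then show ?thesis by (rule that)
qed

context cz_operator
begin

lemma T_measurable: "f \<in> L2 \<Longrightarrow> T f \<in> borel_measurable lebesgue"
  using T_L2 by (simp add: L2_def)

text \<open>The squared form with non-negative integrals can be chained with later estimates without
  integrability conditions.\<close>

lemma T_bound_nn:
  assumes "f \<in> L2"
  shows "(\<integral>\<^sup>+x. ennreal ((norm (T f x))\<^sup>2) \<partial>lebesgue)
    \<le> ennreal (A\<^sup>2) * (\<integral>\<^sup>+x. ennreal ((norm (f x))\<^sup>2) \<partial>lebesgue)"
proof -
  have "(L2_norm (T f))\<^sup>2 \<le> (A * L2_norm f)\<^sup>2"
    by (intro power_mono T_bound assms) (simp add: L2_norm_def)
  then show ?thesis
    using assms T_L2[OF assms]
    by (auto simp: nn_integral_eq_L2_norm power_mult_distrib simp flip: ennreal_mult intro!: ennreal_leI)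
qed

lemma T_weak_L2:
  assumes f: "f \<in> L2" and t: "0 < t"
  shows "emeasure lebesgue {x. t < norm (T f x)}
    \<le> ennreal (A\<^sup>2 / t\<^sup>2) * (\<integral>\<^sup>+x. ennreal ((norm (f x))\<^sup>2) \<partial>lebesgue)"
proof -
  have [measurable]: "T f \<in> borel_measurable lebesgue"
    using T_measurable[OF f] .
  have "{x\<in>space lebesgue. t < norm (T f x)} \<in> sets lebesgue"
    by measurable
  then have m: "{x. t < norm (T f x)} \<in> sets lebesgue"
    by simp
  have "emeasure lebesgue {x. t < norm (T f x)} = (\<integral>\<^sup>+x. indicator {x. t < norm (T f x)} x \<partial>lebesgue)"
    using m by simp
  also have "\<dots> \<le> (\<integral>\<^sup>+x. ennreal (1 / t\<^sup>2) * ennreal ((norm (T f x))\<^sup>2) \<partial>lebesgue)"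
  proof (intro nn_integral_mono)
    fix x
    show "indicator {x. t < norm (T f x)} x \<le> ennreal (1 / t\<^sup>2) * ennreal ((norm (T f x))\<^sup>2)"
    proof (cases "t < norm (T f x)")
      case True
      then have "t\<^sup>2 \<le> (norm (T f x))\<^sup>2" using t by (intro power_mono) auto
      then have "1 \<le> 1 / t\<^sup>2 * (norm (T f x))\<^sup>2" using t by (simp add: field_simps)
      then show ?thesis
        using ennreal_leI[of 1] by (simp add: indicator_def flip: ennreal_mult)
    qed auto
  qed
  also have "\<dots> = ennreal (1 / t\<^sup>2) * (\<integral>\<^sup>+x. ennreal ((norm (T f x))\<^sup>2) \<partial>lebesgue)"
    by (intro nn_integral_cmult) measurable
  also have "\<dots> \<le> ennreal (1 / t\<^sup>2) * (ennreal (A\<^sup>2) * (\<integral>\<^sup>+x. ennreal ((norm (f x))\<^sup>2) \<partial>lebesgue))"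
    by (intro mult_left_mono T_bound_nn f) auto
  also have "\<dots> = ennreal (A\<^sup>2 / t\<^sup>2) * (\<integral>\<^sup>+x. ennreal ((norm (f x))\<^sup>2) \<partial>lebesgue)"
    by (simp add: mult.assoc[symmetric] ennreal_mult[symmetric])
  finally show ?thesis .
qed

lemma T_zero: "AE x in lebesgue. T (\<lambda>_. 0) x = 0"
proof -
  have "(\<lambda>_. 0) \<in> (L2 :: ('a \<Rightarrow> complex) set)"
    by (simp add: L2_iff)
  from T_cmult[OF this, of 0] show ?thesis by simp
qed

text \<open>Additivity is given for two summands and up to a null set, so algebra alone extends it
  to finite sums and no further.\<close>

lemma T_sum:
  assumes "finite F" "\<And>i. i \<in> F \<Longrightarrow> f i \<in> Linf_c"
  shows "AE x in lebesgue. T (\<lambda>y. \<Sum>i\<in>F. f i y) x = (\<Sum>i\<in>F. T (f i) x)"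
  using assms
proof (induction F rule: finite_induct)
  case empty
  then show ?case using T_zero by simp
next
  case (insert i F)
  have "AE x in lebesgue. T (\<lambda>y. f i y + (\<Sum>i\<in>F. f i y)) x = T (f i) x + T (\<lambda>y. \<Sum>i\<in>F. f i y) x"
    using insert by (intro T_add Linf_c_subset_L2 Linf_c_sum) auto
  moreover have "AE x in lebesgue. T (\<lambda>y. \<Sum>i\<in>F. f i y) x = (\<Sum>i\<in>F. T (f i) x)"
    using insert by auto
  ultimately show ?case
    using insert(1,2) by (auto elim: eventually_elim2)
qed

text \<open>Regularity in the second variable makes \<open>K x\<close> continuous away from
  \<open>x\<close>, and a single exceptional point does not affect measurability.\<close>

lemma K_measurable: "K x \<in> borel_measurable lebesgue"
proof -
  have "continuous_on (- {x}) (K x)"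
  proof (rule continuous_at_imp_continuous_on, rule ballI)
    fix y assume "y \<in> - {x}"
    then have xy: "x \<noteq> y" by auto
    have "((\<lambda>h. C * norm h powr \<epsilon> * norm (x - y) powr (- real DIM('a) - \<epsilon>)) \<longlongrightarrow>
        C * 0 powr \<epsilon> * norm (x - y) powr (- real DIM('a) - \<epsilon>)) (at 0)"
      using \<epsilon> by (intro tendsto_intros tendsto_norm_zero tendsto_powr') (auto intro: tendsto_norm_zero)
    then have lim: "((\<lambda>h. C * norm h powr \<epsilon> * norm (x - y) powr (- real DIM('a) - \<epsilon>)) \<longlongrightarrow> 0) (at 0)"
      by simp
    have "eventually (\<lambda>h::'a. norm h < norm (x - y) / 2) (at 0)"
      using xy by (intro order_tendstoD(2)[of _ 0]) (auto intro!: tendsto_norm_zero)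
    then have "eventually (\<lambda>h. norm (K x (y + h) - K x y) \<le>
        C * norm h powr \<epsilon> * norm (x - y) powr (- real DIM('a) - \<epsilon>)) (at 0)"
    proof eventually_elim
      case (elim h)
      then show ?case
        using K_smooth[OF xy, of h] norm_ge_zero[of "K (x + h) y - K x y"] by linarith
    qed
    then have "((\<lambda>h. K x (y + h) - K x y) \<longlongrightarrow> 0) (at 0)"
      using lim by (rule Lim_null_comparison)
    then have "((\<lambda>h. K x (y + h)) \<longlongrightarrow> K x y) (at 0)"
      by (simp add: LIM_zero_iff)
    then show "isCont (K x) y"
      by (simp add: isCont_iff)
  qed
  then have "K x \<in> borel_measurable borel"
    by (intro borel_measurable_continuous_countable_exceptions[of "{x}"]) auto
  then show ?thesis
    by (intro measurable_completion) simp
qed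

text \<open>At distance at least \<delta> from \<open>x\<close> the kernel is bounded by
  \<open>C\<close> times \<delta>^(-n).\<close>

lemma integrable_kernel:
  assumes f: "f \<in> Linf_c" and \<delta>: "0 < \<delta>" "\<And>y. f y \<noteq> 0 \<Longrightarrow> \<delta> \<le> norm (x - y)"
  shows "integrable lebesgue (\<lambda>y. K x y * f y)"
proof (rule Bochner_Integration.integrable_bound)
  have [measurable]: "f \<in> borel_measurable lebesgue" "K x \<in> borel_measurable lebesgue"
    using f K_measurable by (auto simp: Linf_c_def)
  show "(\<lambda>y. K x y * f y) \<in> borel_measurable lebesgue"
    by measurable
  show "integrable lebesgue (\<lambda>y. (C * \<delta> powr (- real DIM('a))) * norm (f y))"
    using integrable_Linf_c[OF f] by simp
  show "AE y in lebesgue. norm (K x y * f y) \<le> norm ((C * \<delta> powr (- real DIM('a))) * norm (f y))"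
  proof (rule AE_I2)
    fix y
    show "norm (K x y * f y) \<le> norm ((C * \<delta> powr (- real DIM('a))) * norm (f y))"
    proof (cases "f y = 0")
      case False
      then have d: "\<delta> \<le> norm (x - y)" using \<delta> by blast
      then have "x \<noteq> y" using \<delta>(1) by auto
      then have "norm (K x y) \<le> C * norm (x - y) powr (- real DIM('a))"
        by (rule K_size)
      also have "\<dots> \<le> C * \<delta> powr (- real DIM('a))"
        using \<delta>(1) d C by (intro mult_left_mono powr_mono2') auto
      finally show ?thesis
        using C by (simp add: norm_mult mult_right_mono)
    qed auto
  qed
qed

text \<open>Since \<open>b\<close> has mean zero, \<open>K x z\<close> may be subtracted from the
  kernel. Regularity in the second variable then gives a decay in \<open>x\<close> that is
  integrable outside the double ball.\<close>

lemma T_atom_bound: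
  assumes b: "b \<in> Linf_c" and r: "0 < r" and ball: "\<And>y. b y \<noteq> 0 \<Longrightarrow> norm (y - z) < r"
    and mean: "(LINT y|lebesgue. b y) = 0"
  shows "(\<integral>\<^sup>+x\<in>- ball z (2 * r). norm (T b x) \<partial>lebesgue)
    \<le> ennreal (C * tail_const DIM('a) \<epsilon> * unit_ball_vol (real DIM('a))) * (\<integral>\<^sup>+y. norm (b y) \<partial>lebesgue)"
proof -
  let ?n = "real DIM('a)"
  let ?I = "\<integral>\<^sup>+y. norm (b y) \<partial>lebesgue"
  have bm [measurable]: "b \<in> borel_measurable lebesgue"
    using b by (simp add: Linf_c_def)
  have Tm [measurable]: "T b \<in> borel_measurable lebesgue"
    using T_measurable[OF Linf_c_subset_L2[OF b]] .
  have supp: "supp b \<subseteq> cball z r"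
    unfolding supp_def using ball by (intro closure_minimal) (auto simp: dist_norm norm_minus_commute less_imp_le)
  have pw: "ennreal (norm (LINT y|lebesgue. K x y * b y))
     \<le> ennreal C * (ennreal ((2 * r) powr \<epsilon> * norm (z - x) powr (- ?n - \<epsilon>)) * ?I)"
    if x: "x \<notin> ball z (2 * r)" for x
  proof -
    have d: "2 * r \<le> norm (x - z)" using x by (simp add: dist_norm norm_minus_commute)
    then have xz: "x \<noteq> z" using r by auto
    have "r \<le> norm (x - y)" if "b y \<noteq> 0" for y
      using d ball[OF that] norm_triangle_ineq[of "x - y" "y - z"] by simp
    then have int: "integrable lebesgue (\<lambda>y. K x y * b y)"
      using integrable_kernel[OF b r] by blast
    have int2: "integrable lebesgue (\<lambda>y. K x z * b y)"
      using integrable_Linf_c[OF b] by simp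
    have "(LINT y|lebesgue. K x y * b y) = (LINT y|lebesgue. K x y * b y) - K x z * (LINT y|lebesgue. b y)"
      using mean by simp
    also have "\<dots> = (LINT y|lebesgue. K x y * b y - K x z * b y)"
      using int int2 by simp
    finally have "ennreal (norm (LINT y|lebesgue. K x y * b y))
      \<le> (\<integral>\<^sup>+y. norm (K x y * b y - K x z * b y) \<partial>lebesgue)"
      using integral_norm_bound_ennreal[OF Bochner_Integration.integrable_diff[OF int int2]] by simp
    also have "\<dots> \<le> (\<integral>\<^sup>+y. ennreal (C * ((2 * r) powr \<epsilon> * norm (z - x) powr (- ?n - \<epsilon>))) * norm (b y) \<partial>lebesgue)"
    proof (intro nn_integral_mono)
      fix y
      have "norm (K x y * b y - K x z * b y) \<le> C * ((2 * r) powr \<epsilon> * norm (z - x) powr (- ?n - \<epsilon>)) * norm (b y)"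
      proof (cases "b y = 0")
        case False
        then have y: "norm (y - z) < r" using ball by auto
        then have "norm (y - z) \<le> norm (x - z) / 2" using d by simp
        from K_smooth[OF xz this]
        have "norm (K x y - K x z) \<le> C * norm (y - z) powr \<epsilon> * norm (x - z) powr (- ?n - \<epsilon>)"
          using norm_ge_zero[of "K (x + (y - z)) z - K x z"] by (simp del: norm_ge_zero)
        also have "\<dots> \<le> C * (2 * r) powr \<epsilon> * norm (x - z) powr (- ?n - \<epsilon>)"
          using y r \<epsilon> C by (intro mult_right_mono mult_left_mono powr_mono2) auto
        finally have "norm (K x y - K x z) * norm (b y)
          \<le> C * (2 * r) powr \<epsilon> * norm (x - z) powr (- ?n - \<epsilon>) * norm (b y)"
          by (intro mult_right_mono) auto
        then show ?thesis
          by (simp add: left_diff_distrib[symmetric] norm_mult mult.assoc norm_minus_commute)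
      qed auto
      then show "ennreal (norm (K x y * b y - K x z * b y))
        \<le> ennreal (C * ((2 * r) powr \<epsilon> * norm (z - x) powr (- ?n - \<epsilon>))) * ennreal (norm (b y))"
        using C by (auto simp flip: ennreal_mult intro!: ennreal_leI)
    qed
    also have "\<dots> = ennreal (C * ((2 * r) powr \<epsilon> * norm (z - x) powr (- ?n - \<epsilon>))) * ?I"
      by (intro nn_integral_cmult) measurable
    also have "\<dots> = ennreal C * (ennreal ((2 * r) powr \<epsilon> * norm (z - x) powr (- ?n - \<epsilon>)) * ?I)"
      using C by (simp add: ennreal_mult mult.assoc)
    finally show ?thesis .
  qed
  have "(\<integral>\<^sup>+x\<in>- ball z (2 * r). norm (T b x) \<partial>lebesgue)
    \<le> (\<integral>\<^sup>+x. ennreal C * (ennreal ((2 * r) powr \<epsilon> * norm (z - x) powr (- ?n - \<epsilon>)) * ?I * indicator (- ball z (2 * r)) x) \<partial>lebesgue)"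
  proof (rule nn_integral_mono_AE)
    show "AE x in lebesgue. ennreal (norm (T b x)) * indicator (- ball z (2 * r)) x
      \<le> ennreal C * (ennreal ((2 * r) powr \<epsilon> * norm (z - x) powr (- ?n - \<epsilon>)) * ?I * indicator (- ball z (2 * r)) x)"
      using T_kernel[OF b]
    proof eventually_elim
      case (elim x)
      show ?case
      proof (cases "x \<in> ball z (2 * r)")
        case False
        then have "x \<notin> supp b" using supp r by auto
        then show ?thesis
          using elim pw[OF False] False by (simp add: mult.assoc)
      qed auto
    qed
  qed
  also have "\<dots> = ennreal C * (\<integral>\<^sup>+x\<in>- ball z (2 * r). (ennreal ((2 * r) powr \<epsilon> * norm (z - x) powr (- ?n - \<epsilon>)) * ?I) \<partial>lebesgue)"
    by (intro nn_integral_cmult) measurable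
  \<comment> \<open>The annulus estimate is used in the variable \<open>x\<close>, with the constant
    \<open>?I\<close> as the function to be summed. This is where the volume of the unit ball
    enters.\<close>
  also have "\<dots> \<le> ennreal C * (ennreal (tail_const DIM('a) \<epsilon>) * (ennreal (unit_ball_vol ?n) * ?I))"
  proof (intro mult_left_mono nn_integral_tail_le \<epsilon>)
    fix \<rho> assume "2 * r \<le> \<rho>"
    then have "0 \<le> \<rho>" using r by simp
    moreover have "(\<integral>\<^sup>+y\<in>ball z \<rho>. ?I \<partial>lebesgue) = ?I * emeasure lebesgue (ball z \<rho>)"
      by (intro nn_integral_cmult_indicator) simp
    ultimately show "(\<integral>\<^sup>+y\<in>ball z \<rho>. ?I \<partial>lebesgue) \<le> ennreal (unit_ball_vol ?n) * ?I * ennreal (\<rho> ^ DIM('a))"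
      by (simp add: emeasure_lebesgue_ball ennreal_mult mult_ac)
  qed (use r in auto)
  also have "\<dots> = ennreal (C * tail_const DIM('a) \<epsilon> * unit_ball_vol ?n) * ?I"
    using C tail_const_nonneg[OF \<epsilon>] by (simp add: ennreal_mult mult_ac)
  finally show ?thesis .
qed

end

section \<open>The weak type estimate\<close>

context cz_operator
begin

text \<open>
  Only a finite subfamily \<open>G\<close> of the Calderon-Zygmund cubes is used, so that \<open>b1\<close> is a finite sum of
  atoms and additivity of \<open>T\<close> suffices; the remaining part \<open>b2\<close> is small in \<open>L\<^sup>2\<close>.
\<close>

lemma weak_type_11_aux:
  assumes f: "f \<in> Linf_c" and t: "0 < t"
  shows "emeasure lebesgue {x. t < norm (T f x)} \<le>
    ennreal ((9 * A\<^sup>2 * 2 ^ DIM('a) + unit_ball_vol (real DIM('a)) * (2 * real DIM('a)) ^ DIM('a)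
      + 6 * (C * tail_const DIM('a) \<epsilon> * unit_ball_vol (real DIM('a)))) / t) * (\<integral>\<^sup>+x. norm (f x) \<partial>lebesgue)"
    (is "_ \<le> ennreal ((?W1 + ?W2 + 6 * ?W3) / t) * ?I")
proof -
  let ?n = "DIM('a)"
  have W3: "0 \<le> ?W3" using C tail_const_nonneg[OF \<epsilon>] by simp
  have [measurable]: "f \<in> borel_measurable lebesgue"
    using f by (simp add: Linf_c_def)
  obtain i where i: "?I = ennreal i" "0 \<le> i"
    using nn_integral_norm_Linf_c[OF f] by (cases ?I) auto
  \<comment> \<open>Top cubes must have averages at most \<open>t\<close>:
    \<open>s \<ge> i / t\<close> gives i \<le> t s, and \<open>s \<ge> 1\<close> gives s \<le>
    s^n.\<close>
  define s where "s = max 1 (i / t)"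
  have s: "0 < s" "1 \<le> s" "i / t \<le> s" by (auto simp: s_def)
  have "i \<le> t * s" using s(3) t by (simp add: field_simps)
  also have "s \<le> s ^ ?n" using s(2) by (simp add: self_le_power)
  finally have its: "i \<le> t * s ^ ?n" using t by simp
  have top: "(\<integral>\<^sup>+y\<in>dcube s 0 x. ennreal (norm (f y)) \<partial>lebesgue) \<le> ennreal t * emeasure lebesgue (dcube s 0 x)" for x
  proof -
    have "(\<integral>\<^sup>+y\<in>dcube s 0 x. ennreal (norm (f y)) \<partial>lebesgue) \<le> ?I"
      by (intro nn_integral_mono) (auto simp: indicator_def)
    also have "\<dots> \<le> ennreal t * emeasure lebesgue (dcube s 0 x)"
      using its s t by (simp add: i emeasure_grid_cube ennreal_leI flip: ennreal_mult)
    finally show ?thesis .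
  qed
  have um: "(\<lambda>x. ennreal (norm (f x))) \<in> borel_measurable lebesgue" by measurable
  obtain F where F: "countable F" "disjoint F"
    "\<And>Q. Q \<in> F \<Longrightarrow> (\<exists>j x. Q = dcube s j x) \<and>
       ennreal t * emeasure lebesgue Q < (\<integral>\<^sup>+y\<in>Q. ennreal (norm (f y)) \<partial>lebesgue) \<and>
       (\<integral>\<^sup>+y\<in>Q. ennreal (norm (f y)) \<partial>lebesgue) \<le> ennreal (2 ^ DIM('a) * t) * emeasure lebesgue Q"
    "AE x in lebesgue. x \<notin> \<Union>F \<longrightarrow> ennreal (norm (f x)) \<le> ennreal t"
    by (rule calderon_zygmund_cubes[OF s(1) t um top]) (rule that)
  have Fm [measurable]: "Q \<in> sets lebesgue" if "Q \<in> F" for Q using F(3)[OF that] by auto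
  have Fpos: "\<exists>q>0. emeasure lebesgue Q = ennreal q" if "Q \<in> F" for Q
  proof -
    obtain j x where "Q = dcube s j x" using F(3)[OF \<open>Q \<in> F\<close>] by blast
    then show ?thesis using s by (intro exI[of _ "(s / 2 ^ j) ^ ?n"]) (simp add: emeasure_grid_cube)
  qed
  define \<Omega> where "\<Omega> = \<Union>F"
  have \<Omega> [measurable]: "\<Omega> \<in> sets lebesgue"
    unfolding \<Omega>_def using F(1) Fm by (intro sets.countable_Union) auto
  \<comment> \<open>Each selected cube has mass above \<open>t\<close> times its measure; summation
    yields t |\<Omega>| \<le> \<open>?I\<close>.\<close>
  have "ennreal t * emeasure lebesgue \<Omega> = (\<integral>\<^sup>+Q. ennreal t * emeasure lebesgue Q \<partial>count_space F)"
    unfolding \<Omega>_def using F(1,2) Fm by (simp add: nn_integral_cmult emeasure_Union_disjoint_sets)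
  also have "\<dots> \<le> (\<integral>\<^sup>+Q. (\<integral>\<^sup>+y\<in>Q. ennreal (norm (f y)) \<partial>lebesgue) \<partial>count_space F)"
    using F(3) by (intro nn_integral_mono) (auto intro: less_imp_le)
  also have "\<dots> = (\<integral>\<^sup>+y\<in>\<Omega>. ennreal (norm (f y)) \<partial>lebesgue)"
    unfolding \<Omega>_def using F(1,2) Fm by (intro nn_integral_UN_disjoint_sets[symmetric]) auto
  also have "\<dots> \<le> ?I"
    by (intro nn_integral_mono) (auto simp: indicator_def)
  finally have "ennreal (1 / t) * (ennreal t * emeasure lebesgue \<Omega>) \<le> ennreal (1 / t) * ?I"
    by (intro mult_left_mono) auto
  then have \<Omega>I: "emeasure lebesgue \<Omega> \<le> ennreal (1 / t) * ?I"
    using t by (simp add: mult.assoc[symmetric] ennreal_mult[symmetric])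
  then have \<Omega>fin: "emeasure lebesgue \<Omega> < \<infinity>"
    using t by (auto simp: i ennreal_mult[symmetric] intro: le_less_trans)
  obtain B where B: "0 \<le> B" "\<And>x. norm (f x) \<le> B"
    using Linf_cD(2)[OF f] by auto
  \<comment> \<open>The ball around a point of \<open>Q\<close> with radius n times the side
    contains \<open>Q\<close>. Its double, outside of which the atom estimate works, has measure
    \<open>?W2\<close> times that of \<open>Q\<close>.\<close>
  obtain \<zeta> \<rho> where ball: "\<And>Q. Q \<in> F \<Longrightarrow> 0 < \<rho> Q \<and> Q \<subseteq> ball (\<zeta> Q) (\<rho> Q) \<and>
      emeasure lebesgue (ball (\<zeta> Q) (2 * \<rho> Q)) = ennreal ?W2 * emeasure lebesgue Q"
  proof -
    have "\<exists>z r. 0 < r \<and> Q \<subseteq> ball z r \<and> emeasure lebesgue (ball z (2 * r)) = ennreal ?W2 * emeasure lebesgue Q" if "Q \<in> F" for Q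
    proof -
      obtain j x where Q: "Q = dcube s j x" using F(3)[OF \<open>Q \<in> F\<close>] by blast
      have "Q \<subseteq> ball x (real ?n * (s / 2 ^ j))"
        using norm_diff_grid_cube[of "s / 2 ^ j", OF _ grid_cube_self] s by (auto simp: Q dist_norm)
      moreover have "emeasure lebesgue (ball x (2 * (real ?n * (s / 2 ^ j)))) = ennreal ?W2 * emeasure lebesgue Q"
        using s by (simp add: Q emeasure_lebesgue_ball emeasure_grid_cube power_mult_distrib power_divide flip: ennreal_mult)
      ultimately show ?thesis
        using s by (intro exI[of _ x] exI[of _ "real ?n * (s / 2 ^ j)"]) auto
    qed
    then show ?thesis using that by metis
  qed
  show ?thesis
  proof (rule ennreal_le_epsilon)
    fix e :: real assume e: "0 < e"
    \<comment> \<open>The part \<open>b2\<close> discarded below has squared L^2 norm at most B^2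
      \<eta>, so at level t/3 it costs at most \<kappa> \<eta> \<le> e. The summand 1 in the
      denominator covers \<kappa> = 0.\<close>
    define \<kappa> where "\<kappa> = 9 * A\<^sup>2 / t\<^sup>2 * B\<^sup>2"
    have \<kappa>: "0 \<le> \<kappa>" by (simp add: \<kappa>_def)
    define \<eta> where "\<eta> = e / (\<kappa> + 1)"
    have \<eta>: "0 < \<eta>" using e \<kappa> by (simp add: \<eta>_def)
    have "\<kappa> * e / (\<kappa> + 1) \<le> e"
      using e \<kappa> by (simp add: pos_divide_le_eq algebra_simps)
    then have \<eta>e: "9 * A\<^sup>2 / t\<^sup>2 * (B\<^sup>2 * \<eta>) \<le> e"
      by (simp add: \<eta>_def \<kappa>_def mult.assoc)
    obtain G where G: "finite G" "G \<subseteq> F" "emeasure lebesgue (\<Omega> - \<Union>G) < ennreal \<eta>"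
      using finite_subfamily_approx[OF F(1) Fm \<Omega>fin[unfolded \<Omega>_def] \<eta>] unfolding \<Omega>_def by blast
    have GF: "Q \<in> F" if "Q \<in> G" for Q using that G by blast
    have UG [measurable]: "\<Union>G \<in> sets lebesgue" using G GF Fm by (intro sets.finite_Union) auto
    have disjG: "disjoint_family_on (\<lambda>Q. Q) G"
      using F(2) G(2) by (auto simp: disjoint_family_on_def disjoint_def)
    have "disjoint G" using F(2) G(2) by (auto simp: disjoint_def)
    note indG = sum_indicator_disjoint[OF G(1) this]
    \<comment> \<open>The usual splitting into averages and atoms, except that on the selected cubes
      outside \<open>G\<close> the function \<open>f\<close> itself is set aside as
      \<open>b2\<close>.\<close>
    define av where "av Q = (LINT y|lebesgue. f y * indicator Q y) / complex_of_real (measure lebesgue Q)" for Q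
    define b where "b Q y = (f y - av Q) * indicator Q y" for Q y
    define g where "g y = f y * indicator (- \<Omega>) y + (\<Sum>Q\<in>G. av Q * indicator Q y)" for y
    define b1 where "b1 y = (\<Sum>Q\<in>G. b Q y)" for y
    define b2 where "b2 y = f y * indicator (\<Omega> - \<Union>G) y" for y
    have feq: "f = (\<lambda>y. g y + (b1 y + b2 y))"
    proof
      fix y
      have "(\<Sum>Q\<in>G. av Q * indicator Q y) + b1 y = (\<Sum>Q\<in>G. f y * indicator Q y)"
        unfolding b1_def b_def sum.distrib[symmetric] by (intro sum.cong) (auto simp: algebra_simps)
      also have "\<dots> = f y * indicator (\<Union>G) y"
        by (simp add: sum_distrib_left[symmetric] indG)
      finally have "g y + (b1 y + b2 y) = f y * indicator (- \<Omega>) y + f y * indicator (\<Union>G) y + f y * indicator (\<Omega> - \<Union>G) y"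
        by (simp add: g_def b2_def algebra_simps)
      also have "\<dots> = f y" using G(2) by (auto simp: indicator_def \<Omega>_def)
      finally show "f y = g y + (b1 y + b2 y)" ..
    qed
    have Qbdd: "norm y \<le> norm (\<zeta> Q) + \<rho> Q" if "y \<in> Q" "Q \<in> F" for y Q
    proof -
      have "norm (y - \<zeta> Q) < \<rho> Q" using ball[of Q] that by (auto simp: dist_norm norm_minus_commute)
      then show ?thesis using norm_triangle_ineq[of "y - \<zeta> Q" "\<zeta> Q"] by simp
    qed
    have avQ: "(\<lambda>y. av Q * indicator Q y) \<in> Linf_c" if "Q \<in> F" for Q
    proof (rule Linf_cI)
      show "(\<lambda>y. av Q * indicator Q y) \<in> borel_measurable lebesgue" using Fm[OF that] by measurable
      show "norm (av Q * indicator Q y) \<le> norm (av Q)" for y by (auto simp: indicator_def)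
      show "norm y \<le> norm (\<zeta> Q) + \<rho> Q" if "av Q * indicator Q y \<noteq> 0" for y
        using that Qbdd[OF _ \<open>Q \<in> F\<close>] by (auto simp: indicator_def split: if_splits)
    qed
    have fQ: "(\<lambda>y. f y * indicator S y) \<in> Linf_c" if "S \<in> sets lebesgue" for S
      using Linf_c_indicator[OF f that] .
    have bQ: "b Q \<in> Linf_c" if "Q \<in> F" for Q
    proof -
      have "(\<lambda>y. f y * indicator Q y + - 1 * (av Q * indicator Q y)) \<in> Linf_c"
      proof (rule Linf_c_add[OF fQ[OF Fm[OF that]]])
        show "(\<lambda>y. - 1 * (av Q * indicator Q y)) \<in> Linf_c"
          using avQ[OF that] by (rule Linf_c_dominated[where c = 1]) (use Fm[OF that] in auto)
      qed
      moreover have "b Q = (\<lambda>y. f y * indicator Q y + - 1 * (av Q * indicator Q y))"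
        by (auto simp: b_def algebra_simps)
      ultimately show ?thesis by simp
    qed
    have gL: "g \<in> Linf_c"
      unfolding g_def using avQ GF G(1) by (intro Linf_c_add fQ Linf_c_sum) (auto simp: Compl_in_sets_lebesgue)
    have b1L: "b1 \<in> Linf_c" unfolding b1_def using bQ GF G(1) by (intro Linf_c_sum) auto
    have b2L: "b2 \<in> Linf_c" unfolding b2_def by (intro fQ) measurable
    have [measurable]: "T g \<in> borel_measurable lebesgue" "T b1 \<in> borel_measurable lebesgue"
      "T b2 \<in> borel_measurable lebesgue" "T f \<in> borel_measurable lebesgue"
      using gL b1L b2L f by (auto intro!: T_measurable Linf_c_subset_L2)
    have TbQ [measurable]: "T (b Q) \<in> borel_measurable lebesgue" if "Q \<in> F" for Q
      using bQ[OF that] by (auto intro!: T_measurable Linf_c_subset_L2)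
    have "AE x in lebesgue. T (\<lambda>y. g y + (b1 y + b2 y)) x = T g x + T (\<lambda>y. b1 y + b2 y) x"
      by (intro T_add Linf_c_subset_L2 Linf_c_add gL b1L b2L)
    moreover have "AE x in lebesgue. T (\<lambda>y. b1 y + b2 y) x = T b1 x + T b2 x"
      by (intro T_add Linf_c_subset_L2 Linf_c_add gL b1L b2L)
    ultimately have split: "AE x in lebesgue. T f x = T g x + T b1 x + T b2 x"
      unfolding feq[symmetric] by eventually_elim simp
    have sumG: "(\<Sum>Q\<in>G. \<integral>\<^sup>+y\<in>Q. ennreal (norm (f y)) \<partial>lebesgue) = (\<integral>\<^sup>+y\<in>\<Union>G. ennreal (norm (f y)) \<partial>lebesgue)"
    proof -
      have "(\<Sum>Q\<in>G. \<integral>\<^sup>+y\<in>Q. ennreal (norm (f y)) \<partial>lebesgue) = (\<integral>\<^sup>+y. (\<Sum>Q\<in>G. ennreal (norm (f y)) * indicator Q y) \<partial>lebesgue)"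
        using GF by (intro nn_integral_sum[symmetric]) auto
      also have "\<dots> = (\<integral>\<^sup>+y\<in>\<Union>G. ennreal (norm (f y)) \<partial>lebesgue)"
        by (simp add: sum_distrib_left[symmetric] indG)
      finally show ?thesis .
    qed
    have av: "ennreal (norm (av Q)) * emeasure lebesgue Q \<le> (\<integral>\<^sup>+y\<in>Q. ennreal (norm (f y)) \<partial>lebesgue)" if "Q \<in> F" for Q
    proof -
      obtain q where q: "0 < q" "emeasure lebesgue Q = ennreal q" using Fpos[OF \<open>Q \<in> F\<close>] by auto
      then have mq: "measure lebesgue Q = q" by (simp add: measure_def)
      have "norm (av Q) * q = norm (LINT y|lebesgue. f y * indicator Q y)"
        using q by (simp add: av_def mq norm_divide)
      then have "ennreal (norm (av Q)) * emeasure lebesgue Q = ennreal (norm (LINT y|lebesgue. f y * indicator Q y))"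
        using q by (simp flip: ennreal_mult)
      also have "\<dots> \<le> (\<integral>\<^sup>+y. norm (f y * indicator Q y) \<partial>lebesgue)"
        by (intro integral_norm_bound_ennreal integrable_Linf_c fQ Fm that)
      also have "\<dots> = (\<integral>\<^sup>+y\<in>Q. ennreal (norm (f y)) \<partial>lebesgue)"
        by (intro nn_integral_cong) (auto simp: indicator_def)
      finally show ?thesis .
    qed
    have av2: "norm (av Q) \<le> 2 ^ ?n * t" if "Q \<in> F" for Q
    proof -
      obtain q where q: "0 < q" "emeasure lebesgue Q = ennreal q" using Fpos[OF \<open>Q \<in> F\<close>] by auto
      have "ennreal (norm (av Q)) * ennreal q \<le> ennreal (2 ^ ?n * t) * ennreal q"
        using av[OF that] F(3)[OF that] q by (auto intro: order_trans)
      then have "norm (av Q) * q \<le> 2 ^ ?n * t * q"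
        using q t by (simp flip: ennreal_mult)
      then show ?thesis using q by simp
    qed
    \<comment> \<open>\<open>g\<close> is bounded by 2^n t almost everywhere and its L^1 norm by
      \<open>?I\<close>, so its squared L^2 norm is at most 2^n t times \<open>?I\<close>. The level
      t/3 contributes the 9 in \<open>?W1\<close>.\<close>
    have P1: "emeasure lebesgue {x. t / 3 < norm (T g x)} \<le> ennreal (?W1 / t) * ?I"
    proof -
      let ?h = "\<lambda>y. ennreal (norm (f y)) * indicator (- \<Omega>) y + (\<Sum>Q\<in>G. ennreal (norm (av Q)) * indicator Q y)"
      have "(\<integral>\<^sup>+y. ennreal ((norm (g y))\<^sup>2) \<partial>lebesgue) \<le> (\<integral>\<^sup>+y. ennreal (2 ^ ?n * t) * ?h y \<partial>lebesgue)"
      proof (rule nn_integral_mono_AE)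
        have sq: "ennreal ((norm a)\<^sup>2) \<le> ennreal (2 ^ ?n * t) * ennreal (norm a)" if "norm a \<le> 2 ^ ?n * t" for a :: complex
          using that t by (auto simp: power2_eq_square mult_right_mono simp flip: ennreal_mult intro!: ennreal_leI)
        show "AE y in lebesgue. ennreal ((norm (g y))\<^sup>2) \<le> ennreal (2 ^ ?n * t) * ?h y"
          using F(4)
        proof eventually_elim
          case (elim y)
          show ?case
          proof (cases "y \<in> \<Omega>")
            case False
            then have "norm (f y) \<le> t" using elim t by (auto simp: \<Omega>_def)
            also have "t \<le> 2 ^ ?n * t" using t by (simp add: one_le_power)
            finally have 1: "norm (f y) \<le> 2 ^ ?n * t" .
            have 2: "y \<notin> Q" if "Q \<in> G" for Q
              using False GF[OF that] by (auto simp: \<Omega>_def)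
            have "g y = f y" "?h y = ennreal (norm (f y))"
              using False by (auto simp: g_def 2)
            then show ?thesis using sq[OF 1] by simp
          next
            case True
            show ?thesis
            proof (cases "y \<in> \<Union>G")
              case True
              then obtain Q where Q: "Q \<in> G" "y \<in> Q" by blast
              have 2: "y \<notin> Q'" if "Q' \<in> G - {Q}" for Q'
                using F(2) Q GF that by (auto simp: disjoint_def)
              have "g y = av Q" "?h y = ennreal (norm (av Q))"
                using \<open>y \<in> \<Omega>\<close> Q by (simp_all add: g_def sum.remove[OF G(1) Q(1)] 2)
              then show ?thesis using sq[OF av2[OF GF[OF Q(1)]]] by simp
            next
              case False
              then have 2: "y \<notin> Q" if "Q \<in> G" for Q using that by auto
              have "g y = 0" using \<open>y \<in> \<Omega>\<close> by (simp add: g_def 2)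
              then show ?thesis by simp
            qed
          qed
        qed
      qed
      also have "\<dots> = ennreal (2 ^ ?n * t) * (\<integral>\<^sup>+y. ?h y \<partial>lebesgue)"
        using GF by (intro nn_integral_cmult) measurable
      also have "(\<integral>\<^sup>+y. ?h y \<partial>lebesgue) = (\<integral>\<^sup>+y\<in>- \<Omega>. ennreal (norm (f y)) \<partial>lebesgue) + (\<Sum>Q\<in>G. ennreal (norm (av Q)) * emeasure lebesgue Q)"
        using GF by (subst nn_integral_add) (auto simp: nn_integral_sum nn_integral_cmult_indicator Fm Compl_in_sets_lebesgue)
      also have "\<dots> \<le> (\<integral>\<^sup>+y\<in>- \<Omega>. ennreal (norm (f y)) \<partial>lebesgue) + (\<integral>\<^sup>+y\<in>\<Union>G. ennreal (norm (f y)) \<partial>lebesgue)"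
        unfolding sumG[symmetric] using av GF by (intro add_left_mono sum_mono) auto
      also have "\<dots> = (\<integral>\<^sup>+y. ennreal (norm (f y)) * indicator (- \<Omega>) y + ennreal (norm (f y)) * indicator (\<Union>G) y \<partial>lebesgue)"
        by (intro nn_integral_add[symmetric]) (auto simp: Compl_in_sets_lebesgue)
      also have "\<dots> \<le> ?I"
        using G(2) by (intro nn_integral_mono) (auto simp: indicator_def \<Omega>_def)
      finally have L2: "(\<integral>\<^sup>+y. ennreal ((norm (g y))\<^sup>2) \<partial>lebesgue) \<le> ennreal (2 ^ ?n * t) * ?I"
        by (simp add: mult_left_mono)
      have "emeasure lebesgue {x. t / 3 < norm (T g x)} \<le> ennreal (A\<^sup>2 / (t / 3)\<^sup>2) * (\<integral>\<^sup>+y. ennreal ((norm (g y))\<^sup>2) \<partial>lebesgue)"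
        using t by (intro T_weak_L2 Linf_c_subset_L2 gL) auto
      also have "\<dots> \<le> ennreal (A\<^sup>2 / (t / 3)\<^sup>2) * (ennreal (2 ^ ?n * t) * ?I)"
        by (intro mult_left_mono L2) auto
      also have "\<dots> = ennreal (A\<^sup>2 / (t / 3)\<^sup>2 * (2 ^ ?n * t)) * ?I"
        using t by (intro ennreal_mult_mult) auto
      also have "A\<^sup>2 / (t / 3)\<^sup>2 * (2 ^ ?n * t) = ?W1 / t"
        using t by (simp add: power2_eq_square field_simps)
      finally show ?thesis .
    qed
    define D where "D = (\<Union>Q\<in>G. ball (\<zeta> Q) (2 * \<rho> Q))"
    have Dm [measurable]: "D \<in> sets lebesgue" unfolding D_def using G(1) by (intro sets.finite_UN) auto
    have P2: "emeasure lebesgue D \<le> ennreal (?W2 / t) * ?I"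
    proof -
      have "emeasure lebesgue D \<le> (\<Sum>Q\<in>G. emeasure lebesgue (ball (\<zeta> Q) (2 * \<rho> Q)))"
        unfolding D_def using G(1) by (intro emeasure_subadditive_finite) auto
      also have "\<dots> = ennreal ?W2 * (\<Sum>Q\<in>G. emeasure lebesgue Q)"
        using ball GF by (simp add: sum_distrib_left)
      also have "(\<Sum>Q\<in>G. emeasure lebesgue Q) = emeasure lebesgue (\<Union>G)"
        using sum_emeasure[of "\<lambda>Q. Q" G lebesgue] disjG G(1) Fm[OF GF] by (simp add: subset_iff)
      also have "\<dots> \<le> emeasure lebesgue \<Omega>"
        using G(2) \<Omega> by (intro emeasure_mono) (auto simp: \<Omega>_def)
      also have "\<dots> \<le> ennreal (1 / t) * ?I" by (rule \<Omega>I)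
      also have "ennreal ?W2 * (ennreal (1 / t) * ?I) = ennreal (?W2 / t) * ?I"
        using t by (simp add: mult.assoc[symmetric] flip: ennreal_mult)
      finally show ?thesis by (simp add: mult_left_mono)
    qed
    \<comment> \<open>The 6 is 3 from the level t/3 times 2 from the L^1 norm of an atom, which is
      at most twice the mass of \<open>f\<close> on its cube.\<close>
    have P3: "emeasure lebesgue {x\<in>- D. t / 3 < norm (T b1 x)} \<le> ennreal (6 * ?W3 / t) * ?I"
    proof -
      have "(\<integral>\<^sup>+x\<in>- D. norm (T b1 x) \<partial>lebesgue) \<le> (\<integral>\<^sup>+x. (\<Sum>Q\<in>G. ennreal (norm (T (b Q) x)) * indicator (- ball (\<zeta> Q) (2 * \<rho> Q)) x) \<partial>lebesgue)"
      proof (rule nn_integral_mono_AE)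
        have "AE x in lebesgue. T b1 x = (\<Sum>Q\<in>G. T (b Q) x)"
          unfolding b1_def using G(1) bQ GF by (intro T_sum) auto
        then show "AE x in lebesgue. ennreal (norm (T b1 x)) * indicator (- D) x \<le> (\<Sum>Q\<in>G. ennreal (norm (T (b Q) x)) * indicator (- ball (\<zeta> Q) (2 * \<rho> Q)) x)"
        proof eventually_elim
          case (elim x)
          show ?case
          proof (cases "x \<in> D")
            case False
            then have "indicator (- ball (\<zeta> Q) (2 * \<rho> Q)) x = (1::ennreal)" if "Q \<in> G" for Q
              using that by (auto simp: D_def indicator_def)
            then have "(\<Sum>Q\<in>G. ennreal (norm (T (b Q) x)) * indicator (- ball (\<zeta> Q) (2 * \<rho> Q)) x) = ennreal (\<Sum>Q\<in>G. norm (T (b Q) x))"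
              by (simp add: sum_ennreal)
            then show ?thesis
              using elim False by (auto intro!: ennreal_leI norm_sum)
          qed auto
        qed
      qed
      also have "\<dots> = (\<Sum>Q\<in>G. \<integral>\<^sup>+x\<in>- ball (\<zeta> Q) (2 * \<rho> Q). norm (T (b Q) x) \<partial>lebesgue)"
        using GF TbQ by (intro nn_integral_sum) (auto simp: Compl_in_sets_lebesgue)
      also have "\<dots> \<le> (\<Sum>Q\<in>G. ennreal ?W3 * (2 * (\<integral>\<^sup>+y\<in>Q. ennreal (norm (f y)) \<partial>lebesgue)))"
      proof (rule sum_mono)
        fix Q assume "Q \<in> G"
        then have Q: "Q \<in> F" using GF by auto
        obtain q where q: "0 < q" "emeasure lebesgue Q = ennreal q" using Fpos[OF Q] by auto
        then have mq: "measure lebesgue Q = q" by (simp add: measure_def)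
        have int: "integrable lebesgue (\<lambda>y. f y * indicator Q y)" "integrable lebesgue (\<lambda>y. av Q * indicator Q y)"
          by (intro integrable_Linf_c fQ Fm avQ Q)+
        have "(LINT y|lebesgue. b Q y) = (LINT y|lebesgue. f y * indicator Q y - av Q * indicator Q y)"
          by (intro Bochner_Integration.integral_cong) (auto simp: b_def algebra_simps)
        also have "\<dots> = (LINT y|lebesgue. f y * indicator Q y) - (LINT y|lebesgue. av Q * indicator Q y)"
          by (rule Bochner_Integration.integral_diff[OF int])
        also have "(LINT y|lebesgue. av Q * indicator Q y) = av Q * complex_of_real q"
        proof -
          have "has_bochner_integral lebesgue (\<lambda>y. indicator Q y *\<^sub>R av Q) (measure lebesgue Q *\<^sub>R av Q)"
            using q Fm[OF Q] by (intro has_bochner_integral_indicator) auto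
          moreover have "(\<lambda>y. indicator Q y *\<^sub>R av Q) = (\<lambda>y. av Q * indicator Q y)"
            by (auto simp: indicator_def)
          ultimately have "has_bochner_integral lebesgue (\<lambda>y. av Q * indicator Q y) (measure lebesgue Q *\<^sub>R av Q)"
            by simp
          then have "(LINT y|lebesgue. av Q * indicator Q y) = measure lebesgue Q *\<^sub>R av Q"
            by (rule has_bochner_integral_integral_eq)
          then show ?thesis
            unfolding mq by (simp only: scaleR_conv_of_real mult.commute)
        qed
        also have "av Q * complex_of_real q = (LINT y|lebesgue. f y * indicator Q y)"
          using q by (simp add: av_def mq)
        finally have mean: "(LINT y|lebesgue. b Q y) = 0" by simp
        have "(\<integral>\<^sup>+x\<in>- ball (\<zeta> Q) (2 * \<rho> Q). norm (T (b Q) x) \<partial>lebesgue) \<le> ennreal ?W3 * (\<integral>\<^sup>+y. norm (b Q y) \<partial>lebesgue)"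
        proof (rule T_atom_bound[OF bQ[OF Q] _ _ mean])
          show "0 < \<rho> Q" using ball[OF Q] by auto
          show "norm (y - \<zeta> Q) < \<rho> Q" if "b Q y \<noteq> 0" for y
          proof -
            have "y \<in> Q" using that by (auto simp: b_def indicator_def split: if_splits)
            then show ?thesis using ball[OF Q] by (auto simp: dist_norm norm_minus_commute)
          qed
        qed
        also have "(\<integral>\<^sup>+y. norm (b Q y) \<partial>lebesgue) \<le> (\<integral>\<^sup>+y. ennreal (norm (f y)) * indicator Q y + ennreal (norm (av Q)) * indicator Q y \<partial>lebesgue)"
          by (intro nn_integral_mono) (auto simp: b_def indicator_def norm_triangle_ineq4 simp flip: ennreal_plus intro!: ennreal_leI)
        also have "\<dots> = (\<integral>\<^sup>+y\<in>Q. ennreal (norm (f y)) \<partial>lebesgue) + ennreal (norm (av Q)) * emeasure lebesgue Q"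
          using Fm[OF Q] by (subst nn_integral_add) (auto simp: nn_integral_cmult_indicator)
        also have "\<dots> \<le> 2 * (\<integral>\<^sup>+y\<in>Q. ennreal (norm (f y)) \<partial>lebesgue)"
          using av[OF Q] by (auto simp: mult_2 intro!: add_mono)
        finally show "(\<integral>\<^sup>+x\<in>- ball (\<zeta> Q) (2 * \<rho> Q). norm (T (b Q) x) \<partial>lebesgue) \<le> ennreal ?W3 * (2 * (\<integral>\<^sup>+y\<in>Q. ennreal (norm (f y)) \<partial>lebesgue))"
          by (simp add: mult_left_mono)
      qed
      also have "\<dots> = ennreal ?W3 * (2 * (\<integral>\<^sup>+y\<in>\<Union>G. ennreal (norm (f y)) \<partial>lebesgue))"
        by (simp add: sum_distrib_left[symmetric] sumG)
      also have "\<dots> \<le> ennreal ?W3 * (2 * ?I)"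
        by (intro mult_left_mono nn_integral_mono) (auto simp: indicator_def)
      finally have L1: "(\<integral>\<^sup>+x\<in>- D. norm (T b1 x) \<partial>lebesgue) \<le> ennreal ?W3 * (2 * ?I)" .
      have "emeasure lebesgue {x\<in>- D. t / 3 < norm (T b1 x)} \<le> ennreal (1 / (t / 3)) * (\<integral>\<^sup>+x\<in>- D. norm (T b1 x) \<partial>lebesgue)"
        using t by (intro emeasure_norm_greater_le) (auto simp: Compl_in_sets_lebesgue)
      also have "\<dots> \<le> ennreal (1 / (t / 3)) * (ennreal ?W3 * (2 * ?I))"
        by (intro mult_left_mono L1) auto
      also have "\<dots> = ennreal (1 / (t / 3) * ?W3 * 2) * ?I"
        using t W3 ennreal_mult_mult[of "1 / (t / 3)" ?W3 "2 * ?I"] ennreal_mult_mult[of "1 / (t / 3) * ?W3" 2 ?I] by simp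
      also have "1 / (t / 3) * ?W3 * 2 = 6 * ?W3 / t"
        using t by (simp add: field_simps)
      finally show ?thesis .
    qed
    \<comment> \<open>\<open>b2\<close> is bounded by \<open>B\<close> and lives on a set of measure
      below \<eta>, so the L^2 bound alone handles it.\<close>
    have P4: "emeasure lebesgue {x. t / 3 < norm (T b2 x)} \<le> ennreal e"
    proof -
      have "(\<integral>\<^sup>+y. ennreal ((norm (b2 y))\<^sup>2) \<partial>lebesgue) \<le> (\<integral>\<^sup>+y. ennreal (B\<^sup>2) * indicator (\<Omega> - \<Union>G) y \<partial>lebesgue)"
        using B by (intro nn_integral_mono) (auto simp: b2_def indicator_def intro!: ennreal_leI power_mono)
      also have "\<dots> = ennreal (B\<^sup>2) * emeasure lebesgue (\<Omega> - \<Union>G)"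
        by (intro nn_integral_cmult_indicator) measurable
      also have "\<dots> \<le> ennreal (B\<^sup>2) * ennreal \<eta>"
        using G(3) by (intro mult_left_mono) auto
      finally have L2: "(\<integral>\<^sup>+y. ennreal ((norm (b2 y))\<^sup>2) \<partial>lebesgue) \<le> ennreal (B\<^sup>2 * \<eta>)"
        using \<eta> by (simp add: ennreal_mult)
      have "emeasure lebesgue {x. t / 3 < norm (T b2 x)} \<le> ennreal (A\<^sup>2 / (t / 3)\<^sup>2) * (\<integral>\<^sup>+y. ennreal ((norm (b2 y))\<^sup>2) \<partial>lebesgue)"
        using t by (intro T_weak_L2 Linf_c_subset_L2 b2L) auto
      also have "\<dots> \<le> ennreal (A\<^sup>2 / (t / 3)\<^sup>2) * ennreal (B\<^sup>2 * \<eta>)"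
        by (intro mult_left_mono L2) auto
      also have "\<dots> = ennreal (9 * A\<^sup>2 / t\<^sup>2 * (B\<^sup>2 * \<eta>))"
        using \<eta> by (simp add: ennreal_mult[symmetric] power_divide)
      also have "\<dots> \<le> ennreal e" by (intro ennreal_leI \<eta>e)
      finally show ?thesis .
    qed
    have m: "{x. t / 3 < norm (T g x)} \<in> sets lebesgue" "{x. t / 3 < norm (T b2 x)} \<in> sets lebesgue"
      "{x\<in>- D. t / 3 < norm (T b1 x)} \<in> sets lebesgue"
    proof -
      have "{x\<in>space lebesgue. t / 3 < norm (T g x)} \<in> sets lebesgue" by measurable
      then show "{x. t / 3 < norm (T g x)} \<in> sets lebesgue" by simp
      have "{x\<in>space lebesgue. t / 3 < norm (T b2 x)} \<in> sets lebesgue" by measurable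
      then show "{x. t / 3 < norm (T b2 x)} \<in> sets lebesgue" by simp
      have "{x\<in>space lebesgue. x \<notin> D \<and> t / 3 < norm (T b1 x)} \<in> sets lebesgue" by measurable
      then show "{x\<in>- D. t / 3 < norm (T b1 x)} \<in> sets lebesgue" by simp
    qed
    \<comment> \<open>Where |T f| exceeds \<open>t\<close>, one of the three parts exceeds t/3; for
      \<open>b1\<close> the points of the doubled balls have been removed beforehand into
      \<open>D\<close>.\<close>
    have "emeasure lebesgue {x. t < norm (T f x)} \<le> emeasure lebesgue
      (({x. t / 3 < norm (T g x)} \<union> D) \<union> ({x\<in>- D. t / 3 < norm (T b1 x)} \<union> {x. t / 3 < norm (T b2 x)}))"
    proof (rule emeasure_mono_AE)
      show "AE x in lebesgue. x \<in> {x. t < norm (T f x)} \<longrightarrow>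
        x \<in> ({x. t / 3 < norm (T g x)} \<union> D) \<union> ({x\<in>- D. t / 3 < norm (T b1 x)} \<union> {x. t / 3 < norm (T b2 x)})"
        using split
      proof eventually_elim
        case (elim x)
        have "norm (T f x) \<le> norm (T g x) + norm (T b1 x) + norm (T b2 x)"
          unfolding elim by (meson norm_triangle_mono norm_triangle_ineq order_refl order_trans)
        then show ?case by auto
      qed
    qed (use m in auto)
    also have "\<dots> \<le> emeasure lebesgue ({x. t / 3 < norm (T g x)} \<union> D) + emeasure lebesgue ({x\<in>- D. t / 3 < norm (T b1 x)} \<union> {x. t / 3 < norm (T b2 x)})"
      using m by (intro emeasure_subadditive) auto
    also have "\<dots> \<le> (emeasure lebesgue {x. t / 3 < norm (T g x)} + emeasure lebesgue D)
      + (emeasure lebesgue {x\<in>- D. t / 3 < norm (T b1 x)} + emeasure lebesgue {x. t / 3 < norm (T b2 x)})"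
      using m by (intro add_mono emeasure_subadditive) auto
    also have "\<dots> \<le> (ennreal (?W1 / t) * ?I + ennreal (?W2 / t) * ?I) + (ennreal (6 * ?W3 / t) * ?I + ennreal e)"
      by (intro add_mono P1 P2 P3 P4)
    also have "\<dots> = (ennreal (?W1 / t) + ennreal (?W2 / t) + ennreal (6 * ?W3 / t)) * ?I + ennreal e"
      by (simp add: distrib_right add.assoc)
    also have "ennreal (?W1 / t) + ennreal (?W2 / t) + ennreal (6 * ?W3 / t) = ennreal ((?W1 + ?W2 + 6 * ?W3) / t)"
      using t W3 by (simp add: add_divide_distrib flip: ennreal_plus)
    finally show "emeasure lebesgue {x. t < norm (T f x)} \<le> ennreal ((?W1 + ?W2 + 6 * ?W3) / t) * ?I + ennreal e" .
  qed
qed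

lemma weak_type_11:
  obtains W where "0 < W"
    "\<And>f t. f \<in> Linf_c \<Longrightarrow> 0 < t \<Longrightarrow>
      emeasure lebesgue {x. t < norm (T f x)} \<le> ennreal (W / t) * (\<integral>\<^sup>+x. norm (f x) \<partial>lebesgue)"
proof (rule that)
  let ?W = "9 * A\<^sup>2 * 2 ^ DIM('a) + unit_ball_vol (real DIM('a)) * (2 * real DIM('a)) ^ DIM('a)
      + 6 * (C * tail_const DIM('a) \<epsilon> * unit_ball_vol (real DIM('a)))"
  have "0 \<le> 9 * A\<^sup>2 * 2 ^ DIM('a)" "0 < unit_ball_vol (real DIM('a)) * (2 * real DIM('a)) ^ DIM('a)"
    "0 \<le> 6 * (C * tail_const DIM('a) \<epsilon> * unit_ball_vol (real DIM('a)))"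
    using C tail_const_nonneg[OF \<epsilon>] by auto
  then show "0 < ?W" by linarith
qed (rule weak_type_11_aux)

end

section \<open>Local mean oscillation\<close>

text \<open>Calderon-Zygmund cubes of the indicator of \<open>E\<close> at height 2^-(n+1). The
  bound through the parent gives density at most 2^n 2^-(n+1) = 1/2 in each, the total measure is at
  most 2^(n+1) |E|, hence at most half of the cube, and off the cubes the indicator is below 1,
  hence 0.\<close>

lemma stopping_cubes:
  fixes E :: "'a::euclidean_space set"
  assumes s: "0 < s" and E [measurable]: "E \<in> sets lebesgue" "E \<subseteq> dcube s j x"
    and small: "emeasure lebesgue E \<le> ennreal (1 / 2 ^ (DIM('a) + 2)) * emeasure lebesgue (dcube s j x)"
  obtains F where "countable F" "disjoint F"
    "\<And>P. P \<in> F \<Longrightarrow> P \<subseteq> dcube s j x \<and> (\<exists>i y. P = dcube s i y) \<and>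
       emeasure lebesgue (P \<inter> E) \<le> ennreal (1 / 2) * emeasure lebesgue P"
    "emeasure lebesgue (\<Union>F) \<le> ennreal (1 / 2) * emeasure lebesgue (dcube s j x)"
    "AE y in lebesgue. y \<in> E \<longrightarrow> y \<in> \<Union>F"
proof -
  let ?n = "DIM('a)" and ?s = "s / 2 ^ j" and ?Q = "dcube s j x"
  define \<alpha> :: real where "\<alpha> = 1 / 2 ^ (?n + 1)"
  have \<alpha>: "0 < \<alpha>" "\<alpha> < 1" "2 ^ ?n * \<alpha> = 1 / 2" by (simp_all add: \<alpha>_def less_1_mult field_simps power_less_one_iff one_less_power flip: power_Suc)
  \<comment> \<open>The grid is restarted with \<open>?Q\<close> as one of its top cubes. The other
    top cubes miss \<open>E\<close>, so the condition on averages is trivial for them.\<close>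
  have s': "0 < ?s" using s by simp
  have cube_eq: "dcube ?s i y = dcube s (j + i) y" for i and y :: 'a by (simp add: power_add)
  have top: "(\<integral>\<^sup>+y\<in>dcube ?s 0 z. indicator E y \<partial>lebesgue) \<le> ennreal \<alpha> * emeasure lebesgue (dcube ?s 0 z)" for z
  proof (cases "z \<in> ?Q")
    case True
    then have eq: "dcube ?s 0 z = ?Q" using grid_cube_eq by fastforce
    have "(\<integral>\<^sup>+y\<in>dcube ?s 0 z. indicator E y \<partial>lebesgue) = (\<integral>\<^sup>+y. indicator E y \<partial>lebesgue)"
      unfolding eq using E(2) by (intro nn_integral_cong) (auto simp: indicator_def)
    also have "\<dots> \<le> ennreal (1 / 2 ^ (?n + 2)) * emeasure lebesgue ?Q"
      using small by simp
    also have "\<dots> \<le> ennreal \<alpha> * emeasure lebesgue ?Q"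
      by (intro mult_right_mono ennreal_leI) (auto simp: \<alpha>_def field_simps)
    finally show ?thesis unfolding eq .
  next
    case False
    have "y \<notin> E" if "y \<in> dcube ?s 0 z" for y
    proof
      assume "y \<in> E"
      then have "y \<in> ?Q" using E(2) by blast
      then have "dcube ?s 0 z = ?Q"
        using that grid_cube_eq[of y ?s x] grid_cube_eq[of y ?s z] by simp
      then show False using False grid_cube_self[of z ?s] by simp
    qed
    then have "(\<integral>\<^sup>+y\<in>dcube ?s 0 z. indicator E y \<partial>lebesgue) = nn_integral lebesgue (\<lambda>y::'a. 0)"
      by (intro nn_integral_cong) (auto simp: indicator_def)
    then show ?thesis by simp
  qed
  have um: "(indicator E :: 'a \<Rightarrow> ennreal) \<in> borel_measurable lebesgue" by measurable
  obtain F where F: "countable F" "disjoint F"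
    "\<And>Q. Q \<in> F \<Longrightarrow> (\<exists>j x. Q = dcube ?s j x) \<and>
       ennreal \<alpha> * emeasure lebesgue Q < (\<integral>\<^sup>+y\<in>Q. indicator E y \<partial>lebesgue) \<and>
       (\<integral>\<^sup>+y\<in>Q. indicator E y \<partial>lebesgue) \<le> ennreal (2 ^ DIM('a) * \<alpha>) * emeasure lebesgue Q"
    "AE x in lebesgue. x \<notin> \<Union>F \<longrightarrow> indicator E x \<le> ennreal \<alpha>"
    by (rule calderon_zygmund_cubes[OF s' \<alpha>(1) um top]) (rule that)
  have Fm: "P \<in> sets lebesgue" if "P \<in> F" for P using F(3)[OF that] by auto
  have int: "(\<integral>\<^sup>+y\<in>P. indicator E y \<partial>lebesgue) = emeasure lebesgue (P \<inter> E)" if "P \<in> F" for P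
  proof -
    have "(\<integral>\<^sup>+y\<in>P. indicator E y \<partial>lebesgue) = (\<integral>\<^sup>+y. indicator (P \<inter> E) y \<partial>lebesgue)"
      by (intro nn_integral_cong) (auto simp: indicator_def)
    then show ?thesis using Fm[OF that] by simp
  qed
  show ?thesis
  proof (rule that[of F])
    fix P assume P: "P \<in> F"
    obtain i y where Pi: "P = dcube ?s i y" using F(3)[OF P] by blast
    \<comment> \<open>A selected cube meets \<open>E\<close>, and therefore descends from
      \<open>?Q\<close> and from no other top cube.\<close>
    have "emeasure lebesgue (P \<inter> E) \<noteq> 0"
      using F(3)[OF P] unfolding int[OF P] by auto
    then obtain w where w: "w \<in> P" "w \<in> E" by (metis disjoint_iff emeasure_empty)
    then have "P = dcube ?s i w" using Pi grid_cube_eq by blast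
    then have "P \<subseteq> dcube ?s 0 w" using dcube_mono[of 0 i ?s w] by simp
    also have "dcube ?s 0 w = ?Q" using w E(2) grid_cube_eq by fastforce
    finally have "P \<subseteq> ?Q" .
    moreover have "\<exists>i y. P = dcube s i y" using Pi unfolding cube_eq by blast
    ultimately show "P \<subseteq> ?Q \<and> (\<exists>i y. P = dcube s i y) \<and>
       emeasure lebesgue (P \<inter> E) \<le> ennreal (1 / 2) * emeasure lebesgue P"
      using F(3)[OF P] unfolding int[OF P] \<alpha>(3) by blast
  next
    have "ennreal \<alpha> * emeasure lebesgue (\<Union>F) = (\<integral>\<^sup>+P. ennreal \<alpha> * emeasure lebesgue P \<partial>count_space F)"
      using F(1,2) Fm by (simp add: nn_integral_cmult emeasure_Union_disjoint_sets)
    also have "\<dots> \<le> (\<integral>\<^sup>+P. (\<integral>\<^sup>+y\<in>P. indicator E y \<partial>lebesgue) \<partial>count_space F)"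
      using F(3) by (intro nn_integral_mono) (auto intro: less_imp_le)
    also have "\<dots> = (\<integral>\<^sup>+y\<in>\<Union>F. indicator E y \<partial>lebesgue)"
      using F(1,2) Fm by (intro nn_integral_UN_disjoint_sets[symmetric]) auto
    also have "\<dots> \<le> (\<integral>\<^sup>+y. indicator E y \<partial>lebesgue)"
      by (intro nn_integral_mono) (auto simp: indicator_def)
    also have "\<dots> \<le> ennreal (1 / 2 ^ (?n + 2)) * emeasure lebesgue ?Q"
      using small by simp
    finally have "ennreal (1 / \<alpha>) * (ennreal \<alpha> * emeasure lebesgue (\<Union>F)) \<le> ennreal (1 / \<alpha>) * (ennreal (1 / 2 ^ (?n + 2)) * emeasure lebesgue ?Q)"
      by (intro mult_left_mono) auto
    moreover have "ennreal (1 / \<alpha>) * (ennreal \<alpha> * emeasure lebesgue (\<Union>F)) = emeasure lebesgue (\<Union>F)"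
      using \<alpha>(1) by (subst ennreal_mult_mult) auto
    moreover have "1 / \<alpha> * (1 / 2 ^ (?n + 2)) = 1 / 2" by (simp add: \<alpha>_def)
    moreover have "ennreal (1 / \<alpha>) * (ennreal (1 / 2 ^ (?n + 2)) * emeasure lebesgue ?Q)
      = ennreal (1 / \<alpha> * (1 / 2 ^ (?n + 2))) * emeasure lebesgue ?Q"
      using \<alpha>(1) by (intro ennreal_mult_mult) auto
    ultimately show "emeasure lebesgue (\<Union>F) \<le> ennreal (1 / 2) * emeasure lebesgue ?Q"
      by (simp only:)
  next
    show "AE y in lebesgue. y \<in> E \<longrightarrow> y \<in> \<Union>F"
      using F(4)
    proof eventually_elim
      case (elim y)
      show ?case
      proof (intro impI, rule ccontr)
        assume "y \<in> E" "y \<notin> \<Union>F"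
        then have "ennreal 1 \<le> ennreal \<alpha>" using elim by simp
        then show False using \<alpha> by (simp del: ennreal_1)
      qed
    qed
  qed (rule F(1) F(2))+
qed

text \<open>
  Lerner's decomposition in integrated form: the constants \<open>c\<close> play the role of medians and
  \<open>a\<close> bounds the local mean oscillation.
\<close>

locale bounded_oscillation =
  fixes h :: "'a::euclidean_space \<Rightarrow> complex" and g :: "'a \<Rightarrow> real" and H :: "'a \<Rightarrow> ennreal"
    and c :: "'a set \<Rightarrow> complex" and a :: "'a set \<Rightarrow> real" and s B b D :: real
  assumes s: "0 < s" and h: "h \<in> L2" and g: "g \<in> borel_measurable lebesgue" "\<And>y. 0 \<le> g y" "\<And>y. g y \<le> B"
    and H: "H \<in> borel_measurable lebesgue"
    and a: "\<And>Q. 0 \<le> a Q" "\<And>Q. a Q \<le> b" and D: "0 \<le> D"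
    and oscillation: "\<And>j x. emeasure lebesgue {y \<in> dcube s j x. a (dcube s j x) < norm (h y - c (dcube s j x))}
      \<le> ennreal (1 / 2 ^ (DIM('a) + 2)) * emeasure lebesgue (dcube s j x)"
    and average: "\<And>j x y. y \<in> dcube s j x \<Longrightarrow> ennreal (a (dcube s j x)) * (\<integral>\<^sup>+y\<in>dcube s j x. ennreal (g y) \<partial>lebesgue)
      \<le> ennreal D * emeasure lebesgue (dcube s j x) * H y"
begin

text \<open>The summand \<open>a Q\<close> makes the recursion close: passing from
  \<open>c Q\<close> to \<open>c P\<close> costs \<open>a Q + a P\<close>, and this
  \<open>a P\<close> is already part of \<open>\<Phi> P\<close>.\<close>

definition \<Phi> :: "'a set \<Rightarrow> ennreal" where
  "\<Phi> Q = (\<integral>\<^sup>+y\<in>Q. ennreal ((norm (h y - c Q) + a Q) * g y) \<partial>lebesgue)"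

text \<open>A majorant for what is left after finitely many generations. It does not depend on the
  cubes, so only the measure of the remaining set matters. Of the 3, one part pays for
  \<open>h\<close> and \<open>a Q\<close>, two for \<open>c Q\<close>.\<close>

definition v :: "'a \<Rightarrow> ennreal" where
  "v y = ennreal (3 * B * (norm (h y) + b))"

lemma B: "0 \<le> B" using g(2,3)[of 0] by linarith

lemma b: "0 \<le> b" using a[of "{}"] by linarith

lemma h_measurable [measurable]: "h \<in> borel_measurable lebesgue"
  using h by (simp add: L2_def)

lemma v_measurable [measurable]: "v \<in> borel_measurable lebesgue"
  unfolding v_def by measurable

declare g(1) [measurable] H [measurable]

definition bad :: "'a set \<Rightarrow> 'a set" where
  "bad Q = {y \<in> Q. a Q < norm (h y - c Q)}"

lemma bad_sets [measurable]: "Q \<in> sets lebesgue \<Longrightarrow> bad Q \<in> sets lebesgue"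
proof -
  assume [measurable]: "Q \<in> sets lebesgue"
  have "bad Q = Q \<inter> {y \<in> space lebesgue. a Q < norm (h y - c Q)}"
    by (auto simp: bad_def)
  also have "\<dots> \<in> sets lebesgue" by measurable
  finally show "bad Q \<in> sets lebesgue" .
qed

lemma emeasure_bad:
  "emeasure lebesgue (bad (dcube s j x)) \<le> ennreal (1 / 2 ^ (DIM('a) + 2)) * emeasure lebesgue (dcube s j x)"
  unfolding bad_def by (rule oscillation)

text \<open>The fraction 2^-(n+2) serves the choice of stopping cubes; the comparison of constants
  uses a quarter, in every dimension.\<close>

lemma emeasure_bad_quarter:
  "emeasure lebesgue (bad (dcube s j x)) \<le> ennreal (1 / 4) * emeasure lebesgue (dcube s j x)"
proof -
  have "(1::real) / 2 ^ (DIM('a) + 2) \<le> 1 / 4"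
    by (simp add: field_simps)
  then show ?thesis
    by (meson emeasure_bad ennreal_leI mult_right_mono order_trans zero_le)
qed

lemma emeasure_dcube:
  "emeasure lebesgue (dcube s j (x::'a)) = ennreal ((s / 2 ^ j) ^ DIM('a))" "0 < (s / 2 ^ j) ^ DIM('a)"
  using s by (auto simp: emeasure_grid_cube)

text \<open>Off \<open>bad Q\<close>, that is on at least half of \<open>Q\<close>, the constant
  satisfies |c Q| \<le> |h| + b. Integrating over that half bounds |c Q| by twice the average of |h|
  + b over \<open>Q\<close>.\<close>

lemma \<Phi>_le_v: "\<Phi> (dcube s j x) \<le> (\<integral>\<^sup>+y\<in>dcube s j x. v y \<partial>lebesgue)"
proof -
  let ?Q = "dcube s j x"
  define q where "q = (s / 2 ^ j) ^ DIM('a)"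
  have q: "emeasure lebesgue ?Q = ennreal q" "0 < q" using emeasure_dcube by (auto simp: q_def)
  define w where "w = (\<integral>\<^sup>+y\<in>?Q. ennreal (norm (h y) + b) \<partial>lebesgue)"
  have "ennreal (1 / 4) * emeasure lebesgue ?Q \<le> ennreal (1 / 2) * emeasure lebesgue ?Q"
    by (intro mult_right_mono ennreal_leI) auto
  then have "emeasure lebesgue (bad ?Q) \<le> ennreal (1 / 2) * emeasure lebesgue ?Q"
    using emeasure_bad_quarter order_trans by blast
  then have half: "ennreal (q / 2) \<le> emeasure lebesgue (?Q - bad ?Q)"
    using q by (intro emeasure_Diff_ge_half) auto
  have "ennreal (norm (c ?Q)) * ennreal (q / 2) \<le> ennreal (norm (c ?Q)) * emeasure lebesgue (?Q - bad ?Q)"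
    by (intro mult_left_mono half) auto
  also have "\<dots> = (\<integral>\<^sup>+y\<in>?Q - bad ?Q. ennreal (norm (c ?Q)) \<partial>lebesgue)"
    by (simp add: nn_integral_cmult_indicator)
  also have "\<dots> \<le> w"
    unfolding w_def
  proof (intro nn_integral_mono)
    fix y
    show "ennreal (norm (c ?Q)) * indicator (?Q - bad ?Q) y \<le> ennreal (norm (h y) + b) * indicator ?Q y"
    proof (cases "y \<in> ?Q - bad ?Q")
      case True
      then have "norm (h y - c ?Q) \<le> b" using a(2)[of ?Q] by (auto simp: bad_def)
      then have "norm (c ?Q) \<le> norm (h y) + b"
        using norm_triangle_ineq3[of "c ?Q" "h y"] by (simp add: norm_minus_commute)
      then show ?thesis using True by (simp add: ennreal_leI)
    qed auto
  qed
  finally have 1: "ennreal (norm (c ?Q)) * ennreal (q / 2) \<le> w" .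
  have "\<Phi> ?Q \<le> (\<integral>\<^sup>+y. ennreal B * (ennreal (norm (h y) + b) * indicator ?Q y) + ennreal (B * norm (c ?Q)) * indicator ?Q y \<partial>lebesgue)"
    unfolding \<Phi>_def
  proof (intro nn_integral_mono)
    fix y
    have "(norm (h y - c ?Q) + a ?Q) * g y \<le> (norm (h y) + norm (c ?Q) + b) * B"
      using a g b by (intro mult_mono add_mono norm_triangle_ineq4) auto
    then have "ennreal ((norm (h y - c ?Q) + a ?Q) * g y) \<le> ennreal B * ennreal (norm (h y) + b) + ennreal (B * norm (c ?Q))"
      using B b by (simp add: algebra_simps ennreal_leI flip: ennreal_mult ennreal_plus)
    then show "ennreal ((norm (h y - c ?Q) + a ?Q) * g y) * indicator ?Q y
      \<le> ennreal B * (ennreal (norm (h y) + b) * indicator ?Q y) + ennreal (B * norm (c ?Q)) * indicator ?Q y"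
      by (auto simp: indicator_def)
  qed
  also have "\<dots> = ennreal B * w + ennreal (B * norm (c ?Q)) * ennreal q"
    by (simp add: nn_integral_add nn_integral_cmult nn_integral_cmult_indicator w_def q)
  also have "ennreal (B * norm (c ?Q)) * ennreal q = ennreal (2 * B) * (ennreal (norm (c ?Q)) * ennreal (q / 2))"
    using B q by (simp flip: ennreal_mult)
  also have "ennreal B * w + ennreal (2 * B) * (ennreal (norm (c ?Q)) * ennreal (q / 2)) \<le> ennreal B * w + ennreal (2 * B) * w"
    by (intro add_left_mono mult_left_mono 1) auto
  also have "\<dots> = (ennreal B + ennreal (2 * B)) * w"
    by (simp add: distrib_right)
  also have "ennreal B + ennreal (2 * B) = ennreal (3 * B)"
    using B by (simp flip: ennreal_plus)
  also have "ennreal (3 * B) * w = (\<integral>\<^sup>+y. ennreal (3 * B) * (ennreal (norm (h y) + b) * indicator ?Q y) \<partial>lebesgue)"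
    unfolding w_def by (intro nn_integral_cmult[symmetric]) measurable
  also have "\<dots> = (\<integral>\<^sup>+y\<in>?Q. v y \<partial>lebesgue)"
    using B b by (intro nn_integral_cong) (simp add: v_def ennreal_mult mult.assoc)
  finally show ?thesis .
qed

text \<open>The cubes of \<open>F\<close> cover the bad part of the cube Q up to a null set. Outside
  them the integrand is at most 2 a(Q) g; inside \<open>P\<close> it is at most the integrand of
  \<open>\<Phi> P\<close> plus 2 a(Q) g. The integral of 2 a(Q) g over all of Q is then charged to Q
  without the subcubes.\<close>

lemma \<Phi>_step:
  obtains F where "countable F" "disjoint F" "\<And>P. P \<in> F \<Longrightarrow> P \<subseteq> dcube s j x \<and> (\<exists>i y. P = dcube s i y)"
    "emeasure lebesgue (\<Union>F) \<le> ennreal (1 / 2) * emeasure lebesgue (dcube s j x)"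
    "\<Phi> (dcube s j x) \<le> ennreal (4 * D) * (\<integral>\<^sup>+y\<in>dcube s j x - \<Union>F. H y \<partial>lebesgue) + (\<integral>\<^sup>+P. \<Phi> P \<partial>count_space F)"
proof -
  let ?Q = "dcube s j x"
  define q where "q = (s / 2 ^ j) ^ DIM('a)"
  have q: "emeasure lebesgue ?Q = ennreal q" "0 < q" using emeasure_dcube by (auto simp: q_def)
  have bad: "bad ?Q \<in> sets lebesgue" "bad ?Q \<subseteq> ?Q" by (auto simp: bad_def[of ?Q])
  obtain F where F: "countable F" "disjoint F"
    "\<And>P. P \<in> F \<Longrightarrow> P \<subseteq> ?Q \<and> (\<exists>i y. P = dcube s i y) \<and>
       emeasure lebesgue (P \<inter> bad ?Q) \<le> ennreal (1 / 2) * emeasure lebesgue P"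
    "emeasure lebesgue (\<Union>F) \<le> ennreal (1 / 2) * emeasure lebesgue ?Q"
    "AE y in lebesgue. y \<in> bad ?Q \<longrightarrow> y \<in> \<Union>F"
    by (rule stopping_cubes[OF s bad emeasure_bad]) (rule that)
  have Fm [measurable]: "P \<in> sets lebesgue" if "P \<in> F" for P using F(3)[OF that] by auto
  have UF [measurable]: "\<Union>F \<in> sets lebesgue" using F(1) Fm by (intro sets.countable_Union) auto
  have UFQ: "\<Union>F \<subseteq> ?Q" using F(3) by blast
  define \<phi> where "\<phi> y = ennreal ((norm (h y - c ?Q) + a ?Q) * g y)" for y
  have \<phi> [measurable]: "\<phi> \<in> borel_measurable lebesgue" unfolding \<phi>_def by measurable
  define \<gamma> where "\<gamma> y = ennreal (2 * a ?Q) * ennreal (g y)" for y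
  have \<gamma> [measurable]: "\<gamma> \<in> borel_measurable lebesgue" unfolding \<gamma>_def by measurable
  \<comment> \<open>The bad parts of \<open>?Q\<close> and of \<open>P\<close> occupy at most 1/2
    and 1/4 of \<open>P\<close>, so some point of \<open>P\<close> has values near both
    constants.\<close>
  have close: "norm (c ?Q - c P) \<le> a ?Q + a P" if P: "P \<in> F" for P
  proof -
    obtain i y where Pi: "P = dcube s i y" using F(3)[OF P] by blast
    have "\<not> P \<subseteq> (P \<inter> bad ?Q) \<union> bad P"
    proof
      assume "P \<subseteq> (P \<inter> bad ?Q) \<union> bad P"
      then have "emeasure lebesgue P \<le> emeasure lebesgue ((P \<inter> bad ?Q) \<union> bad P)"
        using Fm[OF P] bad by (intro emeasure_mono) auto
      also have "\<dots> \<le> emeasure lebesgue (P \<inter> bad ?Q) + emeasure lebesgue (bad P)"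
        using Fm[OF P] bad by (intro emeasure_subadditive) auto
      also have "\<dots> \<le> ennreal (1 / 2) * emeasure lebesgue P + ennreal (1 / 4) * emeasure lebesgue P"
        using F(3)[OF P] emeasure_bad_quarter unfolding Pi by (intro add_mono) auto
      also have "\<dots> = (ennreal (1 / 2) + ennreal (1 / 4)) * emeasure lebesgue P"
        by (rule distrib_right[symmetric])
      also have "ennreal (1 / 2) + ennreal (1 / 4) = ennreal (1 / 2 + 1 / 4)"
        by (intro ennreal_plus[symmetric]) auto
      finally show False
        using emeasure_dcube(1)[of i y] emeasure_dcube(2)[of i] unfolding Pi by (simp flip: ennreal_mult)
    qed
    then obtain y where "y \<in> P" "y \<notin> bad ?Q" "y \<notin> bad P" by blast
    then have "norm (h y - c ?Q) \<le> a ?Q" "norm (h y - c P) \<le> a P"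
      using F(3)[OF P] by (auto simp: bad_def)
    then show ?thesis
      using norm_triangle_ineq4[of "h y - c P" "h y - c ?Q"] by simp
  qed
  have 1: "(\<integral>\<^sup>+y\<in>?Q - \<Union>F. \<phi> y \<partial>lebesgue) \<le> (\<integral>\<^sup>+y\<in>?Q - \<Union>F. \<gamma> y \<partial>lebesgue)"
  proof (rule nn_integral_mono_AE)
    show "AE y in lebesgue. \<phi> y * indicator (?Q - \<Union>F) y \<le> \<gamma> y * indicator (?Q - \<Union>F) y"
      using F(5)
    proof eventually_elim
      case (elim y)
      show ?case
      proof (cases "y \<in> ?Q - \<Union>F")
        case True
        then have "norm (h y - c ?Q) \<le> a ?Q" using elim by (auto simp: bad_def)
        then have "(norm (h y - c ?Q) + a ?Q) * g y \<le> 2 * a ?Q * g y"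
          using g by (intro mult_right_mono) auto
        then show ?thesis
          using True a(1)[of ?Q] g(2)[of y] by (simp add: \<phi>_def \<gamma>_def ennreal_leI flip: ennreal_mult)
      qed auto
    qed
  qed
  have 2: "(\<integral>\<^sup>+y\<in>P. \<phi> y \<partial>lebesgue) \<le> \<Phi> P + (\<integral>\<^sup>+y\<in>P. \<gamma> y \<partial>lebesgue)" if P: "P \<in> F" for P
  proof -
    have [measurable]: "P \<in> sets lebesgue" by (rule Fm[OF P])
    have "(\<integral>\<^sup>+y\<in>P. \<phi> y \<partial>lebesgue) \<le> (\<integral>\<^sup>+y. ennreal ((norm (h y - c P) + a P) * g y) * indicator P y + \<gamma> y * indicator P y \<partial>lebesgue)"
    proof (intro nn_integral_mono)
      fix y
      have "norm (h y - c ?Q) \<le> norm (h y - c P) + norm (c P - c ?Q)"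
        using norm_triangle_ineq[of "h y - c P" "c P - c ?Q"] by simp
      then have "(norm (h y - c ?Q) + a ?Q) * g y \<le> ((norm (h y - c P) + a P) + 2 * a ?Q) * g y"
        using g close[OF P] by (intro mult_right_mono) (auto simp: norm_minus_commute)
      then have "\<phi> y \<le> ennreal ((norm (h y - c P) + a P) * g y) + \<gamma> y"
        using a(1)[of ?Q] a(1)[of P] g(2)[of y]
        by (simp add: \<phi>_def \<gamma>_def distrib_right ennreal_leI flip: ennreal_mult ennreal_plus)
      then show "\<phi> y * indicator P y \<le> ennreal ((norm (h y - c P) + a P) * g y) * indicator P y + \<gamma> y * indicator P y"
        by (auto simp: indicator_def)
    qed
    also have "\<dots> = \<Phi> P + (\<integral>\<^sup>+y\<in>P. \<gamma> y \<partial>lebesgue)"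
      unfolding \<Phi>_def by (intro nn_integral_add) measurable
    finally show ?thesis .
  qed
  have Qeq: "?Q = (?Q - \<Union>F) \<union> \<Union>F" using UFQ by blast
  have split: "(\<integral>\<^sup>+y\<in>?Q. u y \<partial>lebesgue) = (\<integral>\<^sup>+y\<in>?Q - \<Union>F. u y \<partial>lebesgue) + (\<integral>\<^sup>+P. (\<integral>\<^sup>+y\<in>P. u y \<partial>lebesgue) \<partial>count_space F)"
    if [measurable]: "u \<in> borel_measurable lebesgue" for u
  proof -
    have "(\<integral>\<^sup>+y\<in>?Q. u y \<partial>lebesgue) = (\<integral>\<^sup>+y\<in>(?Q - \<Union>F) \<union> \<Union>F. u y \<partial>lebesgue)"
      using Qeq by simp
    also have "\<dots> = (\<integral>\<^sup>+y\<in>?Q - \<Union>F. u y \<partial>lebesgue) + (\<integral>\<^sup>+y\<in>\<Union>F. u y \<partial>lebesgue)"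
      by (intro nn_integral_disjoint_union) auto
    also have "(\<integral>\<^sup>+y\<in>\<Union>F. u y \<partial>lebesgue) = (\<integral>\<^sup>+P. (\<integral>\<^sup>+y\<in>P. u y \<partial>lebesgue) \<partial>count_space F)"
      using F(1,2) Fm by (intro nn_integral_UN_disjoint_sets) auto
    finally show ?thesis .
  qed
  have "\<Phi> ?Q = (\<integral>\<^sup>+y\<in>?Q. \<phi> y \<partial>lebesgue)" by (simp add: \<Phi>_def \<phi>_def)
  also have "\<dots> = (\<integral>\<^sup>+y\<in>?Q - \<Union>F. \<phi> y \<partial>lebesgue) + (\<integral>\<^sup>+P. (\<integral>\<^sup>+y\<in>P. \<phi> y \<partial>lebesgue) \<partial>count_space F)"
    by (rule split[OF \<phi>])
  also have "\<dots> \<le> (\<integral>\<^sup>+y\<in>?Q - \<Union>F. \<gamma> y \<partial>lebesgue) + (\<integral>\<^sup>+P. \<Phi> P + (\<integral>\<^sup>+y\<in>P. \<gamma> y \<partial>lebesgue) \<partial>count_space F)"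
    by (intro add_mono 1 nn_integral_mono) (use 2 in auto)
  also have "\<dots> = (\<integral>\<^sup>+y\<in>?Q. \<gamma> y \<partial>lebesgue) + (\<integral>\<^sup>+P. \<Phi> P \<partial>count_space F)"
    unfolding split[OF \<gamma>] by (subst nn_integral_add) (auto simp: ac_simps)
  \<comment> \<open>The bound \<open>average\<close> holds with every point of \<open>?Q\<close> on
    its right side. Integrated over the part outside the subcubes, of measure at least q/2, it
    yields 4 D: a factor 2 from \<gamma> and another from the half.\<close>
  also have "(\<integral>\<^sup>+y\<in>?Q. \<gamma> y \<partial>lebesgue) \<le> ennreal (4 * D) * (\<integral>\<^sup>+y\<in>?Q - \<Union>F. H y \<partial>lebesgue)"
  proof -
    define X where "X = ennreal (a ?Q) * (\<integral>\<^sup>+y\<in>?Q. ennreal (g y) \<partial>lebesgue)"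
    have half: "ennreal (q / 2) \<le> emeasure lebesgue (?Q - \<Union>F)"
      using q F(4) by (intro emeasure_Diff_ge_half) auto
    have "X * ennreal (q / 2) \<le> X * emeasure lebesgue (?Q - \<Union>F)"
      by (intro mult_left_mono half) auto
    also have "\<dots> = (\<integral>\<^sup>+y\<in>?Q - \<Union>F. X \<partial>lebesgue)"
      by (simp add: nn_integral_cmult_indicator)
    also have "\<dots> \<le> (\<integral>\<^sup>+y. ennreal (D * q) * (H y * indicator (?Q - \<Union>F) y) \<partial>lebesgue)"
      using average[of _ j x] D q by (intro nn_integral_mono) (auto simp: indicator_def X_def ennreal_mult)
    also have "\<dots> = ennreal (D * q) * (\<integral>\<^sup>+y\<in>?Q - \<Union>F. H y \<partial>lebesgue)"
      by (intro nn_integral_cmult) measurable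
    finally have "ennreal (4 / q) * (ennreal (q / 2) * X) \<le> ennreal (4 / q) * (ennreal (D * q) * (\<integral>\<^sup>+y\<in>?Q - \<Union>F. H y \<partial>lebesgue))"
      by (intro mult_left_mono) (auto simp: mult.commute)
    also have "ennreal (4 / q) * (ennreal (D * q) * (\<integral>\<^sup>+y\<in>?Q - \<Union>F. H y \<partial>lebesgue)) = ennreal (4 * D) * (\<integral>\<^sup>+y\<in>?Q - \<Union>F. H y \<partial>lebesgue)"
      using D q by (subst ennreal_mult_mult) auto
    also have "ennreal (4 / q) * (ennreal (q / 2) * X) = ennreal 2 * X"
      using q by (subst ennreal_mult_mult) auto
    also have "ennreal 2 * X = (\<integral>\<^sup>+y. ennreal (2 * a ?Q) * (ennreal (g y) * indicator ?Q y) \<partial>lebesgue)"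
      using a(1)[of ?Q] by (simp add: X_def nn_integral_cmult ennreal_mult mult.assoc)
    finally show ?thesis by (simp add: \<gamma>_def mult.assoc)
  qed
  finally show ?thesis
    using F by (intro that[of F]) (auto intro: add_right_mono)
qed

text \<open>\<Omega> is the union of the k-th generation of subcubes. The integrals of
  \<open>H\<close> from different generations run over disjoint sets, so the constant 4 D does not
  grow with \<open>k\<close>.\<close>

lemma \<Phi>_iterate:
  "\<exists>\<Omega>. \<Omega> \<in> sets lebesgue \<and> \<Omega> \<subseteq> dcube s j x \<and>
    emeasure lebesgue \<Omega> \<le> ennreal ((1 / 2) ^ k) * emeasure lebesgue (dcube s j x) \<and>
    \<Phi> (dcube s j x) \<le> ennreal (4 * D) * (\<integral>\<^sup>+y\<in>dcube s j x - \<Omega>. H y \<partial>lebesgue) + (\<integral>\<^sup>+y\<in>\<Omega>. v y \<partial>lebesgue)"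
proof (induction k arbitrary: j x)
  case 0
  show ?case
    using \<Phi>_le_v[of j x] by (intro exI[of _ "dcube s j x"]) auto
next
  case (Suc k)
  let ?Q = "dcube s j x"
  obtain F where F: "countable F" "disjoint F" "\<And>P. P \<in> F \<Longrightarrow> P \<subseteq> ?Q \<and> (\<exists>i y. P = dcube s i y)"
    "emeasure lebesgue (\<Union>F) \<le> ennreal (1 / 2) * emeasure lebesgue ?Q"
    "\<Phi> ?Q \<le> ennreal (4 * D) * (\<integral>\<^sup>+y\<in>?Q - \<Union>F. H y \<partial>lebesgue) + (\<integral>\<^sup>+P. \<Phi> P \<partial>count_space F)"
    by (rule \<Phi>_step) (rule that)
  have Fm [measurable]: "P \<in> sets lebesgue" if "P \<in> F" for P using F(3)[OF that] by auto
  have UF [measurable]: "\<Union>F \<in> sets lebesgue" using F(1) Fm by (intro sets.countable_Union) auto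
  have "\<forall>P\<in>F. \<exists>\<Omega>. \<Omega> \<in> sets lebesgue \<and> \<Omega> \<subseteq> P \<and>
    emeasure lebesgue \<Omega> \<le> ennreal ((1 / 2) ^ k) * emeasure lebesgue P \<and>
    \<Phi> P \<le> ennreal (4 * D) * (\<integral>\<^sup>+y\<in>P - \<Omega>. H y \<partial>lebesgue) + (\<integral>\<^sup>+y\<in>\<Omega>. v y \<partial>lebesgue)"
  proof
    fix P assume "P \<in> F"
    then obtain i y where "P = dcube s i y" using F(3) by blast
    then show "\<exists>\<Omega>. \<Omega> \<in> sets lebesgue \<and> \<Omega> \<subseteq> P \<and>
      emeasure lebesgue \<Omega> \<le> ennreal ((1 / 2) ^ k) * emeasure lebesgue P \<and>
      \<Phi> P \<le> ennreal (4 * D) * (\<integral>\<^sup>+y\<in>P - \<Omega>. H y \<partial>lebesgue) + (\<integral>\<^sup>+y\<in>\<Omega>. v y \<partial>lebesgue)"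
      using Suc.IH by simp
  qed
  from bchoice[OF this] obtain \<Omega> where \<Omega>: "\<And>P. P \<in> F \<Longrightarrow> \<Omega> P \<in> sets lebesgue" "\<And>P. P \<in> F \<Longrightarrow> \<Omega> P \<subseteq> P"
    "\<And>P. P \<in> F \<Longrightarrow> emeasure lebesgue (\<Omega> P) \<le> ennreal ((1 / 2) ^ k) * emeasure lebesgue P"
    "\<And>P. P \<in> F \<Longrightarrow> \<Phi> P \<le> ennreal (4 * D) * (\<integral>\<^sup>+y\<in>P - \<Omega> P. H y \<partial>lebesgue) + (\<integral>\<^sup>+y\<in>\<Omega> P. v y \<partial>lebesgue)"
    by blast
  define U where "U = (\<Union>P\<in>F. \<Omega> P)"
  have disj0: "P \<inter> P' = {}" if "P \<in> F" "P' \<in> F" "P \<noteq> P'" for P P'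
    using F(2) that by (auto simp: disjoint_def)
  have disj: "disjoint_family_on \<Omega> F" "disjoint_family_on (\<lambda>P. P - \<Omega> P) F"
  proof -
    have "\<Omega> P \<inter> \<Omega> P' = {}" if PP': "P \<in> F" "P' \<in> F" "P \<noteq> P'" for P P'
      using disj0[OF PP'] \<Omega>(2)[OF PP'(1)] \<Omega>(2)[OF PP'(2)] by blast
    then show "disjoint_family_on \<Omega> F" by (simp add: disjoint_family_on_def)
    have "(P - \<Omega> P) \<inter> (P' - \<Omega> P') = {}" if PP': "P \<in> F" "P' \<in> F" "P \<noteq> P'" for P P'
      using disj0[OF PP'] by blast
    then show "disjoint_family_on (\<lambda>P. P - \<Omega> P) F" by (simp add: disjoint_family_on_def)
  qed
  have U [measurable]: "U \<in> sets lebesgue"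
    unfolding U_def using F(1) \<Omega>(1) by (intro sets.countable_UN') auto
  have UF2: "(\<Union>P\<in>F. P - \<Omega> P) = \<Union>F - U"
  proof -
    have "x \<notin> \<Omega> P'" if "P \<in> F" "x \<in> P" "x \<notin> \<Omega> P" "P' \<in> F" for x P P'
      using disj0[of P P'] \<Omega>(2)[of P'] that by (cases "P = P'") auto
    then show ?thesis unfolding U_def by blast
  qed
  have sub: "U \<subseteq> \<Union>F" "\<Union>F \<subseteq> ?Q" using \<Omega>(2) F(3) by (auto simp: U_def)
  have "emeasure lebesgue U = (\<integral>\<^sup>+P. emeasure lebesgue (\<Omega> P) \<partial>count_space F)"
    unfolding U_def using F(1) \<Omega>(1) disj by (intro emeasure_UN_countable) auto
  also have "\<dots> \<le> (\<integral>\<^sup>+P. ennreal ((1 / 2) ^ k) * emeasure lebesgue P \<partial>count_space F)"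
    using \<Omega>(3) by (intro nn_integral_mono) auto
  also have "\<dots> = ennreal ((1 / 2) ^ k) * emeasure lebesgue (\<Union>F)"
    using F(1,2) Fm by (simp add: nn_integral_cmult emeasure_Union_disjoint_sets)
  also have "\<dots> \<le> ennreal ((1 / 2) ^ k) * (ennreal (1 / 2) * emeasure lebesgue ?Q)"
    by (intro mult_left_mono F(4)) auto
  also have "\<dots> = ennreal ((1 / 2) ^ Suc k) * emeasure lebesgue ?Q"
    by (subst ennreal_mult_mult) (auto simp: mult.commute)
  finally have small: "emeasure lebesgue U \<le> ennreal ((1 / 2) ^ Suc k) * emeasure lebesgue ?Q" .
  have "(\<integral>\<^sup>+P. \<Phi> P \<partial>count_space F) \<le> (\<integral>\<^sup>+P. ennreal (4 * D) * (\<integral>\<^sup>+y\<in>P - \<Omega> P. H y \<partial>lebesgue) + (\<integral>\<^sup>+y\<in>\<Omega> P. v y \<partial>lebesgue) \<partial>count_space F)"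
    using \<Omega>(4) by (intro nn_integral_mono) auto
  also have "\<dots> = ennreal (4 * D) * (\<integral>\<^sup>+P. (\<integral>\<^sup>+y\<in>P - \<Omega> P. H y \<partial>lebesgue) \<partial>count_space F) + (\<integral>\<^sup>+P. (\<integral>\<^sup>+y\<in>\<Omega> P. v y \<partial>lebesgue) \<partial>count_space F)"
    by (simp add: nn_integral_add nn_integral_cmult)
  also have "(\<integral>\<^sup>+P. (\<integral>\<^sup>+y\<in>P - \<Omega> P. H y \<partial>lebesgue) \<partial>count_space F) = (\<integral>\<^sup>+y\<in>\<Union>F - U. H y \<partial>lebesgue)"
    unfolding UF2[symmetric] using F(1) disj \<Omega>(1) Fm by (intro nn_integral_UN_disjoint_family[symmetric]) auto
  also have "(\<integral>\<^sup>+P. (\<integral>\<^sup>+y\<in>\<Omega> P. v y \<partial>lebesgue) \<partial>count_space F) = (\<integral>\<^sup>+y\<in>U. v y \<partial>lebesgue)"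
    unfolding U_def using F(1) disj \<Omega>(1) by (intro nn_integral_UN_disjoint_family[symmetric]) auto
  finally have "\<Phi> ?Q \<le> ennreal (4 * D) * (\<integral>\<^sup>+y\<in>?Q - \<Union>F. H y \<partial>lebesgue) +
      (ennreal (4 * D) * (\<integral>\<^sup>+y\<in>\<Union>F - U. H y \<partial>lebesgue) + (\<integral>\<^sup>+y\<in>U. v y \<partial>lebesgue))"
    using F(5) add_left_mono order_trans by blast
  also have "\<dots> = ennreal (4 * D) * ((\<integral>\<^sup>+y\<in>?Q - \<Union>F. H y \<partial>lebesgue) + (\<integral>\<^sup>+y\<in>\<Union>F - U. H y \<partial>lebesgue)) + (\<integral>\<^sup>+y\<in>U. v y \<partial>lebesgue)"
    by (simp add: distrib_left add.assoc)
  also have "(\<integral>\<^sup>+y\<in>?Q - \<Union>F. H y \<partial>lebesgue) + (\<integral>\<^sup>+y\<in>\<Union>F - U. H y \<partial>lebesgue) = (\<integral>\<^sup>+y\<in>(?Q - \<Union>F) \<union> (\<Union>F - U). H y \<partial>lebesgue)"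
    by (intro nn_integral_disjoint_union[symmetric]) auto
  also have "(?Q - \<Union>F) \<union> (\<Union>F - U) = ?Q - U" using sub by blast
  finally show ?case
    using small sub by (intro exI[of _ U]) auto
qed

text \<open>As \<open>k\<close> grows, the integral of \<open>v\<close> over the remaining set tends
  to 0. Its smallness on small sets comes from |h| \<le> \<tau> |h|^2 + 1/\<tau>: first \<tau> is
  fixed so that the quadratic part contributes at most e/2, then \<open>k\<close> so that the
  bounded part does.\<close>

lemma \<Phi>_le: "\<Phi> (dcube s j x) \<le> ennreal (4 * D) * (\<integral>\<^sup>+y\<in>dcube s j x. H y \<partial>lebesgue)"
proof (rule ennreal_le_epsilon)
  fix e :: real assume e: "0 < e"
  let ?Q = "dcube s j x"
  define q where "q = (s / 2 ^ j) ^ DIM('a)"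
  have q: "emeasure lebesgue ?Q = ennreal q" "0 < q" using emeasure_dcube by (auto simp: q_def)
  define N where "N = (L2_norm h)\<^sup>2"
  have N: "(\<integral>\<^sup>+y. ennreal ((norm (h y))\<^sup>2) \<partial>lebesgue) = ennreal N" "0 \<le> N"
    using nn_integral_eq_L2_norm[OF h] by (auto simp: N_def)
  define \<tau> where "\<tau> = e / (2 * (3 * B * N + 1))"
  have "0 \<le> 3 * B * N" using B N by simp
  then have \<tau>: "0 < \<tau>" using e by (simp add: \<tau>_def)
  have "3 * B * N * e \<le> (3 * B * N + 1) * e"
    using e by simp
  then have \<tau>N: "3 * B * \<tau> * N \<le> e / 2"
    using \<open>0 \<le> 3 * B * N\<close> by (simp add: \<tau>_def field_simps)
  define L where "L = 3 * B * (1 / \<tau> + b)"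
  have L: "0 \<le> L" using B b \<tau> by (simp add: L_def)
  have "(\<lambda>k. L * q * (1 / 2) ^ k) \<longlonglongrightarrow> L * q * 0"
    by (intro tendsto_mult tendsto_const LIMSEQ_power_zero) auto
  then have "eventually (\<lambda>k. L * q * (1 / 2) ^ k < e / 2) sequentially"
    using e by (intro order_tendstoD(2)) auto
  then obtain k where k: "L * q * (1 / 2) ^ k < e / 2"
    by (auto simp: eventually_sequentially)
  obtain \<Omega> where \<Omega>: "\<Omega> \<in> sets lebesgue" "\<Omega> \<subseteq> ?Q"
    "emeasure lebesgue \<Omega> \<le> ennreal ((1 / 2) ^ k) * emeasure lebesgue ?Q"
    "\<Phi> ?Q \<le> ennreal (4 * D) * (\<integral>\<^sup>+y\<in>?Q - \<Omega>. H y \<partial>lebesgue) + (\<integral>\<^sup>+y\<in>\<Omega>. v y \<partial>lebesgue)"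
    using \<Phi>_iterate by blast
  note [measurable] = \<Omega>(1)
  \<comment> \<open>Rearranged from (\<tau> |h| - 1)^2 + \<tau> |h| \<ge> 0, divided by
    \<tau>.\<close>
  have pw: "v y \<le> ennreal (3 * B * \<tau>) * ennreal ((norm (h y))\<^sup>2) + ennreal L" for y
  proof -
    have "0 \<le> (\<tau> * norm (h y) - 1)\<^sup>2 + \<tau> * norm (h y)" using \<tau> by simp
    then have "\<tau> * norm (h y) \<le> \<tau> * (\<tau> * (norm (h y))\<^sup>2 + 1 / \<tau>)"
      using \<tau> by (simp add: power2_eq_square algebra_simps)
    then have "norm (h y) \<le> \<tau> * (norm (h y))\<^sup>2 + 1 / \<tau>"
      using \<tau> by (simp only: mult_le_cancel_left_pos)
    then have "3 * B * (norm (h y) + b) \<le> 3 * B * (\<tau> * (norm (h y))\<^sup>2 + 1 / \<tau> + b)"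
      using B by (intro mult_left_mono) auto
    also have "\<dots> = 3 * B * \<tau> * (norm (h y))\<^sup>2 + L"
      by (simp add: L_def algebra_simps)
    finally show ?thesis
      using B \<tau> L unfolding v_def by (simp add: ennreal_leI flip: ennreal_mult ennreal_plus)
  qed
  have "(\<integral>\<^sup>+y\<in>\<Omega>. v y \<partial>lebesgue) \<le> (\<integral>\<^sup>+y. ennreal (3 * B * \<tau>) * ennreal ((norm (h y))\<^sup>2) + ennreal L * indicator \<Omega> y \<partial>lebesgue)"
    using pw by (intro nn_integral_mono) (auto simp: indicator_def)
  also have "\<dots> = ennreal (3 * B * \<tau>) * ennreal N + ennreal L * emeasure lebesgue \<Omega>"
    by (simp add: nn_integral_add nn_integral_cmult nn_integral_cmult_indicator N)
  also have "\<dots> \<le> ennreal (3 * B * \<tau>) * ennreal N + ennreal L * (ennreal ((1 / 2) ^ k) * ennreal q)"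
    using \<Omega>(3) q by (intro add_left_mono mult_left_mono) auto
  also have "\<dots> = ennreal (3 * B * \<tau> * N + L * q * (1 / 2) ^ k)"
    using B \<tau> N L q by (simp add: mult_ac flip: ennreal_mult ennreal_plus)
  also have "\<dots> \<le> ennreal e" using \<tau>N k by (intro ennreal_leI) linarith
  finally have "(\<integral>\<^sup>+y\<in>\<Omega>. v y \<partial>lebesgue) \<le> ennreal e" .
  moreover have "ennreal (4 * D) * (\<integral>\<^sup>+y\<in>?Q - \<Omega>. H y \<partial>lebesgue) \<le> ennreal (4 * D) * (\<integral>\<^sup>+y\<in>?Q. H y \<partial>lebesgue)"
    by (intro mult_left_mono nn_integral_set_mono) auto
  ultimately show "\<Phi> ?Q \<le> ennreal (4 * D) * (\<integral>\<^sup>+y\<in>?Q. H y \<partial>lebesgue) + ennreal e"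
    using \<Omega>(4) by (meson add_mono order_trans)
qed

end

section \<open>The bilinear estimate\<close>

context cz_operator
begin

text \<open>The constant is the far part of the singular integral at the base point
  \<open>z\<close>. Moving \<open>z\<close> within the cube changes it by at most a multiple of
  \<alpha>, by regularity in the first variable; the near part is left to the weak type
  estimate.\<close>

lemma oscillation_bound:
  obtains W where "0 < W"
    "\<And>f z \<sigma> \<alpha>. f \<in> Linf_c \<Longrightarrow> 0 < \<sigma> \<Longrightarrow> 0 < \<alpha> \<Longrightarrow>
      (\<forall>\<rho>\<ge>real DIM('a) * \<sigma>. (\<integral>\<^sup>+y\<in>ball z \<rho>. norm (f y) \<partial>lebesgue) \<le> ennreal (\<alpha> * \<rho> ^ DIM('a))) \<Longrightarrow>
      emeasure lebesgue {x \<in> grid_cube \<sigma> z. W * \<alpha> <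
          norm (T f x - (LINT y|lebesgue. K z y * (f y * indicator (- ball z (2 * real DIM('a) * \<sigma>)) y)))}
        \<le> ennreal (1 / 2 ^ (DIM('a) + 2)) * emeasure lebesgue (grid_cube \<sigma> z)"
proof -
  let ?n = "DIM('a)"
  obtain W0 where W0: "0 < W0" "\<And>f t. f \<in> Linf_c \<Longrightarrow> 0 < t \<Longrightarrow>
      emeasure lebesgue {x. t < norm (T f x)} \<le> ennreal (W0 / t) * (\<integral>\<^sup>+x. norm (f x) \<partial>lebesgue)"
    by (rule weak_type_11) (rule that)
  define \<kappa> :: real where "\<kappa> = 1 / 2 ^ (?n + 2)"
  have \<kappa>: "0 < \<kappa>" by (simp add: \<kappa>_def)
  \<comment> \<open>Chosen so that the weak type bound at level W1 \<alpha>, for a near part of mass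
    at most \<alpha> (2 n \<sigma>)^n, is exactly the fraction \<kappa> of the cube.\<close>
  define W1 where "W1 = W0 * (2 * real ?n) ^ ?n / \<kappa>"
  define W2 where "W2 = C * tail_const ?n \<epsilon>"
  have W12: "0 < W1" "0 \<le> W2" using W0 \<kappa> C tail_const_nonneg[OF \<epsilon>] by (auto simp: W1_def W2_def)
  show ?thesis
  proof (rule that[of "W1 + W2"])
    show "0 < W1 + W2" using W12 by linarith
  next
    fix f :: "'a \<Rightarrow> complex" and z :: 'a and \<sigma> \<alpha> :: real
    assume f: "f \<in> Linf_c" and \<sigma>: "0 < \<sigma>" and \<alpha>: "0 < \<alpha>"
      and "\<forall>\<rho>\<ge>real ?n * \<sigma>. (\<integral>\<^sup>+y\<in>ball z \<rho>. norm (f y) \<partial>lebesgue) \<le> ennreal (\<alpha> * \<rho> ^ ?n)"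
    then have ball: "(\<integral>\<^sup>+y\<in>ball z \<rho>. norm (f y) \<partial>lebesgue) \<le> ennreal (\<alpha> * \<rho> ^ ?n)" if "real ?n * \<sigma> \<le> \<rho>" for \<rho>
      using that by blast
    \<comment> \<open>Points of the cube are within \<open>r\<close> of \<open>z\<close>. Cutting
      \<open>f\<close> at distance 2 r provides the ratio 1/2 that the regularity condition demands
      and keeps the far part at distance at least \<open>r\<close> from the cube.\<close>
    define r where "r = real ?n * \<sigma>"
    have r: "0 < r" using \<sigma> by (simp add: r_def)
    define f1 where "f1 y = f y * indicator (ball z (2 * r)) y" for y
    define f2 where "f2 y = f y * indicator (- ball z (2 * r)) y" for y
    define c where "c = (LINT y|lebesgue. K z y * f2 y)"
    have f12: "f1 \<in> Linf_c" "f2 \<in> Linf_c"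
      unfolding f1_def f2_def by (intro Linf_c_indicator f; simp add: Compl_in_sets_lebesgue)+
    have [measurable]: "f \<in> borel_measurable lebesgue" using f by (simp add: Linf_c_def)
    have [measurable]: "T f1 \<in> borel_measurable lebesgue" using f12 by (auto intro!: T_measurable Linf_c_subset_L2)
    have "f = (\<lambda>y. f1 y + f2 y)" by (auto simp: f1_def f2_def indicator_def)
    moreover have "AE x in lebesgue. T (\<lambda>y. f1 y + f2 y) x = T f1 x + T f2 x"
      by (intro T_add Linf_c_subset_L2 f12)
    ultimately have split: "AE x in lebesgue. T f x = T f1 x + T f2 x" by simp
    have cube: "norm (x - z) < r" if "x \<in> grid_cube \<sigma> z" for x
      using norm_diff_grid_cube[OF \<sigma> that grid_cube_self] by (simp add: r_def)
    have f2_far: "2 * r \<le> norm (z - y)" if "f2 y \<noteq> 0" for y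
      using that by (auto simp: f2_def indicator_def dist_norm split: if_splits)
    have far: "norm ((LINT y|lebesgue. K x y * f2 y) - c) \<le> W2 * \<alpha>" if x: "x \<in> grid_cube \<sigma> z" for x
    proof -
      have xz: "norm (x - z) < r" by (rule cube[OF x])
      have "r \<le> norm (x - y)" if "f2 y \<noteq> 0" for y
        using xz f2_far[OF that] norm_triangle_ineq4[of "x - y" "x - z"] by simp
      then have int1: "integrable lebesgue (\<lambda>y. K x y * f2 y)"
        using integrable_kernel[OF f12(2) r] by blast
      have int2: "integrable lebesgue (\<lambda>y. K z y * f2 y)"
        using integrable_kernel[OF f12(2), of "2 * r" z] f2_far r by auto
      have "ennreal (norm ((LINT y|lebesgue. K x y * f2 y) - c)) \<le> (\<integral>\<^sup>+y. norm (K x y * f2 y - K z y * f2 y) \<partial>lebesgue)"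
        using integral_norm_bound_ennreal[OF Bochner_Integration.integrable_diff[OF int1 int2]] int1 int2 by (simp add: c_def)
      also have "\<dots> \<le> (\<integral>\<^sup>+y. ennreal C * ((ennreal ((2 * r) powr \<epsilon> * norm (z - y) powr (- real ?n - \<epsilon>)) * ennreal (norm (f y))) * indicator (- ball z (2 * r)) y) \<partial>lebesgue)"
      proof (intro nn_integral_mono)
        fix y
        show "ennreal (norm (K x y * f2 y - K z y * f2 y)) \<le> ennreal C * ((ennreal ((2 * r) powr \<epsilon> * norm (z - y) powr (- real ?n - \<epsilon>)) * ennreal (norm (f y))) * indicator (- ball z (2 * r)) y)"
        proof (cases "f2 y = 0")
          case False
          have y: "2 * r \<le> norm (z - y)" "y \<in> - ball z (2 * r)" "f2 y = f y"
            using f2_far[OF False] by (auto simp: dist_norm f2_def)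
          have "z \<noteq> y" "norm (x - z) \<le> norm (z - y) / 2" using y(1) r xz by auto
          from K_smooth[OF this]
          have "norm (K x y - K z y) \<le> C * norm (x - z) powr \<epsilon> * norm (z - y) powr (- real ?n - \<epsilon>)"
            using norm_ge_zero[of "K z (y + (x - z)) - K z y"] by (simp del: norm_ge_zero)
          also have "\<dots> \<le> C * (2 * r) powr \<epsilon> * norm (z - y) powr (- real ?n - \<epsilon>)"
            using xz r \<epsilon> C by (intro mult_right_mono mult_left_mono powr_mono2) auto
          finally have "norm (K x y - K z y) * norm (f y)
            \<le> C * (2 * r) powr \<epsilon> * norm (z - y) powr (- real ?n - \<epsilon>) * norm (f y)"
            by (intro mult_right_mono) auto
          then have "norm (K x y * f2 y - K z y * f2 y) \<le> C * ((2 * r) powr \<epsilon> * norm (z - y) powr (- real ?n - \<epsilon>) * norm (f y))"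
            unfolding y(3) by (simp add: left_diff_distrib[symmetric] norm_mult mult.assoc)
          then show ?thesis
            using C y(2) by (auto simp flip: ennreal_mult intro!: ennreal_leI)
        qed simp
      qed
      also have "\<dots> = ennreal C * (\<integral>\<^sup>+y\<in>- ball z (2 * r). (ennreal ((2 * r) powr \<epsilon> * norm (z - y) powr (- real ?n - \<epsilon>)) * ennreal (norm (f y))) \<partial>lebesgue)"
        by (intro nn_integral_cmult) measurable
      also have "\<dots> \<le> ennreal C * (ennreal (tail_const ?n \<epsilon>) * ennreal \<alpha>)"
      proof (intro mult_left_mono nn_integral_tail_le \<epsilon>)
        fix \<rho> assume \<rho>: "2 * r \<le> \<rho>"
        then have "(\<integral>\<^sup>+y\<in>ball z \<rho>. norm (f y) \<partial>lebesgue) \<le> ennreal (\<alpha> * \<rho> ^ ?n)"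
          using r by (intro ball) (auto simp: r_def)
        then show "(\<integral>\<^sup>+y\<in>ball z \<rho>. ennreal (norm (f y)) \<partial>lebesgue) \<le> ennreal \<alpha> * ennreal (\<rho> ^ ?n)"
          using \<alpha> \<rho> r by (simp flip: ennreal_mult)
      qed (use r in auto)
      also have "\<dots> = ennreal (W2 * \<alpha>)"
        using C \<alpha> tail_const_nonneg[OF \<epsilon>] by (simp add: W2_def mult.assoc flip: ennreal_mult)
      finally show ?thesis
        using \<alpha> W12 by simp
    qed
    have T2: "AE x in lebesgue. x \<in> grid_cube \<sigma> z \<longrightarrow> norm (T f2 x - c) \<le> W2 * \<alpha>"
      using T_kernel[OF f12(2)]
    proof eventually_elim
      case (elim x)
      show ?case
      proof
        assume x: "x \<in> grid_cube \<sigma> z"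
        have "supp f2 \<subseteq> - ball z (2 * r)"
          unfolding supp_def by (intro closure_minimal) (auto simp: f2_def indicator_def split: if_splits)
        then have "x \<notin> supp f2"
          using cube[OF x] r by (auto simp: dist_norm norm_minus_commute)
        then show "norm (T f2 x - c) \<le> W2 * \<alpha>"
          using elim far[OF x] by simp
      qed
    qed
    have m: "{x. W1 * \<alpha> < norm (T f1 x)} \<in> sets lebesgue"
    proof -
      have "{x \<in> space lebesgue. W1 * \<alpha> < norm (T f1 x)} \<in> sets lebesgue" by measurable
      then show ?thesis by simp
    qed
    have "emeasure lebesgue {x \<in> grid_cube \<sigma> z. (W1 + W2) * \<alpha> < norm (T f x - c)} \<le> emeasure lebesgue {x. W1 * \<alpha> < norm (T f1 x)}"
    proof (rule emeasure_mono_AE[OF _ m])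
      show "AE x in lebesgue. x \<in> {x \<in> grid_cube \<sigma> z. (W1 + W2) * \<alpha> < norm (T f x - c)} \<longrightarrow> x \<in> {x. W1 * \<alpha> < norm (T f1 x)}"
        using split T2
      proof eventually_elim
        case (elim x)
        have "norm (T f x - c) \<le> norm (T f1 x) + norm (T f2 x - c)"
          using norm_triangle_ineq[of "T f1 x" "T f2 x - c"] elim(1) by (simp add: algebra_simps)
        then show ?case using elim(2) by (auto simp: algebra_simps)
      qed
    qed
    also have "\<dots> \<le> ennreal (W0 / (W1 * \<alpha>)) * (\<integral>\<^sup>+x. norm (f1 x) \<partial>lebesgue)"
      using W12 \<alpha> by (intro W0(2) f12) auto
    also have "(\<integral>\<^sup>+x. norm (f1 x) \<partial>lebesgue) = (\<integral>\<^sup>+x\<in>ball z (2 * r). norm (f x) \<partial>lebesgue)"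
      by (intro nn_integral_cong) (auto simp: f1_def indicator_def)
    also have "\<dots> \<le> ennreal (\<alpha> * (2 * r) ^ ?n)"
      using r \<sigma> by (intro ball) (auto simp: r_def)
    also have "ennreal (W0 / (W1 * \<alpha>)) * ennreal (\<alpha> * (2 * r) ^ ?n) = ennreal (W0 / (W1 * \<alpha>) * (\<alpha> * (2 * r) ^ ?n))"
      using W0 W12 \<alpha> r by (intro ennreal_mult[symmetric]) auto
    also have "W0 / (W1 * \<alpha>) * (\<alpha> * (2 * r) ^ ?n) = \<kappa> * \<sigma> ^ ?n"
      using W0 \<alpha> \<kappa> by (simp add: W1_def r_def power_mult_distrib)
    also have "ennreal (\<kappa> * \<sigma> ^ ?n) = ennreal \<kappa> * emeasure lebesgue (grid_cube \<sigma> z)"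
      using \<kappa> \<sigma> by (simp add: emeasure_grid_cube ennreal_mult)
    finally show "emeasure lebesgue {x \<in> grid_cube \<sigma> z. (W1 + W2) * \<alpha> <
          norm (T f x - (LINT y|lebesgue. K z y * (f y * indicator (- ball z (2 * real ?n * \<sigma>)) y)))}
        \<le> ennreal (1 / 2 ^ (?n + 2)) * emeasure lebesgue (grid_cube \<sigma> z)"
      by (simp add: c_def f2_def \<kappa>_def r_def mult.assoc mult_left_mono)
  qed
qed

end

section \<open>Elementary properties of the maximal function\<close>

lemma nn_integral_ball_le_maximal:
  assumes "x \<in> ball z r"
  shows "(\<integral>\<^sup>+y\<in>ball z r. norm (f y) \<partial>lebesgue) \<le> maximal f x * emeasure lebesgue (ball z r)"
proof -
  have r: "0 < r" using assms by (metis dist_self mem_ball_leI mem_ball dist_not_less_zero less_le_trans not_less zero_le_dist order_le_less_trans)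
  have "(\<integral>\<^sup>+y\<in>ball z r. norm (f y) \<partial>lebesgue) / emeasure lebesgue (ball z r) \<le> maximal f x"
    unfolding maximal_def using r assms by (intro SUP_upper2[of "(z, r)"]) auto
  then show ?thesis
    using emeasure_lebesgue_ball_pos[OF r, of z] ennreal_divide_le_iff_le_mult by metis
qed

lemma maximal_le:
  assumes "\<And>x. norm (f x) \<le> B"
  shows "maximal f x \<le> ennreal B"
  unfolding maximal_def
proof (intro SUP_least, clarify)
  fix z and r :: real assume r: "0 < r" "x \<in> ball z r"
  obtain m where m: "0 < m" "emeasure lebesgue (ball z r) = ennreal m"
    using emeasure_lebesgue_ball_pos[OF r(1)] by metis
  have "(\<integral>\<^sup>+y\<in>ball z r. norm (f y) \<partial>lebesgue) \<le> (\<integral>\<^sup>+y\<in>ball z r. ennreal B \<partial>lebesgue)"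
    using assms by (intro nn_integral_mono mult_right_mono ennreal_leI) auto
  also have "\<dots> = ennreal B * ennreal m"
    by (simp add: nn_integral_cmult_indicator m)
  finally show "(\<integral>\<^sup>+y\<in>ball z r. norm (f y) \<partial>lebesgue) / emeasure lebesgue (ball z r) \<le> ennreal B"
    using m by (simp add: ennreal_divide_le_iff_le_mult)
qed

text \<open>The balls need not be centred at the point, so each superlevel set is a union of open
  balls and the maximal function is lower semicontinuous.\<close>

lemma maximal_measurable [measurable]: "maximal f \<in> borel_measurable lebesgue"
proof -
  have "open {x. t < maximal f x}" for t
  proof -
    have "{x. t < maximal f x} = (\<Union>(z, r) \<in> {(z, r). 0 < r \<and>
      t < (\<integral>\<^sup>+y\<in>ball z r. norm (f y) \<partial>lebesgue) / emeasure lebesgue (ball z r)}. ball z r)"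
      by (auto simp: maximal_def less_SUP_iff) blast+
    then show ?thesis by auto
  qed
  then have "maximal f \<in> borel_measurable borel"
    by (intro borel_measurableI_greater) auto
  then show ?thesis
    by (intro measurable_completion) simp
qed

context cz_operator
begin

text \<open>\<open>bounded_oscillation\<close> is applied to \<open>T f\<close>, with
  \<open>a Q\<close> a multiple of the infimum of \<open>maximal f\<close> over \<open>Q\<close>.
  Then \<open>a Q\<close> times the average of \<open>g\<close> over \<open>Q\<close> is at most a
  multiple of Mf(y) Mg(y) at every y in \<open>Q\<close>, which is the condition
  \<open>average\<close>.\<close>

lemma T_bilinear_bound:
  obtains D where "0 \<le> D"
    "\<And>f g B R. f \<in> Linf_c \<Longrightarrow> g \<in> borel_measurable lebesgue \<Longrightarrow> \<forall>y. 0 \<le> g y \<Longrightarrow> \<forall>y. g y \<le> B \<Longrightarrow>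
      \<forall>y. g y \<noteq> 0 \<longrightarrow> norm y < R \<Longrightarrow>
      (\<integral>\<^sup>+y. ennreal (norm (T f y) * g y) \<partial>lebesgue)
        \<le> ennreal D * (\<integral>\<^sup>+y. maximal f y * maximal (\<lambda>y. complex_of_real (g y)) y \<partial>lebesgue)"
proof -
  let ?n = "DIM('a)"
  let ?V = "unit_ball_vol (real ?n)"
  obtain W where W: "0 < W"
    "\<And>f z \<sigma> \<alpha>. f \<in> Linf_c \<Longrightarrow> 0 < \<sigma> \<Longrightarrow> 0 < \<alpha> \<Longrightarrow>
      (\<forall>\<rho>\<ge>real ?n * \<sigma>. (\<integral>\<^sup>+y\<in>ball z \<rho>. norm (f y) \<partial>lebesgue) \<le> ennreal (\<alpha> * \<rho> ^ ?n)) \<Longrightarrow>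
      emeasure lebesgue {x \<in> grid_cube \<sigma> z. W * \<alpha> <
          norm (T f x - (LINT y|lebesgue. K z y * (f y * indicator (- ball z (2 * real ?n * \<sigma>)) y)))}
        \<le> ennreal (1 / 2 ^ (?n + 2)) * emeasure lebesgue (grid_cube \<sigma> z)"
    by (rule oscillation_bound) (rule that)
  \<comment> \<open>\<open>W\<close> and one \<open>?V\<close> come from \<open>a\<close>; the other
    \<open>?V\<close> and n^n come from the ball of radius n times the side around a cube, over
    which \<open>g\<close> is averaged.\<close>
  define D where "D = W * ?V * ?V * real ?n ^ ?n"
  have D: "0 \<le> D" using W by (simp add: D_def)
  show ?thesis
  proof (rule that[of "4 * D"])
    show "0 \<le> 4 * D" using D by simp
  next
    fix f :: "'a \<Rightarrow> complex" and g :: "'a \<Rightarrow> real" and B R :: real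
    assume f: "f \<in> Linf_c" and g [measurable]: "g \<in> borel_measurable lebesgue"
      and "\<forall>y. 0 \<le> g y" "\<forall>y. g y \<le> B" "\<forall>y. g y \<noteq> 0 \<longrightarrow> norm y < R"
    then have g0: "0 \<le> g y" and gB: "g y \<le> B" and gR: "g y \<noteq> 0 \<Longrightarrow> norm y < R" for y
      by blast+
    have fm [measurable]: "f \<in> borel_measurable lebesgue" using f by (simp add: Linf_c_def)
    have Tm [measurable]: "T f \<in> borel_measurable lebesgue" using f by (auto intro!: T_measurable Linf_c_subset_L2)
    define H where "H y = maximal f y * maximal (\<lambda>y. complex_of_real (g y)) y" for y
    have H [measurable]: "H \<in> borel_measurable lebesgue" unfolding H_def by measurable
    obtain M where M: "0 \<le> M" "\<And>x. norm (f x) \<le> M" using Linf_cD(2)[OF f] by auto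
    obtain R1 where R1: "0 < R1" "\<And>x. f x \<noteq> 0 \<Longrightarrow> norm x < R1" using Linf_cD(3)[OF f] by auto
    show "(\<integral>\<^sup>+y. ennreal (norm (T f y) * g y) \<partial>lebesgue) \<le> ennreal (4 * D) * (\<integral>\<^sup>+y. maximal f y * maximal (\<lambda>y. complex_of_real (g y)) y \<partial>lebesgue)"
    \<comment> \<open>\<open>oscillation_bound\<close> asks for a positive \<alpha>, and the infimum
      of \<open>maximal f\<close> over a cube is positive as soon as \<open>f\<close> does not
      vanish almost everywhere.\<close>
    proof (cases "(\<integral>\<^sup>+y. norm (f y) \<partial>lebesgue) = 0")
      case True
      then have "AE y in lebesgue. f y = 0"
        by (simp add: nn_integral_0_iff_AE)
      then have "(\<integral>\<^sup>+y. ennreal ((norm (f y))\<^sup>2) \<partial>lebesgue) = 0"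
        by (subst nn_integral_0_iff_AE) auto
      then have "(\<integral>\<^sup>+y. ennreal ((norm (T f y))\<^sup>2) \<partial>lebesgue) = 0"
        using T_bound_nn[OF Linf_c_subset_L2[OF f]] by simp
      then have "AE y in lebesgue. T f y = 0"
        by (subst (asm) nn_integral_0_iff_AE) auto
      then have "(\<integral>\<^sup>+y. ennreal (norm (T f y) * g y) \<partial>lebesgue) = 0"
        by (subst nn_integral_0_iff_AE) auto
      then show ?thesis by simp
    next
      case False
      define R0 where "R0 = max R1 R"
      have R0: "0 < R0" "\<And>x. f x \<noteq> 0 \<Longrightarrow> norm x < R0" "\<And>x. g x \<noteq> 0 \<Longrightarrow> norm x < R0"
        using R1 gR by (fastforce simp: R0_def)+
      \<comment> \<open>With this side, the base point of a top cube that meets the support of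
        \<open>g\<close> is within n s + s \<le> 2 n s of all points where \<open>f\<close> is not
        zero. The far part is then empty and \<open>c\<close> vanishes on such a cube.\<close>
      define s where "s = 2 * R0"
      have s: "0 < s" using R0 by (simp add: s_def)
      define \<mu> where "\<mu> Q = (INF y\<in>Q. maximal f y)" for Q
      define m where "m Q = enn2real (\<mu> Q)" for Q
      \<comment> \<open>The locale takes \<open>a\<close> and \<open>c\<close> as functions of a
        set, so side and base point are recovered from the set: the side as the n-th root of the
        measure, the base point by choice.\<close>
      define \<sigma> where "\<sigma> Q = root ?n (measure lebesgue Q)" for Q :: "'a set"
      define z where "z Q = (SOME z. z \<in> Q)" for Q :: "'a set"
      define c where "c Q = (LINT y|lebesgue. K (z Q) y * (f y * indicator (- ball (z Q) (2 * real ?n * \<sigma> Q)) y))" for Q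
      define a where "a Q = W * (?V * m Q)" for Q
      have z: "z (dcube s j x) \<in> dcube s j x" for j x
        unfolding z_def by (rule someI[of _ x]) simp
      have zeq: "grid_cube (s / 2 ^ j) (z (dcube s j x)) = dcube s j x" for j x
        using grid_cube_eq[OF z] .
      have \<sigma>: "\<sigma> (dcube s j x) = s / 2 ^ j" for j and x :: 'a
        using s by (simp add: \<sigma>_def measure_def emeasure_grid_cube real_root_power_cancel)
      have \<sigma>0: "0 < s / 2 ^ j" for j using s by simp
      have sub: "dcube s j x \<subseteq> ball w \<rho>" if "real ?n * (s / 2 ^ j) \<le> \<rho>" "w \<in> dcube s j x" for j and x w :: 'a and \<rho>
        using norm_diff_grid_cube[OF \<sigma>0 that(2)] that(1) by (fastforce simp: dist_norm)
      have \<mu>M: "\<mu> (dcube s j x) \<le> ennreal M" for j x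
        unfolding \<mu>_def using maximal_le[OF M(2)] by (intro INF_lower2[of x]) auto
      have \<mu>m: "\<mu> (dcube s j x) = ennreal (m (dcube s j x))" for j x
        using \<mu>M[of j x] unfolding m_def by (metis ennreal_enn2real ennreal_less_top le_less_trans)
      have m0: "0 \<le> m Q" for Q by (simp add: m_def)
      have mM: "m Q \<le> M" for Q
      proof (cases "Q = {}")
        case True
        then show ?thesis using M by (simp add: m_def \<mu>_def)
      next
        case False
        then obtain x where "x \<in> Q" by blast
        then have "\<mu> Q \<le> ennreal M"
          unfolding \<mu>_def using maximal_le[OF M(2)] by (intro INF_lower2[of x]) auto
        then show ?thesis using M(1) unfolding m_def by (simp add: enn2real_leI)
      qed
      \<comment> \<open>A single ball around the origin that contains the support of
        \<open>f\<close> and the cube gives all points of the cube the same positive lower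
        bound.\<close>
      have mpos: "0 < m (dcube s j x)" for j x
      proof -
        define \<rho> where "\<rho> = R1 + norm x + real ?n * (s / 2 ^ j)"
        have "0 \<le> real ?n * (s / 2 ^ j)" using s by simp
        then have \<rho>: "R1 \<le> \<rho>" "0 < \<rho>" using R1(1) norm_ge_zero[of x] unfolding \<rho>_def by linarith+
        obtain l where l: "0 < l" "emeasure lebesgue (ball (0::'a) \<rho>) = ennreal l"
          using emeasure_lebesgue_ball_pos[OF \<rho>(2)] by metis
        have "(\<integral>\<^sup>+y. norm (f y) \<partial>lebesgue) / ennreal l \<le> \<mu> (dcube s j x)"
          unfolding \<mu>_def
        proof (rule INF_greatest)
          fix y assume y: "y \<in> dcube s j x"
          have "norm (y - x) < real ?n * (s / 2 ^ j)"
            using norm_diff_grid_cube[OF \<sigma>0 y grid_cube_self] .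
          then have yb: "y \<in> ball 0 \<rho>"
            using norm_triangle_ineq[of "y - x" x] R1(1) by (simp add: \<rho>_def)
          have "(\<integral>\<^sup>+y. norm (f y) \<partial>lebesgue) = (\<integral>\<^sup>+y\<in>ball 0 \<rho>. norm (f y) \<partial>lebesgue)"
            using R1(2) \<rho>(1) by (intro nn_integral_cong) (fastforce simp: indicator_def)
          also have "\<dots> \<le> maximal f y * ennreal l"
            using nn_integral_ball_le_maximal[OF yb, of f] l by simp
          finally show "(\<integral>\<^sup>+y. norm (f y) \<partial>lebesgue) / ennreal l \<le> maximal f y"
            using l by (simp add: ennreal_divide_le_iff_le_mult)
        qed
        moreover have "0 < (\<integral>\<^sup>+y. norm (f y) \<partial>lebesgue) / ennreal l"
          using False l by (simp add: divide_ennreal_def ennreal_zero_less_mult_iff zero_less_iff_neq_zero)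
        ultimately have "0 < \<mu> (dcube s j x)" by (rule less_le_trans[rotated])
        then show ?thesis unfolding \<mu>m by simp
      qed
      interpret bounded_oscillation "T f" g H c a s B "W * (?V * M)" D
      proof
        show "0 < s" by (rule s)
        show "T f \<in> L2" by (intro T_L2 Linf_c_subset_L2 f)
        show "0 \<le> a Q" for Q using W m0[of Q] by (simp add: a_def)
        show "a Q \<le> W * (?V * M)" for Q
          unfolding a_def using W mM by (intro mult_left_mono) auto
        show "0 \<le> D" by (rule D)
        fix j and x :: 'a
        let ?Q = "dcube s j x"
        show "emeasure lebesgue {y \<in> ?Q. a ?Q < norm (T f y - c ?Q)} \<le> ennreal (1 / 2 ^ (?n + 2)) * emeasure lebesgue ?Q"
        proof -
          have "(\<integral>\<^sup>+y\<in>ball (z ?Q) \<rho>. norm (f y) \<partial>lebesgue) \<le> ennreal (?V * m ?Q * \<rho> ^ ?n)" if \<rho>: "real ?n * (s / 2 ^ j) \<le> \<rho>" for \<rho>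
          proof -
            have "0 < real ?n * (s / 2 ^ j)" using s by simp
            then have \<rho>0: "0 < \<rho>" using \<rho> by linarith
            obtain l where l: "0 < l" "emeasure lebesgue (ball (z ?Q) \<rho>) = ennreal l" "l = ?V * \<rho> ^ ?n"
              using emeasure_lebesgue_ball_pos[OF \<rho>0] by metis
            have "(\<integral>\<^sup>+y\<in>ball (z ?Q) \<rho>. norm (f y) \<partial>lebesgue) / ennreal l \<le> \<mu> ?Q"
              unfolding \<mu>_def
            proof (rule INF_greatest)
              fix y assume "y \<in> ?Q"
              then have "y \<in> ball (z ?Q) \<rho>" using sub[OF \<rho> z] by blast
              from nn_integral_ball_le_maximal[OF this, of f]
              show "(\<integral>\<^sup>+y\<in>ball (z ?Q) \<rho>. norm (f y) \<partial>lebesgue) / ennreal l \<le> maximal f y"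
                using l by (simp add: ennreal_divide_le_iff_le_mult)
            qed
            then have "(\<integral>\<^sup>+y\<in>ball (z ?Q) \<rho>. norm (f y) \<partial>lebesgue) \<le> ennreal (m ?Q) * ennreal l"
              using l by (simp add: ennreal_divide_le_iff_le_mult \<mu>m)
            also have "\<dots> = ennreal (?V * m ?Q * \<rho> ^ ?n)"
              using l m0[of ?Q] by (simp add: mult_ac flip: ennreal_mult)
            finally show ?thesis .
          qed
          then have "\<forall>\<rho>\<ge>real ?n * (s / 2 ^ j). (\<integral>\<^sup>+y\<in>ball (z ?Q) \<rho>. norm (f y) \<partial>lebesgue) \<le> ennreal (?V * m ?Q * \<rho> ^ ?n)"
            by blast
          from W(2)[OF f \<sigma>0 _ this] mpos[of j x]
          show ?thesis unfolding a_def c_def \<sigma> zeq by simp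
        qed
        show "ennreal (a ?Q) * (\<integral>\<^sup>+y\<in>?Q. ennreal (g y) \<partial>lebesgue) \<le> ennreal D * emeasure lebesgue ?Q * H y" if y: "y \<in> ?Q" for y
        proof -
          let ?r = "real ?n * (s / 2 ^ j)"
          have r: "0 < ?r" using s by simp
          obtain l where l: "0 < l" "emeasure lebesgue (ball (z ?Q) ?r) = ennreal l" "l = ?V * ?r ^ ?n"
            using emeasure_lebesgue_ball_pos[OF r] by metis
          have yb: "y \<in> ball (z ?Q) ?r" using sub[OF order_refl z] y by blast
          have "(\<integral>\<^sup>+y\<in>?Q. ennreal (g y) \<partial>lebesgue) \<le> (\<integral>\<^sup>+y\<in>ball (z ?Q) ?r. ennreal (g y) \<partial>lebesgue)"
            by (intro nn_integral_set_mono sub[OF order_refl z])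
          also have "\<dots> = (\<integral>\<^sup>+y\<in>ball (z ?Q) ?r. norm (complex_of_real (g y)) \<partial>lebesgue)"
            using g0 by simp
          also have "\<dots> \<le> maximal (\<lambda>y. complex_of_real (g y)) y * ennreal l"
            using nn_integral_ball_le_maximal[OF yb, of "\<lambda>y. complex_of_real (g y)"] l by simp
          finally have 1: "(\<integral>\<^sup>+y\<in>?Q. ennreal (g y) \<partial>lebesgue) \<le> maximal (\<lambda>y. complex_of_real (g y)) y * ennreal l" .
          have "ennreal (m ?Q) \<le> maximal f y"
            unfolding \<mu>m[symmetric] \<mu>_def by (intro INF_lower y)
          then have "ennreal (W * ?V) * ennreal (m ?Q) \<le> ennreal (W * ?V) * maximal f y"
            by (intro mult_left_mono) auto
          moreover have "ennreal (a ?Q) = ennreal (W * ?V) * ennreal (m ?Q)"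
            using W m0[of ?Q] by (simp add: a_def mult.assoc flip: ennreal_mult)
          ultimately have 2: "ennreal (a ?Q) \<le> ennreal (W * ?V) * maximal f y" by simp
          have "ennreal (a ?Q) * (\<integral>\<^sup>+y\<in>?Q. ennreal (g y) \<partial>lebesgue)
            \<le> (ennreal (W * ?V) * maximal f y) * (maximal (\<lambda>y. complex_of_real (g y)) y * ennreal l)"
            by (intro mult_mono 1 2) auto
          also have "\<dots> = ennreal (W * ?V) * ennreal l * H y"
            by (simp add: H_def mult_ac)
          also have "ennreal (W * ?V) * ennreal l = ennreal D * emeasure lebesgue ?Q"
          proof -
            have "?r ^ ?n = real ?n ^ ?n * (s / 2 ^ j) ^ ?n" by (rule power_mult_distrib)
            then have eq: "W * ?V * l = D * (s / 2 ^ j) ^ ?n" unfolding l(3) D_def by (simp only: mult_ac)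
            have "ennreal (W * ?V) * ennreal l = ennreal (W * ?V * l)"
              using W(1) l(1) by (intro ennreal_mult[symmetric]) auto
            also have "\<dots> = ennreal D * emeasure lebesgue ?Q"
              unfolding eq using D s by (simp add: emeasure_grid_cube ennreal_mult)
            finally show ?thesis .
          qed
          finally show ?thesis .
        qed
      qed (use g g0 gB H in auto)
      have top: "(\<integral>\<^sup>+y\<in>dcube s 0 x. ennreal (norm (T f y) * g y) \<partial>lebesgue) \<le> ennreal (4 * D) * (\<integral>\<^sup>+y\<in>dcube s 0 x. H y \<partial>lebesgue)" for x
      proof (cases "\<exists>y\<in>dcube s 0 x. g y \<noteq> 0")
        case True
        then obtain w where w: "w \<in> dcube s 0 x" "norm w < R0" using R0(3) by blast
        have "f y * indicator (- ball (z (dcube s 0 x)) (2 * real ?n * \<sigma> (dcube s 0 x))) y = 0" for y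
        proof (cases "f y = 0")
          case False
          then have y: "norm y < R0" by (rule R0(2))
          have "norm (z (dcube s 0 x) - w) < real ?n * s"
            using norm_diff_grid_cube[OF \<sigma>0 z w(1)] by simp
          then have "norm (z (dcube s 0 x) - y) < real ?n * s + s"
            using norm_triangle_ineq[of "z (dcube s 0 x) - w" "w - y"] norm_triangle_ineq4[of w y] w(2) y by (simp add: s_def)
          also have "s \<le> real ?n * s" using s DIM_positive[where 'a = 'a] by (simp add: Suc_leI)
          then have "real ?n * s + s \<le> 2 * real ?n * s" by (simp add: mult.commute)
          finally have "y \<in> ball (z (dcube s 0 x)) (2 * real ?n * \<sigma> (dcube s 0 x))"
            by (simp add: \<sigma>[of 0, simplified] dist_norm)
          then show ?thesis by simp
        qed simp
        then have c0: "c (dcube s 0 x) = 0" unfolding c_def by (simp only: mult_zero_right Bochner_Integration.integral_zero)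
        have "(\<integral>\<^sup>+y\<in>dcube s 0 x. ennreal (norm (T f y) * g y) \<partial>lebesgue) \<le> \<Phi> (dcube s 0 x)"
          unfolding \<Phi>_def c0 using g0 a(1)[of "dcube s 0 x"]
          by (intro nn_integral_mono mult_right_mono ennreal_leI) auto
        also have "\<dots> \<le> ennreal (4 * D) * (\<integral>\<^sup>+y\<in>dcube s 0 x. H y \<partial>lebesgue)" by (rule \<Phi>_le)
        finally show ?thesis .
      next
        case False
        then have "(\<integral>\<^sup>+y\<in>dcube s 0 x. ennreal (norm (T f y) * g y) \<partial>lebesgue) = (\<integral>\<^sup>+y. 0 \<partial>(lebesgue :: 'a measure))"
          by (intro nn_integral_cong) (auto simp: indicator_def)
        then show ?thesis by simp
      qed
      \<comment> \<open>The top cubes partition the whole space, and the constant 4 D is the same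
        for each, so summation yields the global estimate.\<close>
      obtain F :: "'a set set" where F: "countable F" "disjoint F" "\<Union>F = UNIV" "\<And>Q. Q \<in> F \<Longrightarrow> \<exists>x. Q = dcube s 0 x"
      proof (rule that[of "range (dcube s 0)"])
        show "countable (range (dcube s 0 :: 'a \<Rightarrow> _))" using s by (intro countable_grid_cubes) auto
        show "disjoint (range (dcube s 0 :: 'a \<Rightarrow> _))"
          unfolding disjoint_def using grid_cube_eq by blast
      qed auto
      have Fm: "Q \<in> sets lebesgue" if "Q \<in> F" for Q using F(4)[OF that] by auto
      have sum: "(\<integral>\<^sup>+y. u y \<partial>lebesgue) = (\<integral>\<^sup>+Q. (\<integral>\<^sup>+y\<in>Q. u y \<partial>lebesgue) \<partial>count_space F)" if "u \<in> borel_measurable lebesgue" for u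
        using nn_integral_UN_disjoint_sets[OF F(1,2) Fm that] F(3) by simp
      have "(\<integral>\<^sup>+y. ennreal (norm (T f y) * g y) \<partial>lebesgue) = (\<integral>\<^sup>+Q. (\<integral>\<^sup>+y\<in>Q. ennreal (norm (T f y) * g y) \<partial>lebesgue) \<partial>count_space F)"
        by (intro sum) measurable
      also have "\<dots> \<le> (\<integral>\<^sup>+Q. ennreal (4 * D) * (\<integral>\<^sup>+y\<in>Q. H y \<partial>lebesgue) \<partial>count_space F)"
        using top F(4) by (intro nn_integral_mono) fastforce
      also have "\<dots> = ennreal (4 * D) * (\<integral>\<^sup>+y. H y \<partial>lebesgue)"
        by (simp add: nn_integral_cmult sum[OF H])
      finally show ?thesis by (simp add: H_def)
    qed
  qed
qed

end

section \<open>The exponent is bounded away from one\<close>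

text \<open>The 1/8 is 1/2 for the density of \<open>E\<close> in the innermost cube times 1/4 for
  the part of a cube that \<open>E\<close> occupies in its ring; the rest is the volume of a ball
  around a unit cube.\<close>

definition chain_const :: "nat \<Rightarrow> real" where
  "chain_const n = 1 / (8 * unit_ball_vol (real n) * real n ^ n)"

lemma chain_const_pos: "0 < n \<Longrightarrow> 0 < chain_const n"
  by (simp add: chain_const_def)

text \<open>The logarithmic failure of the maximal operator on L^1. Along nested cubes D 0, ..., D N
  the maximal function is at least of order |D N| / |D i| on the ring between D i and D (i+1), and
  \<open>E\<close> occupies there a fixed fraction of |D i|. So each of the \<open>N\<close> rings
  contributes the same multiple of |D N|.\<close>

lemma maximal_indicator_chain:
  fixes x :: "'a::euclidean_space"
  assumes s: "0 < s" and E [measurable]: "E \<in> sets lebesgue" and F [measurable]: "F \<in> sets lebesgue"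
    and dense: "emeasure lebesgue (dcube s j x - E) \<le> ennreal (1 / (4 * 2 ^ (DIM('a) * N))) * emeasure lebesgue (dcube s j x)"
    and sub: "dcube s (j + N) x \<inter> E \<subseteq> F"
  shows "ennreal (1 / 2) * emeasure lebesgue (dcube s (j + N) x) \<le> emeasure lebesgue (dcube s (j + N) x \<inter> E)" (is ?half)
    and "ennreal (real N * chain_const DIM('a)) * emeasure lebesgue (dcube s (j + N) x)
      \<le> (\<integral>\<^sup>+y\<in>dcube s j x \<inter> E. maximal (indicator F) y \<partial>lebesgue)" (is ?chain)
proof -
  let ?n = "DIM('a)" and ?V = "unit_ball_vol (real DIM('a))"
  define D where "D i = dcube s (j + i) x" for i
  define d where "d i = (s / 2 ^ (j + i)) ^ ?n" for i
  have Dm [measurable]: "D i \<in> sets lebesgue" for i by (simp add: D_def)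
  have d: "emeasure lebesgue (D i) = ennreal (d i)" "0 < d i" for i
    using s by (auto simp: D_def d_def emeasure_grid_cube)
  have dSuc: "d (Suc i) \<le> d i / 2" for i
  proof -
    have "d i = 2 ^ ?n * d (Suc i)" by (simp add: d_def power_divide power_mult_distrib)
    moreover have "(2::real) ^ 1 \<le> 2 ^ ?n" using DIM_positive[where 'a = 'a] by (intro power_increasing) (auto simp: Suc_leI)
    ultimately show ?thesis using d(2)[of "Suc i"] mult_right_mono[of 2 "2 ^ ?n" "d (Suc i)"] by simp
  qed
  have anti: "d N \<le> d i" if "i \<le> N" for i
    using that
  proof (induction rule: dec_induct)
    case (step m)
    then show ?case using dSuc[of m] d(2)[of m] by linarith
  qed simp
  have Dsub: "D k \<subseteq> D i" if "i \<le> k" for i k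
    unfolding D_def using that by (intro dcube_mono) auto
  have D0: "D 0 = dcube s j x" by (simp add: D_def)
  have d0N: "d 0 = 2 ^ (?n * N) * d N"
    by (simp add: d_def power_add power_divide power_mult_distrib power_mult[symmetric] mult.commute)
  \<comment> \<open>Density is measured against the smallest cube: what \<open>E\<close> misses is
    at most a quarter of D N, hence of every D i with i \<le> N.\<close>
  have "emeasure lebesgue (D 0 - E) \<le> ennreal (1 / (4 * 2 ^ (?n * N))) * ennreal (d 0)"
    using dense d(1)[of 0] by (simp add: D0)
  also have "\<dots> = ennreal (1 / (4 * 2 ^ (?n * N)) * d 0)"
    using d(2)[of 0] by (intro ennreal_mult[symmetric]) auto
  also have "1 / (4 * 2 ^ (?n * N)) * d 0 = d N / 4"
    unfolding d0N by simp
  finally have small: "emeasure lebesgue (D 0 - E) \<le> ennreal (d N / 4)" .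
  have half: "ennreal (d N / 2) \<le> emeasure lebesgue (D N \<inter> E)"
  proof -
    have "ennreal (d N / 2) \<le> ennreal (d N - d N / 4)"
      using d(2)[of N] by (intro ennreal_leI) auto
    also have "\<dots> \<le> emeasure lebesgue (D N - (D 0 - E))"
      using d[of N] small by (intro emeasure_Diff_ge_real) auto
    also have "D N - (D 0 - E) = D N \<inter> E" using Dsub[of 0 N] by auto
    finally show ?thesis .
  qed
  have "ennreal (1 / 2) * ennreal (d N) = ennreal (1 / 2 * d N)"
    using d(2)[of N] by (intro ennreal_mult[symmetric]) auto
  then have "ennreal (1 / 2) * emeasure lebesgue (D N) = ennreal (d N / 2)"
    unfolding d(1) by simp
  then show ?half using half by (simp add: D_def)
  define \<beta> where "\<beta> = chain_const ?n * d N"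
  have \<beta>: "0 \<le> \<beta>" using chain_const_pos[of ?n] d(2)[of N] by (simp add: \<beta>_def)
  have Vn: "0 < ?V * real ?n ^ ?n" by simp
  have ring: "ennreal \<beta> \<le> (\<integral>\<^sup>+y\<in>(D i - D (Suc i)) \<inter> E. maximal (indicator F) y \<partial>lebesgue)" if i: "i < N" for i
  proof -
    define X where "X = ennreal (d N / (2 * (?V * real ?n ^ ?n * d i)))"
    have max: "X \<le> maximal (indicator F) y" if y: "y \<in> D i" for y
    proof -
      let ?r = "real ?n * (s / 2 ^ (j + i))"
      have r: "0 < ?r" using s by simp
      obtain l where l: "0 < l" "emeasure lebesgue (ball x ?r) = ennreal l" "l = ?V * ?r ^ ?n"
        using emeasure_lebesgue_ball_pos[OF r] by metis
      have leq: "l = ?V * real ?n ^ ?n * d i" unfolding l(3) d_def power_mult_distrib by simp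
      have sb: "D i \<subseteq> ball x ?r"
        using norm_diff_grid_cube[of "s / 2 ^ (j + i)", OF _ grid_cube_self] s by (auto simp: D_def dist_norm)
      have "ennreal (d N / 2) \<le> emeasure lebesgue (F \<inter> ball x ?r)"
        using half Dsub[of i N] i sub sb
        by (intro order_trans[OF half] emeasure_mono) (auto simp: D_def)
      also have "\<dots> = (\<integral>\<^sup>+y. indicator (F \<inter> ball x ?r) y \<partial>lebesgue)" by simp
      also have "\<dots> = (\<integral>\<^sup>+y\<in>ball x ?r. norm (indicator F y :: complex) \<partial>lebesgue)"
        by (intro nn_integral_cong) (auto simp: indicator_def)
      also have "\<dots> \<le> maximal (indicator F) y * ennreal l"
        using nn_integral_ball_le_maximal[of y x ?r "indicator F"] sb y l by auto
      finally have "ennreal (d N / 2) / ennreal l \<le> maximal (indicator F) y"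
        using l by (simp add: ennreal_divide_le_iff_le_mult)
      moreover have "ennreal (d N / 2) / ennreal l = ennreal (d N / 2 / l)"
        using l(1) d(2)[of N] by (intro divide_ennreal) auto
      ultimately show ?thesis by (simp add: X_def leq)
    qed
    have "ennreal (d i / 4) \<le> emeasure lebesgue (D i - (D (Suc i) \<union> (D 0 - E)))"
    proof -
      have "emeasure lebesgue (D (Suc i) \<union> (D 0 - E)) \<le> emeasure lebesgue (D (Suc i)) + emeasure lebesgue (D 0 - E)"
        by (intro emeasure_subadditive) auto
      also have "\<dots> \<le> ennreal (d i / 2) + ennreal (d i / 4)"
      proof (rule add_mono)
        show "emeasure lebesgue (D (Suc i)) \<le> ennreal (d i / 2)"
          unfolding d(1) by (intro ennreal_leI dSuc)
        show "emeasure lebesgue (D 0 - E) \<le> ennreal (d i / 4)"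
          using anti[of i] i by (intro order_trans[OF small] ennreal_leI) auto
      qed
      also have "\<dots> = ennreal (d i / 2 + d i / 4)"
        using d(2)[of i] by (intro ennreal_plus[symmetric]) auto
      finally have "ennreal (d i - (d i / 2 + d i / 4)) \<le> emeasure lebesgue (D i - (D (Suc i) \<union> (D 0 - E)))"
        using d[of i] by (intro emeasure_Diff_ge_real) auto
      then show ?thesis by simp
    qed
    also have "D i - (D (Suc i) \<union> (D 0 - E)) = (D i - D (Suc i)) \<inter> E" using Dsub[of 0 i] by auto
    finally have "X * ennreal (d i / 4) \<le> X * emeasure lebesgue ((D i - D (Suc i)) \<inter> E)"
      by (intro mult_left_mono) auto
    also have "\<dots> = (\<integral>\<^sup>+y\<in>(D i - D (Suc i)) \<inter> E. X \<partial>lebesgue)"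
      by (simp add: nn_integral_cmult_indicator)
    also have "\<dots> \<le> (\<integral>\<^sup>+y\<in>(D i - D (Suc i)) \<inter> E. maximal (indicator F) y \<partial>lebesgue)"
      using max by (intro nn_integral_mono) (auto simp: indicator_def)
    also have "X * ennreal (d i / 4) = ennreal \<beta>"
    proof -
      have "d N / (2 * (?V * real ?n ^ ?n * d i)) * (d i / 4) = \<beta>"
        using d(2)[of i] Vn by (simp add: \<beta>_def chain_const_def)
      moreover have "X * ennreal (d i / 4) = ennreal (d N / (2 * (?V * real ?n ^ ?n * d i)) * (d i / 4))"
        unfolding X_def using d(2) Vn by (intro ennreal_mult[symmetric]) (auto simp: less_imp_le)
      ultimately show ?thesis by simp
    qed
    finally show ?thesis .
  qed
  have "ennreal (real k * \<beta>) \<le> (\<integral>\<^sup>+y\<in>(D 0 - D k) \<inter> E. maximal (indicator F) y \<partial>lebesgue)" if "k \<le> N" for k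
    using that
  proof (induction k)
    case (Suc k)
    have "ennreal (real (Suc k) * \<beta>) = ennreal (real k * \<beta>) + ennreal \<beta>"
      using \<beta> by (simp add: distrib_right flip: ennreal_plus)
    also have "\<dots> \<le> (\<integral>\<^sup>+y\<in>(D 0 - D k) \<inter> E. maximal (indicator F) y \<partial>lebesgue) + (\<integral>\<^sup>+y\<in>(D k - D (Suc k)) \<inter> E. maximal (indicator F) y \<partial>lebesgue)"
      using Suc by (intro add_mono ring) auto
    also have "\<dots> = (\<integral>\<^sup>+y\<in>((D 0 - D k) \<inter> E) \<union> ((D k - D (Suc k)) \<inter> E). maximal (indicator F) y \<partial>lebesgue)"
      by (intro nn_integral_disjoint_union[symmetric]) auto
    also have "((D 0 - D k) \<inter> E) \<union> ((D k - D (Suc k)) \<inter> E) = (D 0 - D (Suc k)) \<inter> E"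
      using Dsub[of k "Suc k"] Dsub[of 0 k] by auto
    finally show ?case .
  qed simp
  from this[of N] have "ennreal (real N * \<beta>) \<le> (\<integral>\<^sup>+y\<in>D 0 \<inter> E. maximal (indicator F) y \<partial>lebesgue)"
    by (rule order_trans) (auto intro!: nn_integral_set_mono)
  moreover have "ennreal (real N * chain_const ?n) * emeasure lebesgue (D N) = ennreal (real N * \<beta>)"
  proof -
    have "ennreal (real N * chain_const ?n) * ennreal (d N) = ennreal (real N * chain_const ?n * d N)"
      using chain_const_pos[of ?n] d(2)[of N] by (intro ennreal_mult[symmetric]) auto
    then show ?thesis by (simp add: d(1) \<beta>_def mult.assoc)
  qed
  ultimately show ?chain by (simp add: D_def)
qed

text \<open>The chain estimate is run simultaneously in disjoint cubes that \<open>E\<close> nearly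
  fills, and \<open>F\<close> collects the parts of \<open>E\<close> in the innermost cubes. The
  lower bound for the fraction of \<open>E\<close> occupied by \<open>F\<close> depends only on
  \<open>N\<close> and the dimension, so the exponent gap can be fixed before the set is
  known.\<close>

lemma maximal_indicator_large:
  fixes E :: "'a::euclidean_space set"
  assumes E [measurable]: "E \<in> sets lebesgue" and e: "emeasure lebesgue E = ennreal e" "0 < e"
  obtains F where "F \<in> sets lebesgue" "F \<subseteq> E" "ennreal (e / (4 * 2 ^ (DIM('a) * N))) \<le> emeasure lebesgue F"
    "ennreal (real N * chain_const DIM('a)) * emeasure lebesgue F \<le> (\<integral>\<^sup>+y\<in>E. maximal (indicator F) y \<partial>lebesgue)"
proof -
  let ?n = "DIM('a)"
  define \<theta> :: real where "\<theta> = 1 / 2 ^ (?n * N)"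
  have \<theta>: "0 < \<theta>" by (simp add: \<theta>_def)
  define \<kappa> where "\<kappa> = \<theta> / 4"
  have \<kappa>: "0 < \<kappa>" "\<kappa> = 1 / (4 * 2 ^ (?n * N))" using \<theta> by (auto simp: \<kappa>_def \<theta>_def)
  have "0 < \<kappa> * e / 2" using \<kappa> e by simp
  from sets_lebesgue_outer_open[OF E this] obtain U where
    U: "open U" "E \<subseteq> U" "emeasure lebesgue (U - E) < ennreal (\<kappa> * e / 2)" by metis
  have Um [measurable]: "U \<in> sets lebesgue" using U(1) by (metis borel_open sets_completionI_sets sets_lborel)
  obtain P where P: "countable P" "disjoint P" "\<Union>P = U" "\<And>Q. Q \<in> P \<Longrightarrow> \<exists>j x. Q = dcube 1 j x"
    by (rule open_eq_Union_dcubes[OF zero_less_one U(1)]) (rule that)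
  have Pm [measurable]: "Q \<in> sets lebesgue" if "Q \<in> P" for Q using P(4)[OF that] by auto
  \<comment> \<open>In each cube left out, \<open>E\<close> misses more than the fraction \<kappa>.
    The total measure of these cubes times \<kappa> is at most |U - E| \<le> \<kappa> e / 2, so they
    carry at most half of \<open>E\<close>.\<close>
  define G where "G = {Q \<in> P. emeasure lebesgue (Q - E) \<le> ennreal \<kappa> * emeasure lebesgue Q}"
  have GP: "G \<subseteq> P" by (auto simp: G_def)
  have Gc: "countable G" "disjoint G" "\<And>Q. Q \<in> G \<Longrightarrow> Q \<in> sets lebesgue"
    and Bc: "countable (P - G)" "disjoint (P - G)" "\<And>Q. Q \<in> P - G \<Longrightarrow> Q \<in> sets lebesgue"
    using P(1,2) Pm GP by (auto simp: disjoint_def intro: countable_subset)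
  have UG [measurable]: "\<Union>G \<in> sets lebesgue" and UB [measurable]: "\<Union>(P - G) \<in> sets lebesgue"
    using Gc Bc by (auto intro!: sets.countable_Union)
  have bad: "emeasure lebesgue (\<Union>(P - G)) \<le> ennreal (e / 2)"
  proof -
    have "ennreal \<kappa> * emeasure lebesgue (\<Union>(P - G)) = (\<integral>\<^sup>+Q. ennreal \<kappa> * emeasure lebesgue Q \<partial>count_space (P - G))"
      using emeasure_Union_disjoint_sets[OF Bc] by (simp add: nn_integral_cmult)
    also have "\<dots> \<le> (\<integral>\<^sup>+Q. emeasure lebesgue (Q - E) \<partial>count_space (P - G))"
      by (intro nn_integral_mono) (auto simp: G_def)
    also have "\<dots> = emeasure lebesgue (\<Union>Q\<in>P - G. Q - E)"
      using Bc by (intro emeasure_UN_countable[symmetric]) (auto simp: disjoint_family_on_def disjoint_def)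
    also have "\<dots> \<le> emeasure lebesgue (U - E)"
      using P(3) by (intro emeasure_mono) auto
    also have "\<dots> \<le> ennreal (\<kappa> * e / 2)" using U(3) by simp
    finally have "ennreal (1 / \<kappa>) * (ennreal \<kappa> * emeasure lebesgue (\<Union>(P - G))) \<le> ennreal (1 / \<kappa>) * ennreal (\<kappa> * e / 2)"
      by (intro mult_left_mono) auto
    also have "ennreal (1 / \<kappa>) * ennreal (\<kappa> * e / 2) = ennreal (1 / \<kappa> * (\<kappa> * e / 2))"
      using \<kappa> e by (intro ennreal_mult[symmetric]) auto
    also have "ennreal (1 / \<kappa>) * (ennreal \<kappa> * emeasure lebesgue (\<Union>(P - G))) = ennreal (1 / \<kappa> * \<kappa>) * emeasure lebesgue (\<Union>(P - G))"
      using \<kappa> by (intro ennreal_mult_mult) auto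
    finally show ?thesis using \<kappa> by simp
  qed
  have good: "ennreal (e / 2) \<le> emeasure lebesgue (\<Union>G)"
  proof -
    have "ennreal (e - e / 2) \<le> emeasure lebesgue (E - \<Union>(P - G))"
      using e bad by (intro emeasure_Diff_ge_real) auto
    also have "\<dots> \<le> emeasure lebesgue (\<Union>G)"
      using U(2) P(3) by (intro emeasure_mono) auto
    finally show ?thesis by simp
  qed
  \<comment> \<open>The chain bound is kept for every measurable \<open>F\<close> that contains
    \<open>Q' \<inter> E\<close>, since the final \<open>F\<close> depends on the choices in all
    cubes together.\<close>
  have "\<forall>Q\<in>G. \<exists>Q'. Q' \<in> sets lebesgue \<and> Q' \<subseteq> Q \<and> emeasure lebesgue Q' = ennreal \<theta> * emeasure lebesgue Q \<and>
    ennreal (1 / 2) * emeasure lebesgue Q' \<le> emeasure lebesgue (Q' \<inter> E) \<and>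
    (\<forall>F. F \<in> sets lebesgue \<longrightarrow> Q' \<inter> E \<subseteq> F \<longrightarrow>
      ennreal (real N * chain_const ?n) * emeasure lebesgue Q' \<le> (\<integral>\<^sup>+y\<in>Q \<inter> E. maximal (indicator F) y \<partial>lebesgue))"
  proof
    fix Q assume Q: "Q \<in> G"
    then obtain j x where Qj: "Q = dcube 1 j x" using P(4) GP by blast
    have dense: "emeasure lebesgue (dcube 1 j x - E) \<le> ennreal (1 / (4 * 2 ^ (?n * N))) * emeasure lebesgue (dcube 1 j x)"
      using Q unfolding G_def \<kappa>(2) Qj by auto
    have "dcube 1 (j + N) x \<inter> E \<in> sets lebesgue" by measurable
    note chain = maximal_indicator_chain[OF zero_less_one E _ dense]
    have "emeasure lebesgue (dcube 1 (j + N) x) = ennreal \<theta> * emeasure lebesgue (dcube 1 j x)"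
      using \<theta> by (simp add: emeasure_grid_cube \<theta>_def power_add power_divide power_mult_distrib power_mult[symmetric] mult.commute flip: ennreal_mult)
    moreover have "ennreal (1 / 2) * emeasure lebesgue (dcube 1 (j + N) x) \<le> emeasure lebesgue (dcube 1 (j + N) x \<inter> E)"
      by (rule chain(1)) (auto simp: \<open>dcube 1 (j + N) x \<inter> E \<in> sets lebesgue\<close>)
    ultimately show "\<exists>Q'. Q' \<in> sets lebesgue \<and> Q' \<subseteq> Q \<and> emeasure lebesgue Q' = ennreal \<theta> * emeasure lebesgue Q \<and>
      ennreal (1 / 2) * emeasure lebesgue Q' \<le> emeasure lebesgue (Q' \<inter> E) \<and>
      (\<forall>F. F \<in> sets lebesgue \<longrightarrow> Q' \<inter> E \<subseteq> F \<longrightarrow>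
        ennreal (real N * chain_const ?n) * emeasure lebesgue Q' \<le> (\<integral>\<^sup>+y\<in>Q \<inter> E. maximal (indicator F) y \<partial>lebesgue))"
      unfolding Qj
    proof (intro exI[of _ "dcube 1 (j + N) x"] conjI allI impI)
      show "dcube 1 (j + N) x \<subseteq> dcube 1 j x" by (intro dcube_mono) simp
    qed (assumption | rule sets_grid_cube chain(2))+
  qed
  from bchoice[OF this] obtain S where S0: "\<forall>Q\<in>G. S Q \<in> sets lebesgue \<and> S Q \<subseteq> Q \<and>
    emeasure lebesgue (S Q) = ennreal \<theta> * emeasure lebesgue Q \<and>
    ennreal (1 / 2) * emeasure lebesgue (S Q) \<le> emeasure lebesgue (S Q \<inter> E) \<and>
    (\<forall>F. F \<in> sets lebesgue \<longrightarrow> S Q \<inter> E \<subseteq> F \<longrightarrow>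
      ennreal (real N * chain_const ?n) * emeasure lebesgue (S Q) \<le> (\<integral>\<^sup>+y\<in>Q \<inter> E. maximal (indicator F) y \<partial>lebesgue))"
    by (rule exE)
  note S = bspec[OF S0, THEN conjunct1] bspec[OF S0, THEN conjunct2, THEN conjunct1]
    bspec[OF S0, THEN conjunct2, THEN conjunct2, THEN conjunct1]
    bspec[OF S0, THEN conjunct2, THEN conjunct2, THEN conjunct2, THEN conjunct1]
    bspec[OF S0, THEN conjunct2, THEN conjunct2, THEN conjunct2, THEN conjunct2, rule_format]
  define F where "F = (\<Union>Q\<in>G. S Q \<inter> E)"
  have F [measurable]: "F \<in> sets lebesgue"
    unfolding F_def using Gc(1) S(1) by (intro sets.countable_UN') auto
  have disj0: "Q \<inter> Q' = {}" if "Q \<in> G" "Q' \<in> G" "Q \<noteq> Q'" for Q Q'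
    using Gc(2) that by (auto simp: disjoint_def)
  have "(S Q \<inter> E) \<inter> (S Q' \<inter> E) = {}" if QQ': "Q \<in> G" "Q' \<in> G" "Q \<noteq> Q'" for Q Q'
    using disj0[OF QQ'] S(2)[OF QQ'(1)] S(2)[OF QQ'(2)] by blast
  then have disj: "disjoint_family_on (\<lambda>Q. S Q \<inter> E) G" by (simp add: disjoint_family_on_def)
  have disj2: "disjoint_family_on (\<lambda>Q. Q \<inter> E) G"
    using disj0 by (auto simp: disjoint_family_on_def)
  have Fsum: "emeasure lebesgue F = (\<integral>\<^sup>+Q. emeasure lebesgue (S Q \<inter> E) \<partial>count_space G)"
    unfolding F_def using Gc(1) S(1) disj by (intro emeasure_UN_countable) auto
  show ?thesis
  proof (rule that[OF F])
    show "F \<subseteq> E" by (auto simp: F_def)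
    have "ennreal (1 / 2 * \<theta>) * emeasure lebesgue (\<Union>G) = (\<integral>\<^sup>+Q. ennreal (1 / 2 * \<theta>) * emeasure lebesgue Q \<partial>count_space G)"
      using emeasure_Union_disjoint_sets[OF Gc] by (simp add: nn_integral_cmult)
    also have "\<dots> \<le> (\<integral>\<^sup>+Q. emeasure lebesgue (S Q \<inter> E) \<partial>count_space G)"
    proof (intro nn_integral_mono)
      fix Q assume "Q \<in> space (count_space G)"
      then have Q: "Q \<in> G" by simp
      have "ennreal (1 / 2) * (ennreal \<theta> * emeasure lebesgue Q) = ennreal (1 / 2 * \<theta>) * emeasure lebesgue Q"
        using \<theta> by (intro ennreal_mult_mult) auto
      then show "ennreal (1 / 2 * \<theta>) * emeasure lebesgue Q \<le> emeasure lebesgue (S Q \<inter> E)"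
        using S(4)[OF Q] unfolding S(3)[OF Q] by (simp only:)
    qed
    finally have "ennreal (1 / 2 * \<theta>) * ennreal (e / 2) \<le> emeasure lebesgue F"
      unfolding Fsum using good by (meson mult_left_mono order_trans zero_le)
    moreover have "ennreal (1 / 2 * \<theta>) * ennreal (e / 2) = ennreal (1 / 2 * \<theta> * (e / 2))"
      using \<theta> e by (intro ennreal_mult[symmetric]) auto
    moreover have "1 / 2 * \<theta> * (e / 2) = e / (4 * 2 ^ (?n * N))" by (simp add: \<theta>_def)
    ultimately show "ennreal (e / (4 * 2 ^ (?n * N))) \<le> emeasure lebesgue F" by (simp only:)
    have "ennreal (real N * chain_const ?n) * emeasure lebesgue F = (\<integral>\<^sup>+Q. ennreal (real N * chain_const ?n) * emeasure lebesgue (S Q \<inter> E) \<partial>count_space G)"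
      unfolding Fsum by (simp add: nn_integral_cmult)
    also have "\<dots> \<le> (\<integral>\<^sup>+Q. (\<integral>\<^sup>+y\<in>Q \<inter> E. maximal (indicator F) y \<partial>lebesgue) \<partial>count_space G)"
    proof (intro nn_integral_mono)
      fix Q assume "Q \<in> space (count_space G)"
      then have Q: "Q \<in> G" by simp
      have "ennreal (real N * chain_const ?n) * emeasure lebesgue (S Q \<inter> E) \<le> ennreal (real N * chain_const ?n) * emeasure lebesgue (S Q)"
        using S(1)[OF Q] by (intro mult_left_mono emeasure_mono) auto
      also have "\<dots> \<le> (\<integral>\<^sup>+y\<in>Q \<inter> E. maximal (indicator F) y \<partial>lebesgue)"
        using Q by (intro S(5) F) (auto simp: F_def)
      finally show "ennreal (real N * chain_const ?n) * emeasure lebesgue (S Q \<inter> E) \<le> (\<integral>\<^sup>+y\<in>Q \<inter> E. maximal (indicator F) y \<partial>lebesgue)" .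
    qed
    also have "\<dots> = (\<integral>\<^sup>+y\<in>(\<Union>Q\<in>G. Q \<inter> E). maximal (indicator F) y \<partial>lebesgue)"
      using Gc disj2 by (intro nn_integral_UN_disjoint_family[symmetric]) auto
    also have "\<dots> \<le> (\<integral>\<^sup>+y\<in>E. maximal (indicator F) y \<partial>lebesgue)"
      by (intro nn_integral_set_mono) auto
    finally show "ennreal (real N * chain_const ?n) * emeasure lebesgue F \<le> (\<integral>\<^sup>+y\<in>E. maximal (indicator F) y \<partial>lebesgue)" .
  qed
qed

section \<open>From norms to integrals of powers and back\<close>

lemma epowr_ennreal: "0 \<le> t \<Longrightarrow> epowr (ennreal t) r = ennreal (t powr r)"
  by (simp add: epowr_def)

lemma epowr_mono:
  assumes "a \<le> b" "0 \<le> r"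
  shows "epowr a r \<le> epowr b r"
proof (cases "b = \<infinity>")
  case False
  then have "a \<noteq> \<infinity>" "enn2real a \<le> enn2real b"
    using assms by (auto simp: top_unique intro: enn2real_mono simp flip: less_top)
  then show ?thesis
    using False assms by (auto simp: epowr_def intro!: ennreal_leI powr_mono2)
qed (simp add: epowr_def)

lemma epowr_measurable [measurable]:
  assumes [measurable]: "F \<in> borel_measurable M" "r \<in> borel_measurable M"
  shows "(\<lambda>x. epowr (F x) (r x)) \<in> borel_measurable M"
  unfolding epowr_def by measurable

lemma var_norm_leI:
  assumes "0 < l" "(\<integral>\<^sup>+x\<in>{x. p x \<noteq> \<infinity>}. epowr (F x / ennreal l) (enn2real (p x)) \<partial>lebesgue)
       + inverse (ennreal l) * esssup (restrict_space lebesgue {x. p x = \<infinity>}) F \<le> 1"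
  shows "var_norm p F \<le> ennreal l"
  unfolding var_norm_def using assms by (intro Inf_lower) auto

text \<open>Some admissible l lies below \<open>L\<close>, and the integral decreases as the scale
  grows. The strict inequality avoids the question whether the infimum is attained.\<close>

lemma var_norm_lessD:
  assumes "var_norm p F < ennreal L"
  shows "(\<integral>\<^sup>+x\<in>{x. p x \<noteq> \<infinity>}. epowr (F x / ennreal L) (enn2real (p x)) \<partial>lebesgue) \<le> 1"
proof -
  obtain l where l: "0 < l" "ennreal l < ennreal L" "(\<integral>\<^sup>+x\<in>{x. p x \<noteq> \<infinity>}. epowr (F x / ennreal l) (enn2real (p x)) \<partial>lebesgue)
       + inverse (ennreal l) * esssup (restrict_space lebesgue {x. p x = \<infinity>}) F \<le> 1"
    using assms unfolding var_norm_def Inf_less_iff by auto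
  have "(\<integral>\<^sup>+x\<in>{x. p x \<noteq> \<infinity>}. epowr (F x / ennreal L) (enn2real (p x)) \<partial>lebesgue)
    \<le> (\<integral>\<^sup>+x\<in>{x. p x \<noteq> \<infinity>}. epowr (F x / ennreal l) (enn2real (p x)) \<partial>lebesgue)"
  proof (intro nn_integral_mono mult_right_mono epowr_mono)
    fix x
    have "l < L" using l(1,2) by (auto simp: ennreal_less_iff)
    then have "inverse (ennreal L) \<le> inverse (ennreal l)"
      using l(1) by (simp add: inverse_ennreal ennreal_leI le_imp_inverse_le)
    then show "F x / ennreal L \<le> F x / ennreal l"
      by (simp add: divide_ennreal_def mult_left_mono)
  qed auto
  also have "\<dots> \<le> (\<integral>\<^sup>+x\<in>{x. p x \<noteq> \<infinity>}. epowr (F x / ennreal l) (enn2real (p x)) \<partial>lebesgue)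
       + inverse (ennreal l) * esssup (restrict_space lebesgue {x. p x = \<infinity>}) F"
    by (rule add_increasing2) auto
  also note l(3)
  finally show ?thesis .
qed

text \<open>Bisection: of the two halves of the exponent range, one keeps at least half of the
  measure.\<close>

lemma halving_exponent_range:
  fixes r :: "'a \<Rightarrow> real"
  assumes [measurable]: "r \<in> borel_measurable M" "E \<in> sets M" and \<delta>: "0 \<le> \<delta>"
    and r: "\<And>x. x \<in> E \<Longrightarrow> 1 \<le> r x \<and> r x \<le> 1 + \<delta>" and e: "emeasure M E = ennreal e" "0 \<le> e"
  shows "\<exists>G \<pi>. G \<in> sets M \<and> G \<subseteq> E \<and> 1 \<le> \<pi> \<and> \<pi> + \<delta> / 2 ^ i \<le> 1 + \<delta> \<and>
    ennreal (e / 2 ^ i) \<le> emeasure M G \<and> (\<forall>x\<in>G. \<pi> \<le> r x \<and> r x \<le> \<pi> + \<delta> / 2 ^ i)"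
proof (induction i)
  case 0
  show ?case using assms by (intro exI[of _ E] exI[of _ 1]) auto
next
  case (Suc i)
  then obtain G \<pi> where G [measurable]: "G \<in> sets M" and GE: "G \<subseteq> E" and \<pi>: "1 \<le> \<pi>" "\<pi> + \<delta> / 2 ^ i \<le> 1 + \<delta>"
    and m: "ennreal (e / 2 ^ i) \<le> emeasure M G" and rG: "\<And>x. x \<in> G \<Longrightarrow> \<pi> \<le> r x \<and> r x \<le> \<pi> + \<delta> / 2 ^ i"
    by blast
  define \<mu> where "\<mu> = \<pi> + \<delta> / 2 ^ Suc i"
  have \<mu>: "\<pi> \<le> \<mu>" "\<mu> + \<delta> / 2 ^ Suc i = \<pi> + \<delta> / 2 ^ i" using \<delta> by (auto simp: \<mu>_def)
  define G1 where "G1 = G \<inter> {x \<in> space M. r x \<le> \<mu>}"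
  have G1 [measurable]: "G1 \<in> sets M" unfolding G1_def by measurable
  have inG: "x \<in> space M" if "x \<in> G" for x using that sets.sets_into_space[OF G] by blast
  show ?case
  proof (cases "ennreal (e / 2 ^ Suc i) \<le> emeasure M G1")
    case True
    have "\<mu> \<le> 1 + \<delta>" using \<pi> \<mu> \<delta> by (smt (verit) divide_nonneg_pos zero_less_power)
    then show ?thesis
      using True GE \<pi> rG G1 by (intro exI[of _ G1] exI[of _ \<pi>]) (auto simp: G1_def \<mu>_def)
  next
    case False
    have "ennreal (e / 2 ^ Suc i) \<le> emeasure M (G - G1)"
    proof (rule ccontr)
      assume "\<not> ennreal (e / 2 ^ Suc i) \<le> emeasure M (G - G1)"
      with False have less: "emeasure M (G - G1) < ennreal (e / 2 ^ Suc i)" "emeasure M G1 < ennreal (e / 2 ^ Suc i)" by auto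
      have "emeasure M G = emeasure M (G - G1) + emeasure M G1"
        by (subst plus_emeasure) (auto simp: G1_def intro!: arg_cong[where f = "emeasure M"])
      also have "\<dots> < ennreal (e / 2 ^ Suc i) + ennreal (e / 2 ^ Suc i)"
        using less by (rule add_strict_mono)
      also have "\<dots> = ennreal (e / 2 ^ Suc i + e / 2 ^ Suc i)"
        using e by (intro ennreal_plus[symmetric]) auto
      also have "e / 2 ^ Suc i + e / 2 ^ Suc i = e / 2 ^ i" by simp
      finally show False using m by simp
    qed
    then show ?thesis
      using GE \<pi> \<mu> rG inG by (intro exI[of _ "G - G1"] exI[of _ \<mu>]) (auto simp: G1_def)
  qed
qed

text \<open>The logarithm of the left side is \<delta> 2^(-i) (i ln 2 - ln e), which tends to 0: the
  exponent range shrinks geometrically, while the logarithm of the measure falls only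
  linearly.\<close>

lemma ex_small_oscillation:
  fixes \<delta> e :: real
  assumes "0 < e"
  obtains i :: nat where "(e / 2 ^ i) powr (- (\<delta> / 2 ^ i)) \<le> 2"
proof -
  have "(\<lambda>i::nat. \<delta> * (real i * (1 / 2) ^ i * ln 2 - (1 / 2) ^ i * ln e)) \<longlonglongrightarrow> \<delta> * (0 * ln 2 - 0 * ln e)"
  proof (intro tendsto_intros LIMSEQ_power_zero)
    show "(\<lambda>i. real i * (1 / 2) ^ i) \<longlonglongrightarrow> (0::real)"
      by (rule powser_times_n_limit_0) simp
  qed auto
  then have "eventually (\<lambda>i::nat. \<delta> * (real i * (1 / 2) ^ i * ln 2 - (1 / 2) ^ i * ln e) < ln 2) sequentially"
    by (intro order_tendstoD(2)) auto
  then obtain i :: nat where i: "\<delta> * (real i * (1 / 2) ^ i * ln 2 - (1 / 2) ^ i * ln e) < ln 2"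
    by (auto simp: eventually_sequentially)
  have "ln (e / 2 ^ i) = ln e - real i * ln 2"
    using assms by (simp add: ln_div ln_realpow)
  then have "- (\<delta> / 2 ^ i) * ln (e / 2 ^ i) = \<delta> * (real i * (1 / 2) ^ i * ln 2 - (1 / 2) ^ i * ln e)"
    by (simp only:) (simp add: algebra_simps power_divide)
  then have "- (\<delta> / 2 ^ i) * ln (e / 2 ^ i) < ln 2"
    using i by simp
  then have "exp (- (\<delta> / 2 ^ i) * ln (e / 2 ^ i)) < exp (ln 2)" by (simp only: exp_less_cancel_iff)
  then have "(e / 2 ^ i) powr (- (\<delta> / 2 ^ i)) < 2"
    using assms by (simp add: powr_def)
  then show ?thesis by (intro that[of i]) simp
qed

text \<open>Above the threshold \<open>a\<close> the factor t^(1-r) is at most a^(1-\<pi>). For a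
  suitable \<open>a\<close> this replaces Hoelder's inequality where the exponent varies.\<close>

lemma power_ge_linear:
  fixes t a r \<pi> :: real
  assumes "0 \<le> t" "1 \<le> a" "1 \<le> \<pi>" "\<pi> \<le> r"
  shows "t \<le> a + a powr (1 - \<pi>) * t powr r"
proof (cases "t \<le> a")
  case True
  then show ?thesis by (simp add: add_increasing2)
next
  case False
  then have t: "a \<le> t" "0 < t" using assms by auto
  have "t = t powr (1 - r) * t powr r"
    using t by (simp add: powr_add[symmetric])
  also have "\<dots> \<le> a powr (1 - r) * t powr r"
    using t assms by (intro mult_right_mono powr_mono2') auto
  also have "\<dots> \<le> a powr (1 - \<pi>) * t powr r"
    using assms by (intro mult_right_mono powr_mono) auto
  finally show ?thesis using assms by linarith
qed

text \<open>For \<open>\<phi> \<le> 1\<close> and exponents at most \<open>P\<close> the power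
  \<phi>^(-p(x)/P) is at most 1/\<phi>, so at the claimed scale the integral over \<open>F\<close>
  is at most 1.\<close>

lemma wnorm_indicator_le:
  assumes p: "exponent p" and w: "weight w" and E [measurable]: "F \<in> sets lebesgue" "emeasure lebesgue F = ennreal \<phi>" "0 < \<phi>" "\<phi> \<le> 1"
    and k: "0 < k" "\<And>x. x \<in> F \<Longrightarrow> w x \<le> ennreal k"
    and r: "\<And>x. x \<in> F \<Longrightarrow> p x \<noteq> \<infinity> \<and> enn2real (p x) \<le> P" and P: "0 < P"
  shows "wnorm p w (indicator F) \<le> ennreal (k * \<phi> powr (1 / P))"
  unfolding wnorm_def
proof (rule var_norm_leI)
  let ?l = "k * \<phi> powr (1 / P)"
  let ?F = "\<lambda>x. ennreal (norm (indicator F x :: complex)) * w x"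
  show l: "0 < ?l" using k E by simp
  have [measurable]: "w \<in> borel_measurable lebesgue" using w by (simp add: weight_def)
  have "esssup (restrict_space lebesgue {x. p x = \<infinity>}) ?F \<le> 0"
  proof (rule esssup_I)
    show "?F \<in> borel_measurable (restrict_space lebesgue {x. p x = \<infinity>})"
      by (intro measurable_restrict_space1) measurable
    show "AE x in restrict_space lebesgue {x. p x = \<infinity>}. ?F x \<le> 0"
      using r by (intro AE_I2) (auto simp: indicator_def space_restrict_space)
  qed
  then have "esssup (restrict_space lebesgue {x. p x = \<infinity>}) ?F = 0" by simp
  moreover have "(\<integral>\<^sup>+x\<in>{x. p x \<noteq> \<infinity>}. epowr (?F x / ennreal ?l) (enn2real (p x)) \<partial>lebesgue) \<le> (\<integral>\<^sup>+x. ennreal (1 / \<phi>) * indicator F x \<partial>lebesgue)"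
  proof (intro nn_integral_mono)
    fix x
    have p1: "1 \<le> p x" using p by (simp add: exponent_def)
    show "epowr (?F x / ennreal ?l) (enn2real (p x)) * indicator {x. p x \<noteq> \<infinity>} x \<le> ennreal (1 / \<phi>) * indicator F x"
    proof (cases "x \<in> F")
      case True
      have "?F x / ennreal ?l \<le> ennreal k / ennreal ?l"
        using True k by (intro divide_right_mono_ennreal) auto
      also have "\<dots> = ennreal (k / ?l)"
        using k l by (intro divide_ennreal) auto
      also have "k / ?l = \<phi> powr (- (1 / P))"
        using k by (simp add: powr_minus_divide)
      finally have "epowr (?F x / ennreal ?l) (enn2real (p x)) \<le> epowr (ennreal (\<phi> powr (- (1 / P)))) (enn2real (p x))"
        by (intro epowr_mono) auto
      also have "\<dots> = ennreal (\<phi> powr (- (enn2real (p x) / P)))"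
        by (simp add: epowr_ennreal powr_powr)
      also have "\<dots> \<le> ennreal (\<phi> powr (- 1))"
        using r[OF True] P E by (intro ennreal_leI powr_mono') auto
      also have "\<phi> powr (- 1) = 1 / \<phi>"
        using E by (simp add: powr_minus_divide)
      finally show ?thesis using True r[OF True] by simp
    next
      case False
      then show ?thesis using p1 by (auto simp: epowr_def)
    qed
  qed
  moreover have "(\<integral>\<^sup>+x. ennreal (1 / \<phi>) * indicator F x \<partial>lebesgue) = 1"
    using E by (simp add: nn_integral_cmult_indicator flip: ennreal_mult)
  ultimately show "(\<integral>\<^sup>+x\<in>{x. p x \<noteq> \<infinity>}. epowr (?F x / ennreal ?l) (enn2real (p x)) \<partial>lebesgue)
       + inverse (ennreal ?l) * esssup (restrict_space lebesgue {x. p x = \<infinity>}) ?F \<le> 1"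
    by simp
qed

text \<open>Plays the part of Hoelder's inequality against the indicator of \<open>E\<close>, for
  exponents of at least \<pi>.\<close>

lemma nn_integral_le_if_var_norm_less:
  fixes h :: "'a::euclidean_space \<Rightarrow> real"
  assumes p: "exponent p" and [measurable]: "h \<in> borel_measurable lebesgue" "E \<in> sets lebesgue"
    and h: "\<And>x. 0 \<le> h x" and e: "emeasure lebesgue E = ennreal e" "0 < e" "e \<le> 1"
    and k: "0 < k" "\<And>x. x \<in> E \<Longrightarrow> ennreal k \<le> w x"
    and r: "\<And>x. x \<in> E \<Longrightarrow> p x \<noteq> \<infinity> \<and> \<pi> \<le> enn2real (p x)" and \<pi>: "1 \<le> \<pi>" and L: "0 < L"
    and less: "var_norm p (\<lambda>x. ennreal (h x) * w x) < ennreal L"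
  shows "(\<integral>\<^sup>+x\<in>E. ennreal (h x) \<partial>lebesgue) \<le> ennreal (2 * L / k * e powr (1 - 1 / \<pi>))"
proof -
  \<comment> \<open>This threshold balances the two terms, a e = a^(1-\<pi>) = e^(1-1/\<pi>); their
    sum accounts for the 2 in the conclusion.\<close>
  define a where "a = e powr (- (1 / \<pi>))"
  have a: "1 \<le> a" "0 < a"
    using e \<pi> powr_mono'[of "- (1 / \<pi>)" 0 e] by (auto simp: a_def)
  define b where "b = a powr (1 - \<pi>)"
  have b: "b = e powr (1 - 1 / \<pi>)"
    using \<pi> by (simp add: b_def a_def powr_powr diff_divide_distrib algebra_simps)
  have ae: "a * e = e powr (1 - 1 / \<pi>)"
    using e powr_add[of e "- (1 / \<pi>)" 1] by (simp add: a_def)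
  define u where "u x = epowr (ennreal (h x) * w x / ennreal L) (enn2real (p x))" for x
  have mod: "(\<integral>\<^sup>+x\<in>{x. p x \<noteq> \<infinity>}. u x \<partial>lebesgue) \<le> 1"
    using var_norm_lessD[OF less] by (simp add: u_def)
  have pm [measurable]: "p \<in> borel_measurable lebesgue" using p by (simp add: exponent_def)
  have "(\<integral>\<^sup>+x\<in>E. ennreal (k / L * h x) \<partial>lebesgue) \<le> (\<integral>\<^sup>+x. ennreal a * indicator E x + ennreal b * epowr (ennreal (k / L * h x)) (enn2real (p x)) * indicator E x \<partial>lebesgue)"
  proof (intro nn_integral_mono)
    fix x
    show "ennreal (k / L * h x) * indicator E x \<le> ennreal a * indicator E x + ennreal b * epowr (ennreal (k / L * h x)) (enn2real (p x)) * indicator E x"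
    proof (cases "x \<in> E")
      case True
      have "0 \<le> k / L * h x" using k L h by simp
      then have "ennreal (k / L * h x) \<le> ennreal (a + b * (k / L * h x) powr (enn2real (p x)))"
        using power_ge_linear[of "k / L * h x" a \<pi> "enn2real (p x)"] a \<pi> r[OF True] by (intro ennreal_leI) (simp add: b_def)
      then show ?thesis
        using True a \<open>0 \<le> k / L * h x\<close> by (simp add: epowr_ennreal ennreal_mult ennreal_plus b_def)
    qed auto
  qed
  also have "\<dots> = ennreal a * ennreal e + ennreal b * (\<integral>\<^sup>+x\<in>E. epowr (ennreal (k / L * h x)) (enn2real (p x)) \<partial>lebesgue)"
    by (simp add: nn_integral_add nn_integral_cmult nn_integral_cmult_indicator e mult.assoc)
  also have "(\<integral>\<^sup>+x\<in>E. epowr (ennreal (k / L * h x)) (enn2real (p x)) \<partial>lebesgue) \<le> (\<integral>\<^sup>+x\<in>{x. p x \<noteq> \<infinity>}. u x \<partial>lebesgue)"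
  proof (intro nn_integral_mono)
    fix x
    show "epowr (ennreal (k / L * h x)) (enn2real (p x)) * indicator E x \<le> u x * indicator {x. p x \<noteq> \<infinity>} x"
    proof (cases "x \<in> E")
      case True
      have "ennreal (k / L * h x) = ennreal (h x) * ennreal k / ennreal L"
        using k L h[of x] by (simp add: divide_ennreal mult.commute flip: ennreal_mult)
      also have "\<dots> \<le> ennreal (h x) * w x / ennreal L"
        using k(2)[OF True] by (intro divide_right_mono_ennreal mult_left_mono) auto
      finally have "epowr (ennreal (k / L * h x)) (enn2real (p x)) \<le> u x"
        unfolding u_def by (intro epowr_mono) auto
      then show ?thesis using True r[OF True] by simp
    qed auto
  qed
  also note mod
  finally have "(\<integral>\<^sup>+x\<in>E. ennreal (k / L * h x) \<partial>lebesgue) \<le> ennreal a * ennreal e + ennreal b"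
    by (simp add: mult_left_mono add_left_mono)
  also have "\<dots> = ennreal (2 * e powr (1 - 1 / \<pi>))"
    using a e by (simp add: ae b flip: ennreal_mult ennreal_plus)
  finally have 1: "(\<integral>\<^sup>+x\<in>E. ennreal (k / L * h x) \<partial>lebesgue) \<le> ennreal (2 * e powr (1 - 1 / \<pi>))" .
  have "(\<integral>\<^sup>+x\<in>E. ennreal (h x) \<partial>lebesgue) = (\<integral>\<^sup>+x. ennreal (L / k) * (ennreal (k / L * h x) * indicator E x) \<partial>lebesgue)"
    using k L h by (intro nn_integral_cong) (auto simp: indicator_def simp flip: ennreal_mult)
  also have "\<dots> = ennreal (L / k) * (\<integral>\<^sup>+x\<in>E. ennreal (k / L * h x) \<partial>lebesgue)"
    by (intro nn_integral_cmult) measurable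
  also have "\<dots> \<le> ennreal (L / k) * ennreal (2 * e powr (1 - 1 / \<pi>))"
    by (intro mult_left_mono 1) auto
  also have "\<dots> = ennreal (2 * L / k * e powr (1 - 1 / \<pi>))"
    using k L by (simp add: mult_ac flip: ennreal_mult)
  finally show ?thesis .
qed

text \<open>
  Boundedness of the maximal operator keeps the exponent away from \<open>1\<close>. Otherwise pigeonholing
  yields a set \<open>G\<close> of measure \<open>e\<close> where \<open>w\<close> is essentially constant and the oscillation \<open>\<eta>\<close> of
  \<open>p\<close> is so small that \<open>e powr - \<eta>\<close> is bounded. There the norm behaves like that of \<open>L\<^sup>p\<close> with
  constant \<open>p\<close> close to \<open>1\<close>, and spreading many small cubes over \<open>G\<close> contradicts the bound.
\<close>

lemma maximal_bounded_exponent_gt_1: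
  fixes p w :: "'a::euclidean_space \<Rightarrow> ennreal"
  assumes p: "exponent p" and w: "weight w" and M: "maximal_bounded p w"
  shows "\<exists>\<delta>>0. AE x in lebesgue. ennreal (1 + \<delta>) \<le> p x"
proof -
  let ?n = "DIM('a)"
  obtain C0 where C0: "\<forall>f\<in>wLp p w. var_norm p (\<lambda>x. maximal f x * w x) \<le> ennreal C0 * wnorm p w f"
    using M by (auto simp: maximal_bounded_def)
  define C where "C = max 1 C0"
  have C: "1 \<le> C" "var_norm p (\<lambda>x. maximal f x * w x) \<le> ennreal C * wnorm p w f" if "f \<in> wLp p w" for f
  proof -
    have "ennreal C0 * wnorm p w f \<le> ennreal C * wnorm p w f"
      by (intro mult_right_mono ennreal_leI) (auto simp: C_def)
    then show "var_norm p (\<lambda>x. maximal f x * w x) \<le> ennreal C * wnorm p w f"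
      using C0 that order_trans by blast
  qed (simp add: C_def)
  have C1: "1 \<le> C" by (simp add: C_def)
  have pm [measurable]: "p \<in> borel_measurable lebesgue" using p by (simp add: exponent_def)
  have wm [measurable]: "w \<in> borel_measurable lebesgue" using w by (simp add: weight_def)
  have p1: "1 \<le> p x" for x using p by (simp add: exponent_def)
  define c where "c = chain_const ?n"
  have c: "0 < c" by (simp add: c_def chain_const_pos)
  \<comment> \<open>The final comparison reads N c \<le> 32 C and must fail. Of the 32, a factor 8
    collects the 2 from the integral estimate, the 2 from the weight and the 2 in \<open>L\<close>;
    the factor 4 bounds the two powers left at the end.\<close>
  obtain N :: nat where N: "32 * C / c < real N" using reals_Archimedean2 by blast
  then have N0: "0 < N" using C1 c by (cases "N = 0") (auto simp: divide_less_0_iff)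
  \<comment> \<open>The lower bound for |F| / |G| that \<open>maximal_indicator_large\<close>
    supplies.\<close>
  define \<theta> :: real where "\<theta> = 1 / (4 * 2 ^ (?n * N))"
  have "(1::real) \<le> 2 ^ (?n * N)" by (rule one_le_power) simp
  then have "1 < 4 * (2::real) ^ (?n * N)" by linarith
  then have \<theta>: "0 < \<theta>" "\<theta> < 1"
    unfolding \<theta>_def by (simp_all only: divide_less_eq_1_pos zero_less_divide_1_iff)
  \<comment> \<open>Chosen so that the loss \<theta>^(-\<delta>) caused by the smallness of
    \<open>F\<close> is exactly 2. It depends only on the constant \<open>C\<close> and the
    dimension.\<close>
  define \<delta> where "\<delta> = ln 2 / ln (1 / \<theta>)"
  have \<delta>: "0 < \<delta>" using \<theta> by (simp add: \<delta>_def)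
  have \<theta>\<delta>: "\<theta> powr (- \<delta>) = 2"
    using \<theta> by (simp add: powr_def \<delta>_def ln_div)
  have "AE x in lebesgue. ennreal (1 + \<delta>) \<le> p x"
  proof (rule ccontr)
    assume notAE: "\<not> (AE x in lebesgue. ennreal (1 + \<delta>) \<le> p x)"
    \<comment> \<open>Dyadic levels of the weight inside unit cubes: countably many pieces of
      measure at most 1, on each of which \<open>w\<close> is constant up to a factor 2.\<close>
    define E where "E k Q = Q \<inter> {x \<in> space lebesgue. p x < ennreal (1 + \<delta>) \<and> ennreal (2 powr of_int k) \<le> w x \<and> w x < ennreal (2 * 2 powr of_int k)}"
      for k :: int and Q :: "'a set"
    \<comment> \<open>The pieces cover the set where p < 1 + \<delta> up to a null set; were all of
      them null, this set would be null as well.\<close>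
    have "\<exists>k. \<exists>Q\<in>range (grid_cube 1). emeasure lebesgue (E k Q) \<noteq> 0"
    proof (rule ccontr)
      assume "\<not> ?thesis"
      then have null: "emeasure lebesgue (E k Q) = 0" if "Q \<in> range (grid_cube 1)" for k Q using that by blast
      have "AE x in lebesgue. \<forall>k. \<forall>Q\<in>range (grid_cube 1). x \<notin> E k Q"
      proof (subst AE_all_countable, intro allI, subst AE_ball_countable)
        show "countable (range (grid_cube 1 :: 'a \<Rightarrow> _))" by (intro countable_grid_cubes) auto
        show "\<forall>Q\<in>range (grid_cube 1). AE x in lebesgue. x \<notin> E k Q" for k
        proof
          fix Q assume Q: "Q \<in> range (grid_cube 1 :: 'a \<Rightarrow> _)"
          then have [measurable]: "Q \<in> sets lebesgue" by auto
          have "E k Q \<in> sets lebesgue" unfolding E_def by measurable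
          then have "E k Q \<in> null_sets lebesgue" using null[OF Q] by auto
          then show "AE x in lebesgue. x \<notin> E k Q" by (rule AE_not_in)
        qed
      qed
      moreover have "AE x in lebesgue. 0 < w x \<and> w x < \<infinity>" using w by (simp add: weight_def)
      ultimately have "AE x in lebesgue. ennreal (1 + \<delta>) \<le> p x"
      proof eventually_elim
        case (elim x)
        obtain t where t: "w x = ennreal t" "0 < t" using elim(2) by (cases "w x") auto
        define k where "k = \<lfloor>log 2 t\<rfloor>"
        have "of_int k \<le> log 2 t" "log 2 t < of_int k + 1" by (auto simp: k_def)
        then have "2 powr of_int k \<le> t" "t < 2 powr (of_int k + 1)"
          using t by (auto simp: le_log_iff log_less_iff)
        then have "ennreal (2 powr of_int k) \<le> w x \<and> w x < ennreal (2 * 2 powr of_int k)"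
          using t by (auto simp: powr_add ennreal_leI ennreal_lessI)
        moreover have "x \<notin> E k (grid_cube 1 x)" using elim(1) by blast
        ultimately show ?case by (auto simp: E_def)
      qed
      then show False using notAE by simp
    qed
    then obtain k Q where Q: "Q \<in> range (grid_cube 1)" "emeasure lebesgue (E k Q) \<noteq> 0" by blast
    define \<nu> :: real where "\<nu> = 2 powr of_int k"
    have \<nu>: "0 < \<nu>" by (simp add: \<nu>_def)
    have Qm [measurable]: "Q \<in> sets lebesgue" using Q by auto
    have Em [measurable]: "E k Q \<in> sets lebesgue" unfolding E_def by measurable
    have "emeasure lebesgue (E k Q) \<le> emeasure lebesgue Q" by (intro emeasure_mono) (auto simp: E_def)
    also have "\<dots> = 1" using Q(1) by (auto simp: emeasure_grid_cube)
    finally have E1: "emeasure lebesgue (E k Q) \<le> 1" .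
    then obtain e0 where e0: "emeasure lebesgue (E k Q) = ennreal e0" "0 \<le> e0"
      by (cases "emeasure lebesgue (E k Q)") (auto simp: top_unique)
    with Q(2) E1 have e01: "0 < e0" "e0 \<le> 1" by (auto simp: less_le)
    have rE: "p x \<noteq> \<infinity>" "1 \<le> enn2real (p x) \<and> enn2real (p x) \<le> 1 + \<delta>" if "x \<in> E k Q" for x
    proof -
      have less: "p x < ennreal (1 + \<delta>)" using that by (simp add: E_def del: ennreal_plus)
      then obtain t where t: "p x = ennreal t" "0 \<le> t" by (cases "p x") auto
      have "t < 1 + \<delta>" using less t(2) unfolding t(1) by (simp only: ennreal_less_iff)
      then show "p x \<noteq> \<infinity>" "1 \<le> enn2real (p x) \<and> enn2real (p x) \<le> 1 + \<delta>" using p1[of x] t by auto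
    qed
    \<comment> \<open>The number of bisections is read off from \<open>e0\<close>, before
      \<open>G\<close> is known. As \<open>G\<close> keeps measure at least e0 / 2^i, the bound
      carries over to its own measure.\<close>
    obtain i :: nat where i: "(e0 / 2 ^ i) powr (- (\<delta> / 2 ^ i)) \<le> 2"
      by (rule ex_small_oscillation[OF e01(1)]) (rule that)
    define \<eta> where "\<eta> = \<delta> / 2 ^ i"
    have \<eta>: "0 < \<eta>" using \<delta> by (simp add: \<eta>_def)
    have "(\<lambda>x. enn2real (p x)) \<in> borel_measurable lebesgue" by measurable
    from halving_exponent_range[OF this Em less_imp_le[OF \<delta>] rE(2) e0, of i]
    obtain G \<pi> where G [measurable]: "G \<in> sets lebesgue" and GE: "G \<subseteq> E k Q" and \<pi>: "1 \<le> \<pi>" "\<pi> + \<eta> \<le> 1 + \<delta>"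
      and Gm: "ennreal (e0 / 2 ^ i) \<le> emeasure lebesgue G" and rG: "\<And>x. x \<in> G \<Longrightarrow> \<pi> \<le> enn2real (p x) \<and> enn2real (p x) \<le> \<pi> + \<eta>"
      unfolding \<eta>_def by blast
    have "emeasure lebesgue G \<le> emeasure lebesgue (E k Q)" using GE by (intro emeasure_mono) auto
    then have G1: "emeasure lebesgue G \<le> 1" using E1 by simp
    then obtain e where e: "emeasure lebesgue G = ennreal e" "0 \<le> e"
      by (cases "emeasure lebesgue G") (auto simp: top_unique)
    have e1: "e0 / 2 ^ i \<le> e" "e \<le> 1" using Gm G1 e e01 by auto
    have "0 < e0 / 2 ^ i" using e01 by simp
    then have epos: "0 < e" using e1 by linarith
    have e\<eta>: "e powr (- \<eta>) \<le> 2"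
    proof -
      have "e powr (- \<eta>) \<le> (e0 / 2 ^ i) powr (- \<eta>)"
        using e1 \<open>0 < e0 / 2 ^ i\<close> \<eta> by (intro powr_mono2') auto
      then show ?thesis using i by (simp add: \<eta>_def)
    qed
    obtain F where F [measurable]: "F \<in> sets lebesgue" and FG: "F \<subseteq> G"
      and Fm: "ennreal (e / (4 * 2 ^ (?n * N))) \<le> emeasure lebesgue F"
      and FM: "ennreal (real N * c) * emeasure lebesgue F \<le> (\<integral>\<^sup>+y\<in>G. maximal (indicator F) y \<partial>lebesgue)"
      by (rule maximal_indicator_large[OF G e(1) epos, of N, folded c_def]) (rule that)
    have "emeasure lebesgue F \<le> emeasure lebesgue G" using FG by (intro emeasure_mono) auto
    then obtain \<phi> where \<phi>: "emeasure lebesgue F = ennreal \<phi>" "0 \<le> \<phi>" "\<phi> \<le> e"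
      using e by (cases "emeasure lebesgue F") (auto simp: top_unique)
    have \<phi>\<theta>: "\<theta> * e \<le> \<phi>" using Fm \<phi> by (simp add: \<theta>_def)
    have \<phi>pos: "0 < \<phi>" "\<phi> \<le> 1" using \<phi>\<theta> \<theta>(1) epos mult_pos_pos[of \<theta> e] \<phi> e1 by linarith+
    define P where "P = \<pi> + \<eta>"
    have P: "1 < P" "P \<le> 1 + \<delta>" "P - \<pi> = \<eta>" using \<pi> \<eta> by (auto simp: P_def)
    have inE: "x \<in> E k Q" if "x \<in> F" for x using that FG GE by blast
    have wn: "wnorm p w (indicator F) \<le> ennreal (2 * \<nu> * \<phi> powr (1 / P))"
    proof (rule wnorm_indicator_le[OF p w F \<phi>(1) \<phi>pos])
      show "0 < 2 * \<nu>" using \<nu> by simp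
      show "w x \<le> ennreal (2 * \<nu>)" if "x \<in> F" for x using inE[OF that] by (auto simp: E_def \<nu>_def)
      show "p x \<noteq> \<infinity> \<and> enn2real (p x) \<le> P" if "x \<in> F" for x
        using rE(1)[OF inE[OF that]] rG[of x] that FG by (auto simp: P_def)
      show "0 < P" using P by simp
    qed
    have "(indicator F :: 'a \<Rightarrow> complex) \<in> borel_measurable lebesgue" by measurable
    then have FL: "indicator F \<in> wLp p w"
      using wn by (auto simp: wLp_def intro: le_less_trans)
    \<comment> \<open>The last factor 2 only makes the inequality for the norm strict.\<close>
    define L where "L = C * (2 * \<nu> * \<phi> powr (1 / P)) * 2"
    have L: "0 < L" using C1 \<nu> \<phi>pos by (simp add: L_def)
    have "var_norm p (\<lambda>x. maximal (indicator F) x * w x) \<le> ennreal C * ennreal (2 * \<nu> * \<phi> powr (1 / P))"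
      using C(2)[OF FL] wn by (meson mult_left_mono order_trans zero_le)
    also have "\<dots> = ennreal (C * (2 * \<nu> * \<phi> powr (1 / P)))"
      using C1 \<nu> by (intro ennreal_mult[symmetric]) auto
    also have "\<dots> < ennreal L"
      using L by (intro ennreal_lessI) (auto simp: L_def)
    finally have less: "var_norm p (\<lambda>x. maximal (indicator F) x * w x) < ennreal L" .
    \<comment> \<open>The maximal function of an indicator is at most 1, so nothing is lost by
      making it real.\<close>
    define h where "h x = enn2real (maximal (indicator F) x)" for x
    have "maximal (indicator F) x \<le> ennreal 1" for x by (rule maximal_le) (auto simp: indicator_def)
    then have hM: "ennreal (h x) = maximal (indicator F) x" for x
      unfolding h_def by (metis ennreal_enn2real ennreal_less_top le_less_trans)
    have "(\<integral>\<^sup>+x\<in>G. ennreal (h x) \<partial>lebesgue) \<le> ennreal (2 * L / \<nu> * e powr (1 - 1 / \<pi>))"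
    proof (rule nn_integral_le_if_var_norm_less[OF p _ G _ e(1) epos e1(2) \<nu>])
      show "h \<in> borel_measurable lebesgue" unfolding h_def by measurable
      show "ennreal \<nu> \<le> w x" if "x \<in> G" for x using that GE by (auto simp: E_def \<nu>_def)
      show "p x \<noteq> \<infinity> \<and> \<pi> \<le> enn2real (p x)" if "x \<in> G" for x
        using rE(1)[of x] rG[OF that] that GE by auto
      show "var_norm p (\<lambda>x. ennreal (h x) * w x) < ennreal L" using less by (simp add: hM)
    qed (use \<pi> L in \<open>auto simp: h_def\<close>)
    then have "ennreal (real N * c) * ennreal \<phi> \<le> ennreal (2 * L / \<nu> * e powr (1 - 1 / \<pi>))"
      using FM by (simp add: hM \<phi>)
    then have "real N * c * \<phi> \<le> 2 * L / \<nu> * e powr (1 - 1 / \<pi>)"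
      using c \<phi> L \<nu> by (simp flip: ennreal_mult)
    also have "2 * L / \<nu> = 8 * C * \<phi> powr (1 / P)"
      using \<nu> by (simp add: L_def)
    finally have "real N * c * \<phi> / \<phi> \<le> 8 * C * \<phi> powr (1 / P) * e powr (1 - 1 / \<pi>) / \<phi>"
      using \<phi>pos by (intro divide_right_mono) auto
    also have "8 * C * \<phi> powr (1 / P) * e powr (1 - 1 / \<pi>) / \<phi> = 8 * C * (\<phi> powr (1 / P - 1) * e powr (1 - 1 / \<pi>))"
    proof -
      have "\<phi> powr (1 / P - 1) = \<phi> powr (1 / P) / \<phi>" using \<phi>pos by (simp add: powr_diff)
      then show ?thesis by simp
    qed
    \<comment> \<open>The exponent 1/P - 1 is negative, so \<phi> may be replaced by its lower bound
      \<theta> e. The powers of \<open>e\<close> then combine to 1/P - 1/\<pi>, whose size is at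
      most \<eta>.\<close>
    also have "\<dots> \<le> 8 * C * ((\<theta> * e) powr (1 / P - 1) * e powr (1 - 1 / \<pi>))"
      using C1 \<phi>\<theta> \<theta> epos P by (intro mult_left_mono mult_right_mono powr_mono2') (auto simp: field_simps)
    also have "\<dots> = 8 * C * (\<theta> powr (1 / P - 1) * e powr (1 / P - 1 / \<pi>))"
      using \<theta> epos by (simp add: powr_mult powr_add[symmetric])
    also have "\<dots> \<le> 8 * C * (2 * 2)"
    proof (intro mult_left_mono mult_mono)
      \<comment> \<open>From P \<le> 1 + \<delta> and (1 - \<delta>) (1 + \<delta>) \<le> 1; for
        \<delta> > 1 the left side is negative.\<close>
      have "1 - \<delta> \<le> 1 / P"
      proof -
        have "(1 - \<delta>) * P \<le> 1"
        proof (cases "\<delta> \<le> 1")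
          case True
          then have "(1 - \<delta>) * P \<le> (1 - \<delta>) * (1 + \<delta>)" using P by (intro mult_left_mono) auto
          also have "\<dots> \<le> 1" by (simp add: algebra_simps)
          finally show ?thesis .
        next
          case False
          then have "(1 - \<delta>) * P \<le> 0" using P by (intro mult_nonpos_nonneg) auto
          then show ?thesis by simp
        qed
        then show ?thesis using P by (simp add: field_simps)
      qed
      then have "\<theta> powr (1 / P - 1) \<le> \<theta> powr (- \<delta>)"
        using \<theta> by (intro powr_mono') auto
      then show "\<theta> powr (1 / P - 1) \<le> 2" using \<theta>\<delta> by simp
      have "1 / \<pi> - 1 / P = \<eta> / (\<pi> * P)" using P \<pi> by (simp add: field_simps)
      also have "\<dots> \<le> \<eta> / 1" using P \<pi> \<eta> mult_mono[of 1 \<pi> 1 P] by (intro divide_left_mono) auto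
      finally have "e powr (1 / P - 1 / \<pi>) \<le> e powr (- \<eta>)"
        using epos e1 by (intro powr_mono') auto
      then show "e powr (1 / P - 1 / \<pi>) \<le> 2" using e\<eta> by simp
    qed (use C1 in auto)
    finally have "real N * c \<le> 32 * C" using \<phi>pos by simp
    then show False using N c by (simp add: field_simps)
  qed
  then show ?thesis using \<delta> by blast
qed

section \<open>Norms for exponents bounded away from one and infinity\<close>

lemma epowr_mult:
  assumes "0 < c"
  shows "epowr (ennreal c * t) r = ennreal (c powr r) * epowr t r"
proof (cases t)
  case (real s)
  then show ?thesis
    using assms by (simp add: epowr_ennreal powr_mult flip: ennreal_mult)
next
  case top
  then show ?thesis
    using assms by (simp add: epowr_def ennreal_mult_top)
qed

text \<open>Here exponents of at least 1 enter the norm estimates: c^r \<le> c for c \<le>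
  1.\<close>

lemma epowr_scale_le:
  assumes "0 < c" "c \<le> 1" "1 \<le> r"
  shows "epowr (ennreal c * t) r \<le> ennreal c * epowr t r"
proof -
  have "c powr r \<le> c powr 1" using assms by (intro powr_mono') auto
  then show ?thesis
    using assms by (simp add: epowr_mult mult_right_mono ennreal_leI)
qed

lemma epowr_zero [simp]: "epowr 0 r = 0"
  by (simp add: epowr_def)

lemma less_one_if_epowr_less_one:
  assumes "epowr t r < 1" "0 \<le> r"
  shows "t < 1"
proof (rule ccontr)
  assume "\<not> t < 1"
  then have "epowr (ennreal 1) r \<le> epowr t r" using assms by (intro epowr_mono) auto
  then show False using assms(1) epowr_ennreal[of 1 r] by simp
qed

text \<open>Young's inequality without its coefficients: if y \<le> x^(r-1) the first power alone
  bounds the product, otherwise the second does. The lost coefficients reappear as the 2 in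
  \<open>hoelder\<close>.\<close>

lemma ennreal_mult_le_epowr_add:
  assumes r: "1 < r"
  shows "s * t \<le> epowr s r + epowr t (r / (r - 1))"
proof (cases s)
  case top
  then show ?thesis by (simp add: epowr_def)
next
  case (real x)
  note x = this
  show ?thesis
  proof (cases t)
    case top
    then show ?thesis by (simp add: epowr_def)
  next
    case (real y)
    have "x * y \<le> x powr r + y powr (r / (r - 1))"
    proof (cases "y \<le> x powr (r - 1)")
      case True
      then have "x * y \<le> x * x powr (r - 1)" using x by (intro mult_left_mono) auto
      also have "\<dots> = x powr r" using x by (cases "x = 0") (auto simp: powr_mult_base)
      finally show ?thesis by (simp add: add_increasing2)
    next
      case False
      then have "(x powr (r - 1)) powr (1 / (r - 1)) \<le> y powr (1 / (r - 1))" using r by (intro powr_mono2) auto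
      then have "x \<le> y powr (1 / (r - 1))" using x r by (simp add: powr_powr)
      then have "x * y \<le> y powr (1 / (r - 1)) * y" using real by (intro mult_right_mono) auto
      also have "\<dots> = y powr (1 / (r - 1) + 1)"
        using real by (cases "y = 0") (auto simp: powr_add)
      also have "1 / (r - 1) + 1 = r / (r - 1)" using r by (simp add: field_simps)
      finally show ?thesis by (simp add: add_increasing)
    qed
    then show ?thesis
      using x real by (simp add: epowr_ennreal ennreal_leI flip: ennreal_mult ennreal_plus)
  qed
qed

lemma conj_exponent_ennreal:
  assumes "p x = ennreal r" "1 < r"
  shows "conj_exponent p x = ennreal (r / (r - 1))"
proof -
  have "1 - inverse (ennreal r) = ennreal (1 - inverse r)"
    using assms by (simp add: inverse_ennreal ennreal_minus flip: ennreal_1)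
  moreover have "0 < 1 - inverse r" using assms by (simp add: field_simps)
  moreover have "inverse (1 - inverse r) = r / (r - 1)" using assms by (simp add: field_simps)
  ultimately show ?thesis
    using assms by (simp add: conj_exponent_def inverse_ennreal)
qed

definition modular :: "('a::euclidean_space \<Rightarrow> ennreal) \<Rightarrow> ('a \<Rightarrow> ennreal) \<Rightarrow> ennreal" where
  "modular p F = (\<integral>\<^sup>+x. epowr (F x) (enn2real (p x)) \<partial>lebesgue)"

text \<open>The bounds hold almost everywhere, as \<open>maximal_bounded_exponent_gt_1\<close>
  delivers them. The lower one makes the conjugate exponent bounded; the upper one keeps the
  conjugate exponent away from 1 and gives the domination needed for density.\<close>

locale nice_exponent =
  fixes p :: "'a::euclidean_space \<Rightarrow> ennreal" and a b :: real
  assumes p [measurable]: "p \<in> borel_measurable lebesgue" and a: "1 < a"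
    and range: "AE x in lebesgue. ennreal a \<le> p x \<and> p x \<le> ennreal b"
begin

lemma real_range: "AE x in lebesgue. p x = ennreal (enn2real (p x)) \<and> a \<le> enn2real (p x) \<and> enn2real (p x) \<le> b"
  using range
proof eventually_elim
  case (elim x)
  then obtain t where t: "p x = ennreal t" "0 \<le> t" by (cases "p x") (auto simp: top_unique)
  have "a \<le> t" using elim a t by simp
  moreover have "t \<le> b" using elim t \<open>a \<le> t\<close> a by (cases "0 \<le> b") (auto simp: ennreal_neg)
  ultimately show ?case using t by simp
qed

text \<open>The whole space is not a null set, so a \<le> p(x) \<le> b holds at some point.\<close>

lemma b: "1 < b"
proof (rule ccontr)
  assume "\<not> 1 < b"
  have "AE x in lebesgue :: 'a measure. False"
    using real_range
  proof eventually_elim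
    case (elim x)
    then show ?case using a \<open>\<not> 1 < b\<close> by linarith
  qed
  then have "emeasure lebesgue (UNIV :: 'a set) = 0"
    using ae_filter_eq_bot_iff[of "lebesgue :: 'a measure"] by (simp add: trivial_limit_def)
  then show False by (simp add: emeasure_completion)
qed

lemma finite_AE: "AE x in lebesgue. p x \<noteq> \<infinity>"
  using real_range by eventually_elim (metis ennreal_neq_top infinity_ennreal_def)

lemma real_measurable [measurable]: "(\<lambda>x. enn2real (p x)) \<in> borel_measurable lebesgue"
  by measurable

text \<open>The set where \<open>p\<close> is infinite is null, so the essential supremum in the
  norm vanishes.\<close>

lemma var_norm_le_if_modular_le:
  assumes [measurable]: "F \<in> borel_measurable lebesgue" and l: "0 < l" and mod: "modular p (\<lambda>x. F x / ennreal l) \<le> 1"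
  shows "var_norm p F \<le> ennreal l"
proof (rule var_norm_leI[OF l])
  have "esssup (restrict_space lebesgue {x. p x = \<infinity>}) F \<le> 0"
  proof (rule esssup_I)
    show "F \<in> borel_measurable (restrict_space lebesgue {x. p x = \<infinity>})"
      by (intro measurable_restrict_space1) measurable
    have "{x \<in> space lebesgue. p x = \<infinity>} \<in> sets lebesgue" by measurable
    then have "{x. p x = \<infinity>} \<inter> space lebesgue \<in> sets lebesgue" by simp
    moreover have "AE x in lebesgue. x \<in> {x. p x = \<infinity>} \<longrightarrow> F x \<le> 0"
      using finite_AE by eventually_elim simp
    ultimately show "AE x in restrict_space lebesgue {x. p x = \<infinity>}. F x \<le> 0"
      by (simp add: AE_restrict_space_iff)
  qed
  then have "esssup (restrict_space lebesgue {x. p x = \<infinity>}) F = 0" by simp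
  moreover have "(\<integral>\<^sup>+x\<in>{x. p x \<noteq> \<infinity>}. epowr (F x / ennreal l) (enn2real (p x)) \<partial>lebesgue) \<le> modular p (\<lambda>x. F x / ennreal l)"
    unfolding modular_def by (intro nn_integral_mono) (auto simp: indicator_def)
  ultimately show "(\<integral>\<^sup>+x\<in>{x. p x \<noteq> \<infinity>}. epowr (F x / ennreal l) (enn2real (p x)) \<partial>lebesgue)
       + inverse (ennreal l) * esssup (restrict_space lebesgue {x. p x = \<infinity>}) F \<le> 1"
    using mod by simp
qed

lemma modular_le_if_var_norm_less:
  assumes "var_norm p F < ennreal L"
  shows "modular p (\<lambda>x. F x / ennreal L) \<le> 1"
proof -
  have "modular p (\<lambda>x. F x / ennreal L) \<le> (\<integral>\<^sup>+x\<in>{x. p x \<noteq> \<infinity>}. epowr (F x / ennreal L) (enn2real (p x)) \<partial>lebesgue)"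
    unfolding modular_def
  proof (rule nn_integral_mono_AE)
    show "AE x in lebesgue. epowr (F x / ennreal L) (enn2real (p x))
      \<le> epowr (F x / ennreal L) (enn2real (p x)) * indicator {x. p x \<noteq> \<infinity>} x"
      using finite_AE by eventually_elim simp
  qed
  then show ?thesis using var_norm_lessD[OF assms] by simp
qed

lemma modular_mono_AE:
  assumes "AE x in lebesgue. F x \<le> G x"
  shows "modular p F \<le> modular p G"
  unfolding modular_def using assms
  by (intro nn_integral_mono_AE) (auto elim!: eventually_mono intro!: epowr_mono)

lemma var_norm_mono_AE:
  assumes F: "F \<in> borel_measurable lebesgue" and le: "AE x in lebesgue. F x \<le> G x"
  shows "var_norm p F \<le> var_norm p G"
proof (rule ennreal_le_if_less_imp_le)
  fix L :: real assume L: "0 < L" "var_norm p G < ennreal L"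
  have "AE x in lebesgue. F x / ennreal L \<le> G x / ennreal L"
    using le by eventually_elim (rule divide_right_mono_ennreal)
  then have "modular p (\<lambda>x. F x / ennreal L) \<le> modular p (\<lambda>x. G x / ennreal L)"
    by (rule modular_mono_AE)
  also have "\<dots> \<le> 1" by (rule modular_le_if_var_norm_less[OF L(2)])
  finally show "var_norm p F \<le> ennreal L"
    using F L by (intro var_norm_le_if_modular_le) auto
qed

lemma var_norm_cmult_less_top:
  assumes [measurable]: "F \<in> borel_measurable lebesgue" and c: "0 < c" and fin: "var_norm p F < \<infinity>"
  shows "var_norm p (\<lambda>x. ennreal c * F x) < \<infinity>"
proof -
  obtain l where l: "var_norm p F = ennreal l" "0 \<le> l" using fin by (cases "var_norm p F") auto
  define L where "L = l + 1"
  have L: "0 < L" "var_norm p F < ennreal L" using l by (auto simp: L_def ennreal_lessI simp del: ennreal_plus)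
  have eq: "ennreal c * F x / ennreal (c * L) = F x / ennreal L" for x
  proof -
    have "inverse (ennreal (c * L)) = ennreal (inverse c) * inverse (ennreal L)"
      using c L by (simp add: inverse_ennreal inverse_mult_distrib flip: ennreal_mult)
    then have "ennreal c * F x / ennreal (c * L) = (ennreal c * ennreal (inverse c)) * (F x * inverse (ennreal L))"
      by (simp add: divide_ennreal_def mult_ac)
    also have "ennreal c * ennreal (inverse c) = 1"
      using c by (simp flip: ennreal_mult)
    finally show ?thesis by (simp add: divide_ennreal_def)
  qed
  have "var_norm p (\<lambda>x. ennreal c * F x) \<le> ennreal (c * L)"
    using c L modular_le_if_var_norm_less[OF L(2)] by (intro var_norm_le_if_modular_le) (auto simp: eq)
  then show ?thesis by (rule le_less_trans) simp
qed

text \<open>F + G is at most L + L' times the larger of F/L and G/L'. The extra 1/2 in the scale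
  comes out of the power as a factor of at most 1/2, because the exponent is at least 1. This
  replaces convexity at the cost of a constant 2 in the triangle inequality.\<close>

lemma modular_add_halves:
  assumes [measurable]: "F \<in> borel_measurable lebesgue" "G \<in> borel_measurable lebesgue"
    and L: "0 < L" "0 < L'"
  shows "modular p (\<lambda>x. (F x + G x) / ennreal (2 * (L + L')))
    \<le> ennreal (1 / 2) * (modular p (\<lambda>x. F x / ennreal L) + modular p (\<lambda>x. G x / ennreal L'))"
proof -
  have "modular p (\<lambda>x. (F x + G x) / ennreal (2 * (L + L')))
    \<le> (\<integral>\<^sup>+x. ennreal (1 / 2) * (epowr (F x / ennreal L) (enn2real (p x)) + epowr (G x / ennreal L') (enn2real (p x))) \<partial>lebesgue)"
    unfolding modular_def
  proof (rule nn_integral_mono_AE)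
    show "AE x in lebesgue. epowr ((F x + G x) / ennreal (2 * (L + L'))) (enn2real (p x))
      \<le> ennreal (1 / 2) * (epowr (F x / ennreal L) (enn2real (p x)) + epowr (G x / ennreal L') (enn2real (p x)))"
      using real_range
    proof eventually_elim
      case (elim x)
      then have r: "1 \<le> enn2real (p x)" using a by simp
      define m where "m = max (F x / ennreal L) (G x / ennreal L')"
      have "F x \<le> m * ennreal L" "G x \<le> m * ennreal L'"
        using L by (auto simp: m_def simp flip: ennreal_divide_le_iff_le_mult)
      then have "F x + G x \<le> m * ennreal L + m * ennreal L'" by (rule add_mono)
      also have "\<dots> = m * ennreal (L + L')" using L by (simp add: distrib_left)
      also have "\<dots> = ennreal (1 / 2) * m * ennreal (2 * (L + L'))"
      proof -
        have "ennreal (1 / 2) * ennreal (2 * (L + L')) = ennreal (1 / 2 * (2 * (L + L')))"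
          using L by (intro ennreal_mult[symmetric]) auto
        also have "1 / 2 * (2 * (L + L')) = L + L'" by simp
        finally have eq: "ennreal (1 / 2) * ennreal (2 * (L + L')) = ennreal (L + L')" .
        have "ennreal (1 / 2) * m * ennreal (2 * (L + L')) = m * (ennreal (1 / 2) * ennreal (2 * (L + L')))"
          by (simp only: mult_ac)
        then show ?thesis unfolding eq by simp
      qed
      finally have "(F x + G x) / ennreal (2 * (L + L')) \<le> ennreal (1 / 2) * m"
        using L by (subst ennreal_divide_le_iff_le_mult) auto
      then have "epowr ((F x + G x) / ennreal (2 * (L + L'))) (enn2real (p x)) \<le> epowr (ennreal (1 / 2) * m) (enn2real (p x))"
        by (intro epowr_mono) auto
      also have "\<dots> \<le> ennreal (1 / 2) * epowr m (enn2real (p x))"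
        using r by (intro epowr_scale_le) auto
      also have "epowr m (enn2real (p x)) \<le> epowr (F x / ennreal L) (enn2real (p x)) + epowr (G x / ennreal L') (enn2real (p x))"
        by (auto simp: m_def max_def add_increasing add_increasing2)
      finally show ?case by (simp add: mult_left_mono)
    qed
  qed
  also have "\<dots> = ennreal (1 / 2) * (modular p (\<lambda>x. F x / ennreal L) + modular p (\<lambda>x. G x / ennreal L'))"
    unfolding modular_def by (subst nn_integral_cmult, measurable) (subst nn_integral_add, measurable)
  finally show ?thesis .
qed

text \<open>The constant 2 is harmless: the inequality serves limits, finiteness and bounds up to a
  constant.\<close>

lemma var_norm_add:
  assumes F [measurable]: "F \<in> borel_measurable lebesgue" and G [measurable]: "G \<in> borel_measurable lebesgue"
  shows "var_norm p (\<lambda>x. F x + G x) \<le> 2 * (var_norm p F + var_norm p G)"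
proof (cases "var_norm p F = \<infinity> \<or> var_norm p G = \<infinity>")
  case True
  then show ?thesis by (auto simp: ennreal_mult_top)
next
  case False
  then obtain l l' where l: "var_norm p F = ennreal l" "0 \<le> l" "var_norm p G = ennreal l'" "0 \<le> l'"
    by (cases "var_norm p F"; cases "var_norm p G") auto
  have "var_norm p (\<lambda>x. F x + G x) \<le> ennreal (2 * (l + l'))"
  proof (rule ennreal_le_epsilon)
    fix e :: real assume e: "0 < e"
    define L where "L = l + e / 4"
    define L' where "L' = l' + e / 4"
    have L: "0 < L" "0 < L'" using l e by (auto simp: L_def L'_def)
    have "var_norm p F < ennreal L" "var_norm p G < ennreal L'"
      using l e by (auto simp: L_def L'_def ennreal_lessI simp del: ennreal_plus)
    then have m: "modular p (\<lambda>x. F x / ennreal L) \<le> 1" "modular p (\<lambda>x. G x / ennreal L') \<le> 1"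
      by (auto intro: modular_le_if_var_norm_less)
    have "modular p (\<lambda>x. (F x + G x) / ennreal (2 * (L + L'))) \<le> ennreal (1 / 2) * (1 + 1)"
      using m by (intro order_trans[OF modular_add_halves[OF F G L]] mult_left_mono add_mono) auto
    also have "\<dots> = ennreal (1 / 2) * ennreal 2" by (simp add: one_add_one)
    also have "\<dots> = ennreal (1 / 2 * 2)" by (intro ennreal_mult[symmetric]) auto
    finally have "var_norm p (\<lambda>x. F x + G x) \<le> ennreal (2 * (L + L'))"
      using L by (intro var_norm_le_if_modular_le) auto
    also have "2 * (L + L') = 2 * (l + l') + e" by (simp add: L_def L'_def)
    also have "ennreal (2 * (l + l') + e) = ennreal (2 * (l + l')) + ennreal e"
      using l e by (intro ennreal_plus) auto
    finally show "var_norm p (\<lambda>x. F x + G x) \<le> ennreal (2 * (l + l')) + ennreal e" .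
  qed
  then show ?thesis using l by (simp add: ennreal_mult)
qed

lemma conj_real:
  "AE x in lebesgue. enn2real (conj_exponent p x) = enn2real (p x) / (enn2real (p x) - 1) \<and>
    conj_exponent p x = ennreal (enn2real (p x) / (enn2real (p x) - 1))"
  using real_range
proof eventually_elim
  case (elim x)
  then have "conj_exponent p x = ennreal (enn2real (p x) / (enn2real (p x) - 1))"
    using a by (intro conj_exponent_ennreal) auto
  then show ?case using elim a by simp
qed

text \<open>r/(r-1) decreases in r, so the two bounds change places.\<close>

lemma nice_exponent_conj: "nice_exponent (conj_exponent p) (b / (b - 1)) (a / (a - 1))"
proof
  have "(\<lambda>x. inverse (1 - inverse (p x))) \<in> borel_measurable lebesgue" by measurable
  then show "conj_exponent p \<in> borel_measurable lebesgue"
    by (simp add: conj_exponent_def[abs_def])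
  show "1 < b / (b - 1)" using b by (simp add: field_simps)
  show "AE x in lebesgue. ennreal (b / (b - 1)) \<le> conj_exponent p x \<and> conj_exponent p x \<le> ennreal (a / (a - 1))"
    using real_range conj_real
  proof eventually_elim
    case (elim x)
    define r where "r = enn2real (p x)"
    have r: "a \<le> r" "r \<le> b" using elim by (auto simp: r_def)
    have "b / (b - 1) \<le> r / (r - 1)" "r / (r - 1) \<le> a / (a - 1)"
      using r a by (auto simp: field_simps)
    then show ?case using elim by (simp add: r_def ennreal_leI)
  qed
qed

text \<open>Young's inequality after division by scales slightly above the norms. Letting the excess
  tend to 0 includes functions of norm 0.\<close>

lemma hoelder:
  assumes [measurable]: "F \<in> borel_measurable lebesgue" "G \<in> borel_measurable lebesgue"
    and fin: "var_norm p F < \<infinity>" "var_norm (conj_exponent p) G < \<infinity>"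
  shows "(\<integral>\<^sup>+x. F x * G x \<partial>lebesgue) \<le> 2 * var_norm p F * var_norm (conj_exponent p) G"
proof -
  interpret conj: nice_exponent "conj_exponent p" "b / (b - 1)" "a / (a - 1)"
    by (rule nice_exponent_conj)
  obtain l l' where l: "var_norm p F = ennreal l" "0 \<le> l" "var_norm (conj_exponent p) G = ennreal l'" "0 \<le> l'"
    using fin by (cases "var_norm p F"; cases "var_norm (conj_exponent p) G") auto
  have le: "(\<integral>\<^sup>+x. F x * G x \<partial>lebesgue) \<le> ennreal (2 * (l + e) * (l' + e))" if e: "0 < e" for e
  proof -
    define L where "L = l + e"
    define L' where "L' = l' + e"
    have L: "0 < L" "0 < L'" using l e by (auto simp: L_def L'_def)
    have "var_norm p F < ennreal L" "var_norm (conj_exponent p) G < ennreal L'"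
      using l e by (auto simp: L_def L'_def ennreal_lessI simp del: ennreal_plus)
    then have m: "modular p (\<lambda>x. F x / ennreal L) \<le> 1" "modular (conj_exponent p) (\<lambda>x. G x / ennreal L') \<le> 1"
      by (auto intro: modular_le_if_var_norm_less conj.modular_le_if_var_norm_less)
    have "(\<integral>\<^sup>+x. F x * G x \<partial>lebesgue) \<le> (\<integral>\<^sup>+x. ennreal (L * L') *
      (epowr (F x / ennreal L) (enn2real (p x)) + epowr (G x / ennreal L') (enn2real (conj_exponent p x))) \<partial>lebesgue)"
    proof (rule nn_integral_mono_AE)
      show "AE x in lebesgue. F x * G x \<le> ennreal (L * L') *
        (epowr (F x / ennreal L) (enn2real (p x)) + epowr (G x / ennreal L') (enn2real (conj_exponent p x)))"
        using real_range conj_real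
      proof eventually_elim
        case (elim x)
        have "F x / ennreal L * ennreal L = F x" "G x / ennreal L' * ennreal L' = G x"
          using L by (auto simp: ennreal_divide_times)
        then have "F x * G x = (F x / ennreal L * ennreal L) * (G x / ennreal L' * ennreal L')" by simp
        also have "\<dots> = (ennreal L * ennreal L') * ((F x / ennreal L) * (G x / ennreal L'))" by (simp only: mult_ac)
        also have "ennreal L * ennreal L' = ennreal (L * L')" using L by (intro ennreal_mult[symmetric]) auto
        also have "(F x / ennreal L) * (G x / ennreal L') \<le> epowr (F x / ennreal L) (enn2real (p x)) + epowr (G x / ennreal L') (enn2real (conj_exponent p x))"
          using ennreal_mult_le_epowr_add[of "enn2real (p x)"] elim a by simp
        finally show ?case by (simp add: mult_left_mono)
      qed
    qed
    also have "\<dots> = ennreal (L * L') * (modular p (\<lambda>x. F x / ennreal L) + modular (conj_exponent p) (\<lambda>x. G x / ennreal L'))"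
      unfolding modular_def by (subst nn_integral_cmult, measurable) (subst nn_integral_add, measurable)
    also have "\<dots> \<le> ennreal (L * L') * (1 + 1)"
      by (intro mult_left_mono add_mono m) auto
    also have "\<dots> = ennreal (L * L') * ennreal 2" by simp
    also have "\<dots> = ennreal (L * L' * 2)" using L by (intro ennreal_mult[symmetric]) auto
    also have "L * L' * 2 = 2 * (l + e) * (l' + e)" by (simp add: L_def L'_def)
    finally show ?thesis .
  qed
  have "((\<lambda>e. ennreal (2 * (l + e) * (l' + e))) \<longlongrightarrow> ennreal (2 * (l + 0) * (l' + 0))) (at_right 0)"
    by (intro tendsto_ennrealI tendsto_intros)
  then have "(\<integral>\<^sup>+x. F x * G x \<partial>lebesgue) \<le> ennreal (2 * (l + 0) * (l' + 0))"
    by (rule tendsto_lowerbound) (use le in \<open>auto simp: eventually_at_filter\<close>)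
  then show ?thesis using l by (simp add: ennreal_mult)
qed

text \<open>Tests with the extremal function h^(r-1) w, truncated to be bounded with bounded
  support. If the truncated modular were some m > 1, this function would have dual norm at most
  \<open>m\<close> and yet pair with \<open>u\<close> to K m > \<Lambda> m. Finiteness of the norm
  of \<open>u\<close> is part of the conclusion.\<close>

lemma var_norm_le_by_duality:
  assumes w: "weight w" and u [measurable]: "u \<in> borel_measurable lebesgue" and u0: "\<And>x. 0 \<le> u x" and \<Lambda>: "0 \<le> \<Lambda>"
    and dual: "\<And>g B R. g \<in> borel_measurable lebesgue \<Longrightarrow> (\<And>y. 0 \<le> g y) \<Longrightarrow> (\<And>y. g y \<le> B) \<Longrightarrow>
      (\<And>y. g y \<noteq> 0 \<Longrightarrow> norm y < R) \<Longrightarrow> var_norm (conj_exponent p) (\<lambda>x. ennreal (g x) * inverse (w x)) < \<infinity> \<Longrightarrow>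
      (\<integral>\<^sup>+y. ennreal (u y * g y) \<partial>lebesgue) \<le> ennreal \<Lambda> * var_norm (conj_exponent p) (\<lambda>x. ennreal (g x) * inverse (w x))"
  shows "var_norm p (\<lambda>x. ennreal (u x) * w x) \<le> ennreal \<Lambda>"
proof (rule ennreal_le_epsilon)
  interpret conj: nice_exponent "conj_exponent p" "b / (b - 1)" "a / (a - 1)"
    by (rule nice_exponent_conj)
  fix e :: real assume e: "0 < e"
  \<comment> \<open>A level strictly above \<Lambda> is what the contradiction needs; the excess
    \<open>e\<close> is arbitrary.\<close>
  define K where "K = \<Lambda> + e"
  have K: "0 < K" "\<Lambda> < K" using \<Lambda> e by (auto simp: K_def)
  have wm [measurable]: "w \<in> borel_measurable lebesgue" using w by (simp add: weight_def)
  define W where "W x = enn2real (w x)" for x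
  have W [measurable]: "W \<in> borel_measurable lebesgue" unfolding W_def by measurable
  define r where "r x = enn2real (p x)" for x
  have r [measurable]: "r \<in> borel_measurable lebesgue" unfolding r_def by measurable
  define h where "h x = u x * W x / K" for x
  have h [measurable]: "h \<in> borel_measurable lebesgue" unfolding h_def by measurable
  have h0: "0 \<le> h x" for x using u0 K by (simp add: h_def W_def)
  define r' where "r' x = enn2real (conj_exponent p x)" for x
  have r' [measurable]: "r' \<in> borel_measurable lebesgue" unfolding r'_def by measurable
  \<comment> \<open>Besides truncating, \<open>X k\<close> collects the almost everywhere properties
    of \<open>w\<close>, of \<open>p\<close> and of its conjugate, so that computations on it hold
    at every point. The sets increase to almost all of the space.\<close>
  define X where "X k = {x \<in> space lebesgue. norm x < real k \<and> h x \<le> real k \<and> W x \<le> real k \<and> 0 < W x \<and> w x = ennreal (W x) \<and>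
    a \<le> r x \<and> r x \<le> b \<and> p x = ennreal (r x) \<and> r' x = r x / (r x - 1)}" for k :: nat
  have X [measurable]: "X k \<in> sets lebesgue" for k unfolding X_def by measurable
  define \<phi> where "\<phi> k x = h x powr r x * indicator (X k) x" for k x
  have \<phi> [measurable]: "\<phi> k \<in> borel_measurable lebesgue" for k unfolding \<phi>_def by measurable
  have \<phi>1: "(\<integral>\<^sup>+x. ennreal (\<phi> k x) \<partial>lebesgue) \<le> 1" for k
  proof (rule ccontr)
    assume "\<not> (\<integral>\<^sup>+x. ennreal (\<phi> k x) \<partial>lebesgue) \<le> 1"
    then have big: "1 < (\<integral>\<^sup>+x. ennreal (\<phi> k x) \<partial>lebesgue)" by simp
    define c where "c = max 1 (real k)"
    have c: "1 \<le> c" by (simp add: c_def)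
    have pow: "h x powr s \<le> c powr b" if "x \<in> X k" "0 \<le> s" "s \<le> b" for x s
    proof -
      have "h x powr s \<le> c powr s" using that h0 by (intro powr_mono2) (auto simp: X_def c_def)
      also have "\<dots> \<le> c powr b" using that c by (intro powr_mono) auto
      finally show ?thesis .
    qed
    have "(\<integral>\<^sup>+x. ennreal (\<phi> k x) \<partial>lebesgue) \<le> (\<integral>\<^sup>+x. ennreal (c powr b) * indicator (ball (0::'a) (real k)) x \<partial>lebesgue)"
    proof (intro nn_integral_mono)
      fix x
      show "ennreal (\<phi> k x) \<le> ennreal (c powr b) * indicator (ball (0::'a) (real k)) x"
      proof (cases "x \<in> X k")
        case True
        then have "\<phi> k x \<le> c powr b" using pow[OF True, of "r x"] a by (auto simp: \<phi>_def X_def)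
        moreover have "x \<in> ball 0 (real k)" using True by (simp add: X_def)
        ultimately show ?thesis by (simp add: ennreal_leI)
      qed (simp add: \<phi>_def)
    qed
    also have "\<dots> < \<infinity>"
      by (simp add: nn_integral_cmult_indicator emeasure_lebesgue_ball ennreal_mult_less_top)
    finally obtain m where m: "(\<integral>\<^sup>+x. ennreal (\<phi> k x) \<partial>lebesgue) = ennreal m" "0 \<le> m"
      by (cases "\<integral>\<^sup>+x. ennreal (\<phi> k x) \<partial>lebesgue") auto
    have m1: "1 < m" using big m by simp
    define g where "g x = h x powr (r x - 1) * W x * indicator (X k) x" for x
    have g [measurable]: "g \<in> borel_measurable lebesgue" unfolding g_def by measurable
    have g0: "0 \<le> g x" for x by (auto simp: g_def W_def)
    have "g x \<le> c powr b * real k" for x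
    proof (cases "x \<in> X k")
      case True
      then show ?thesis
        using pow[OF True, of "r x - 1"] a unfolding g_def by (auto simp: X_def intro!: mult_mono)
    qed (simp add: g_def)
    moreover have "norm x < real k" if "g x \<noteq> 0" for x
      using that by (auto simp: g_def X_def indicator_def split: if_splits)
    moreover have norm_g: "var_norm (conj_exponent p) (\<lambda>x. ennreal (g x) * inverse (w x)) \<le> ennreal m"
    proof (rule conj.var_norm_le_if_modular_le)
      have "modular (conj_exponent p) (\<lambda>x. ennreal (g x) * inverse (w x) / ennreal m) \<le> (\<integral>\<^sup>+x. ennreal (1 / m) * ennreal (\<phi> k x) \<partial>lebesgue)"
        unfolding modular_def r'_def[symmetric]
      proof (intro nn_integral_mono)
        fix x
        show "epowr (ennreal (g x) * inverse (w x) / ennreal m) (r' x) \<le> ennreal (1 / m) * ennreal (\<phi> k x)"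
        proof (cases "x \<in> X k")
          case True
          then have x: "0 < W x" "w x = ennreal (W x)" "1 < r x" "r' x = r x / (r x - 1)" using a by (auto simp: X_def)
          have r'1: "1 \<le> r' x" unfolding x(4) using x(3) by (simp add: field_simps)
          have "ennreal (g x) * inverse (w x) / ennreal m = ennreal (g x / W x) / ennreal m"
            using x g0[of x] by (simp add: inverse_ennreal divide_inverse flip: ennreal_mult)
          also have "\<dots> = ennreal (g x / W x / m)"
            using x g0[of x] m1 by (intro divide_ennreal) auto
          also have "g x / W x / m = h x powr (r x - 1) * (1 / m)"
            using x True by (simp add: g_def)
          finally have "epowr (ennreal (g x) * inverse (w x) / ennreal m) (r' x) = ennreal ((h x powr (r x - 1) * (1 / m)) powr r' x)"
            using m1 by (simp add: epowr_ennreal)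
          also have "(h x powr (r x - 1) * (1 / m)) powr r' x = (h x powr (r x - 1)) powr r' x * (1 / m) powr r' x"
            by (rule powr_mult)
          also have "(h x powr (r x - 1)) powr r' x = h x powr r x"
            using x by (simp add: powr_powr)
          \<comment> \<open>Here m > 1 is used: the conjugate exponent is at least 1, so the
            normalisation gains the factor 1/m that brings the dual modular down to 1.\<close>
          also have "(1 / m) powr r' x \<le> (1 / m) powr 1"
            using m1 r'1 by (intro powr_mono') auto
          finally have "epowr (ennreal (g x) * inverse (w x) / ennreal m) (r' x) \<le> ennreal (h x powr r x * (1 / m))"
            using m1 by (auto simp: ennreal_leI mult_left_mono)
          then show ?thesis
            using True m1 by (simp add: \<phi>_def mult.commute flip: ennreal_mult)
        next
          case False
          then show ?thesis by (simp add: g_def)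
        qed
      qed
      also have "\<dots> = ennreal (1 / m) * ennreal m"
        by (simp add: nn_integral_cmult m)
      also have "\<dots> = 1" using m1 by (simp flip: ennreal_mult)
      finally show "modular (conj_exponent p) (\<lambda>x. ennreal (g x) * inverse (w x) / ennreal m) \<le> 1" .
    qed (use m1 in auto)
    moreover from norm_g have "var_norm (conj_exponent p) (\<lambda>x. ennreal (g x) * inverse (w x)) < \<infinity>"
      by (rule le_less_trans) simp
    ultimately have "(\<integral>\<^sup>+y. ennreal (u y * g y) \<partial>lebesgue) \<le> ennreal \<Lambda> * var_norm (conj_exponent p) (\<lambda>x. ennreal (g x) * inverse (w x))"
      using g g0 by (intro dual)
    also have "\<dots> \<le> ennreal \<Lambda> * ennreal m" by (intro mult_left_mono norm_g) auto
    also have "(\<integral>\<^sup>+y. ennreal (u y * g y) \<partial>lebesgue) = (\<integral>\<^sup>+y. ennreal K * ennreal (\<phi> k y) \<partial>lebesgue)"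
    proof (intro nn_integral_cong)
      fix y
      have "u y * g y = K * \<phi> k y"
      proof (cases "y \<in> X k")
        case True
        have "u y * g y = K * (h y powr (r y - 1) * h y)"
          using K True by (simp add: g_def h_def)
        also have "h y powr (r y - 1) * h y = h y powr r y"
          using h0[of y] by (cases "h y = 0") (auto simp: powr_diff)
        finally show ?thesis using True by (simp add: \<phi>_def)
      qed (simp add: g_def \<phi>_def)
      then show "ennreal (u y * g y) = ennreal K * ennreal (\<phi> k y)"
        using K by (simp add: ennreal_mult')
    qed
    also have "\<dots> = ennreal K * ennreal m"
      by (simp add: nn_integral_cmult m)
    finally have "K * m \<le> \<Lambda> * m" using K \<Lambda> m by (simp flip: ennreal_mult)
    then show False using m1 K by simp
  qed
  have "modular p (\<lambda>x. ennreal (u x) * w x / ennreal K) \<le> (\<integral>\<^sup>+x. (SUP k. ennreal (\<phi> k x)) \<partial>lebesgue)"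
    unfolding modular_def r_def[symmetric]
  proof (rule nn_integral_mono_AE)
    have "AE x in lebesgue. 0 < w x \<and> w x < \<infinity>" using w by (simp add: weight_def)
    then show "AE x in lebesgue. epowr (ennreal (u x) * w x / ennreal K) (r x) \<le> (SUP k. ennreal (\<phi> k x))"
      using real_range conj_real
    proof eventually_elim
      case (elim x)
      have x: "w x = ennreal (W x)" "0 < W x"
        using elim(1) by (auto simp: W_def less_top enn2real_positive_iff)
      obtain k :: nat where k: "norm x + h x + W x < real k" using reals_Archimedean2 by blast
      have "norm x < real k" "h x \<le> real k" "W x \<le> real k"
        using k x(2) h0[of x] norm_ge_zero[of x] by linarith+
      then have "x \<in> X k"
        using x elim by (auto simp: X_def r_def r'_def)
      then have "\<phi> k x = h x powr r x" by (simp add: \<phi>_def)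
      have "ennreal (u x) * w x / ennreal K = ennreal (u x * W x) / ennreal K"
        using x u0[of x] by (simp flip: ennreal_mult)
      also have "\<dots> = ennreal (h x)"
        unfolding h_def using x u0[of x] K by (intro divide_ennreal) auto
      finally have "epowr (ennreal (u x) * w x / ennreal K) (r x) = ennreal (\<phi> k x)"
        using h0[of x] \<open>\<phi> k x = h x powr r x\<close> by (simp add: epowr_ennreal)
      also have "\<dots> \<le> (SUP k. ennreal (\<phi> k x))" by (rule SUP_upper) simp
      finally show ?case .
    qed
  qed
  also have "\<dots> = (SUP k. \<integral>\<^sup>+x. ennreal (\<phi> k x) \<partial>lebesgue)"
  proof (rule nn_integral_monotone_convergence_SUP)
    show "incseq (\<lambda>k x. ennreal (\<phi> k x))"
    proof (rule incseq_SucI, rule le_funI, rule ennreal_leI)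
      fix k x
      show "\<phi> k x \<le> \<phi> (Suc k) x" by (auto simp: \<phi>_def X_def indicator_def)
    qed
  qed measurable
  also have "\<dots> \<le> 1" by (intro SUP_least \<phi>1)
  finally have "var_norm p (\<lambda>x. ennreal (u x) * w x) \<le> ennreal K"
    using K by (intro var_norm_le_if_modular_le) auto
  then show "var_norm p (\<lambda>x. ennreal (u x) * w x) \<le> ennreal \<Lambda> + ennreal e"
    using \<Lambda> e by (simp add: K_def)
qed

end

section \<open>The weighted space: density and completeness\<close>

lemma wnorm_minus_commute: "wnorm p w (\<lambda>x. f x - g x) = wnorm p w (\<lambda>x. g x - f x)"
  by (simp add: wnorm_def norm_minus_commute)

context nice_exponent
begin

lemma wnorm_mono_AE:
  assumes [measurable]: "weight w" "f \<in> borel_measurable lebesgue" and le: "AE x in lebesgue. norm (f x) \<le> norm (g x)"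
  shows "wnorm p w f \<le> wnorm p w g"
proof -
  have [measurable]: "w \<in> borel_measurable lebesgue" using assms(1) by (simp add: weight_def)
  show ?thesis
    unfolding wnorm_def
  proof (rule var_norm_mono_AE)
    show "AE x in lebesgue. ennreal (norm (f x)) * w x \<le> ennreal (norm (g x)) * w x"
      using le by eventually_elim (intro mult_right_mono ennreal_leI, auto)
  qed measurable
qed

lemma wnorm_cong_AE:
  assumes "weight w" "f \<in> borel_measurable lebesgue" "g \<in> borel_measurable lebesgue" "AE x in lebesgue. f x = g x"
  shows "wnorm p w f = wnorm p w g"
  using assms by (intro antisym wnorm_mono_AE) (auto elim: eventually_mono)

lemma wnorm_add:
  assumes w: "weight w" and [measurable]: "f \<in> borel_measurable lebesgue" "g \<in> borel_measurable lebesgue"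
  shows "wnorm p w (\<lambda>x. f x + g x) \<le> 2 * (wnorm p w f + wnorm p w g)"
proof -
  have [measurable]: "w \<in> borel_measurable lebesgue" using w by (simp add: weight_def)
  have "wnorm p w (\<lambda>x. f x + g x) \<le> var_norm p (\<lambda>x. ennreal (norm (f x)) * w x + ennreal (norm (g x)) * w x)"
    unfolding wnorm_def
  proof (rule var_norm_mono_AE[OF _ AE_I2])
    fix x
    have "ennreal (norm (f x + g x)) \<le> ennreal (norm (f x)) + ennreal (norm (g x))"
      by (simp add: norm_triangle_ineq ennreal_leI flip: ennreal_plus)
    then show "ennreal (norm (f x + g x)) * w x \<le> ennreal (norm (f x)) * w x + ennreal (norm (g x)) * w x"
      by (simp add: mult_right_mono flip: distrib_right)
  qed measurable
  also have "\<dots> \<le> 2 * (wnorm p w f + wnorm p w g)"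
    unfolding wnorm_def by (intro var_norm_add) measurable
  finally show ?thesis .
qed

lemma wnorm_diff_triangle:
  assumes w: "weight w" and [measurable]: "f \<in> borel_measurable lebesgue" "g \<in> borel_measurable lebesgue" "h \<in> borel_measurable lebesgue"
  shows "wnorm p w (\<lambda>x. f x - h x) \<le> 2 * (wnorm p w (\<lambda>x. f x - g x) + wnorm p w (\<lambda>x. g x - h x))"
  using wnorm_add[OF w, of "\<lambda>x. f x - g x" "\<lambda>x. g x - h x"] by simp

text \<open>Truncation in range and in space. At each point the error is eventually 0, and
  boundedness of the exponent provides domination: changing the scale from \<open>L\<close> to
  \<open>e\<close> costs at most the constant c^b.\<close>

lemma exists_truncation_approximates:
  assumes w: "weight w" and f: "f \<in> wLp p w"
  shows "\<exists>\<phi>. approximates p w \<phi> f"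
proof -
  have fm [measurable]: "f \<in> borel_measurable lebesgue" and fin: "wnorm p w f < \<infinity>" using f by (auto simp: wLp_def)
  have wm [measurable]: "w \<in> borel_measurable lebesgue" using w by (simp add: weight_def)
  define X where "X k = {x \<in> space lebesgue. norm x \<le> real k \<and> norm (f x) \<le> real k}" for k
  have X [measurable]: "X k \<in> sets lebesgue" for k unfolding X_def by measurable
  define \<phi> where "\<phi> k x = f x * indicator (X k) x" for k x
  have \<phi>m [measurable]: "\<phi> k \<in> borel_measurable lebesgue" for k unfolding \<phi>_def by measurable
  have \<phi>L: "\<phi> k \<in> Linf_c" for k
    by (rule Linf_cI[of _ "real k" "real k"]) (auto simp: \<phi>_def X_def indicator_def)
  define d where "d k x = ennreal (norm (\<phi> k x - f x)) * w x" for k x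
  have dm [measurable]: "d k \<in> borel_measurable lebesgue" for k unfolding d_def by measurable
  obtain l where l: "wnorm p w f = ennreal l" "0 \<le> l" using fin by (cases "wnorm p w f") auto
  define L where "L = l + 1"
  have L: "0 < L" "wnorm p w f < ennreal L" using l by (auto simp: L_def ennreal_lessI simp del: ennreal_plus)
  have mod: "modular p (\<lambda>x. ennreal (norm (f x)) * w x / ennreal L) \<le> 1"
    using L(2) unfolding wnorm_def by (rule modular_le_if_var_norm_less)
  have "((\<lambda>k. var_norm p (d k)) \<longlongrightarrow> 0) sequentially"
  proof (rule tendsto_zero_ennrealI)
    fix e :: real assume e: "0 < e"
    define c where "c = max 1 (L / e)"
    have "(\<lambda>k. \<integral>\<^sup>+x. epowr (d k x / ennreal e) (enn2real (p x)) \<partial>lebesgue) \<longlonglongrightarrow> nn_integral lebesgue (\<lambda>x::'a. 0)"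
    proof (rule nn_integral_dominated_convergence)
      let ?v = "\<lambda>x. ennreal (c powr b) * epowr (ennreal (norm (f x)) * w x / ennreal L) (enn2real (p x))"
      show "AE x in lebesgue. epowr (d k x / ennreal e) (enn2real (p x)) \<le> ?v x" for k
        using real_range
      proof eventually_elim
        case (elim x)
        have "d k x \<le> ennreal (norm (f x)) * w x"
          unfolding d_def by (intro mult_right_mono ennreal_leI) (auto simp: \<phi>_def indicator_def)
        then have "d k x / ennreal e \<le> ennreal (norm (f x)) * w x / ennreal e"
          by (rule divide_right_mono_ennreal)
        also have "\<dots> = ennreal (L / e) * (ennreal (norm (f x)) * w x / ennreal L)"
        proof -
          have eq: "ennreal (L / e) * inverse (ennreal L) = inverse (ennreal e)"
            using L e by (simp add: inverse_ennreal field_simps flip: ennreal_mult)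
          have "ennreal (L / e) * (y * inverse (ennreal L)) = y * (ennreal (L / e) * inverse (ennreal L))" for y
            by (simp only: mult_ac)
          then show ?thesis unfolding divide_ennreal_def eq by simp
        qed
        finally have "epowr (d k x / ennreal e) (enn2real (p x)) \<le> epowr (ennreal (L / e) * (ennreal (norm (f x)) * w x / ennreal L)) (enn2real (p x))"
          by (intro epowr_mono) auto
        also have "\<dots> = ennreal ((L / e) powr enn2real (p x)) * epowr (ennreal (norm (f x)) * w x / ennreal L) (enn2real (p x))"
          using L e by (intro epowr_mult) auto
        also have "(L / e) powr enn2real (p x) \<le> c powr enn2real (p x)"
          using L e by (intro powr_mono2) (auto simp: c_def)
        also have "\<dots> \<le> c powr b" using elim by (intro powr_mono) (auto simp: c_def)
        finally show ?case by (simp add: mult_right_mono ennreal_leI)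
      qed
      have "(\<integral>\<^sup>+x. ?v x \<partial>lebesgue) = ennreal (c powr b) * modular p (\<lambda>x. ennreal (norm (f x)) * w x / ennreal L)"
        unfolding modular_def by (intro nn_integral_cmult) measurable
      also have "\<dots> \<le> ennreal (c powr b) * 1" by (intro mult_left_mono mod) auto
      also have "\<dots> < \<infinity>" by simp
      finally show "(\<integral>\<^sup>+x. ?v x \<partial>lebesgue) < \<infinity>" .
      show "AE x in lebesgue. (\<lambda>k. epowr (d k x / ennreal e) (enn2real (p x))) \<longlonglongrightarrow> 0"
      proof (rule AE_I2)
        fix x
        obtain k0 :: nat where k0: "max (norm x) (norm (f x)) < real k0" using reals_Archimedean2 by blast
        have "eventually (\<lambda>k. epowr (d k x / ennreal e) (enn2real (p x)) = 0) sequentially"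
          using eventually_ge_at_top[of k0]
        proof eventually_elim
          case (elim k)
          then have "x \<in> X k" using k0 by (auto simp: X_def)
          then show ?case by (simp add: d_def \<phi>_def)
        qed
        then show "(\<lambda>k. epowr (d k x / ennreal e) (enn2real (p x))) \<longlonglongrightarrow> 0"
          by (rule tendsto_eventually)
      qed
    qed measurable
    then have "(\<lambda>k. modular p (\<lambda>x. d k x / ennreal e)) \<longlonglongrightarrow> 0"
      by (simp add: modular_def)
    then have "eventually (\<lambda>k. modular p (\<lambda>x. d k x / ennreal e) < 1) sequentially"
      by (rule order_tendstoD(2)) simp
    then show "eventually (\<lambda>k. var_norm p (d k) \<le> ennreal e) sequentially"
    proof eventually_elim
      case (elim k)
      then show ?case using e by (intro var_norm_le_if_modular_le) auto
    qed
  qed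
  then have "approximates p w \<phi> f"
    using \<phi>L by (simp add: approximates_def wnorm_def d_def[abs_def])
  then show ?thesis by blast
qed

text \<open>Passing from the scale 4^(-k) to 2^(-k) gains a factor 2^(-k) in the modular, so the
  modulars are summable. Their integrands tend to 0 almost everywhere, which eventually bounds the
  increments by 2^(-k) / w(x).\<close>

lemma AE_convergent_if_fast_cauchy:
  assumes w: "weight w" and G [measurable]: "\<And>k. G k \<in> borel_measurable lebesgue"
    and fast: "\<And>k::nat. wnorm p w (\<lambda>x. G (Suc k) x - G k x) < ennreal ((1 / 4) ^ k)"
  shows "AE x in lebesgue. convergent (\<lambda>k. G k x :: complex)"
proof -
  have wm [measurable]: "w \<in> borel_measurable lebesgue" using w by (simp add: weight_def)
  define d where "d k x = ennreal (norm (G (Suc k) x - G k x)) * w x" for k x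
  have dm [measurable]: "d k \<in> borel_measurable lebesgue" for k unfolding d_def by measurable
  define u where "u k x = epowr (d k x / ennreal ((1 / 2) ^ k)) (enn2real (p x))" for k :: nat and x
  have um [measurable]: "u k \<in> borel_measurable lebesgue" for k unfolding u_def by measurable
  have "(\<integral>\<^sup>+x. u k x \<partial>lebesgue) \<le> ennreal ((1 / 2) ^ k)" for k
  proof -
    have m: "modular p (\<lambda>x. d k x / ennreal ((1 / 4) ^ k)) \<le> 1"
      using fast[of k] unfolding wnorm_def d_def by (rule modular_le_if_var_norm_less)
    have "(\<integral>\<^sup>+x. u k x \<partial>lebesgue) \<le> (\<integral>\<^sup>+x. ennreal ((1 / 2) ^ k) * epowr (d k x / ennreal ((1 / 4) ^ k)) (enn2real (p x)) \<partial>lebesgue)"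
    proof (rule nn_integral_mono_AE)
      show "AE x in lebesgue. u k x \<le> ennreal ((1 / 2) ^ k) * epowr (d k x / ennreal ((1 / 4) ^ k)) (enn2real (p x))"
        using real_range
      proof eventually_elim
        case (elim x)
        have "inverse (ennreal ((1 / 2) ^ k)) = ennreal ((1 / 2) ^ k) * inverse (ennreal ((1 / 4) ^ k))"
        proof -
          have "inverse ((1 / 2::real) ^ k) = (1 / 2) ^ k * inverse ((1 / 4) ^ k)"
            by (simp add: power_inverse[symmetric] power_mult_distrib[symmetric] flip: power_inverse)
          then show ?thesis by (simp add: inverse_ennreal flip: ennreal_mult)
        qed
        then have "d k x / ennreal ((1 / 2) ^ k) = ennreal ((1 / 2) ^ k) * (d k x / ennreal ((1 / 4) ^ k))"
          by (simp add: divide_ennreal_def mult_ac)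
        then show ?case
          unfolding u_def using elim a by (auto intro!: epowr_scale_le simp: power_le_one)
      qed
    qed
    also have "\<dots> = ennreal ((1 / 2) ^ k) * modular p (\<lambda>x. d k x / ennreal ((1 / 4) ^ k))"
      unfolding modular_def by (intro nn_integral_cmult) measurable
    also have "\<dots> \<le> ennreal ((1 / 2) ^ k) * 1" by (intro mult_left_mono m) auto
    finally show ?thesis by simp
  qed
  then have "(\<Sum>k. \<integral>\<^sup>+x. u k x \<partial>lebesgue) \<le> (\<Sum>k. ennreal ((1 / 2) ^ k))"
    by (intro suminf_le summableI)
  also have "\<dots> = ennreal 2"
    using geometric_sums[of "1 / 2::real"] by (intro suminf_ennreal_eq) auto
  also have "\<dots> < \<infinity>" by simp
  finally have "(\<integral>\<^sup>+x. (\<Sum>k. u k x) \<partial>lebesgue) < \<infinity>"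
    by (subst nn_integral_suminf) auto
  then have "AE x in lebesgue. (\<Sum>k. u k x) \<noteq> \<infinity>"
    by (intro nn_integral_noteq_infinite) auto
  moreover have "AE x in lebesgue. 0 < w x \<and> w x < \<infinity>" using w by (simp add: weight_def)
  ultimately show ?thesis
  proof eventually_elim
    case (elim x)
    have le: "u k x \<le> (\<Sum>k. u k x)" for k
      using sum_le_suminf[of "\<lambda>k. u k x" "{k}"] by auto
    have fin: "u k x = ennreal (enn2real (u k x))" for k
      using le[of k] elim(1) by (metis ennreal_enn2real infinity_ennreal_def less_top neq_top_trans)
    have "summable (\<lambda>k. enn2real (u k x))"
    proof (rule summable_suminf_not_top)
      show "(\<Sum>k. ennreal (enn2real (u k x))) \<noteq> top" using elim(1) by (simp flip: fin)
    qed simp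
    then have ev1: "eventually (\<lambda>k. enn2real (u k x) < 1) sequentially"
      by (intro order_tendstoD(2)[OF summable_LIMSEQ_zero]) auto
    obtain W where W: "w x = ennreal W" "0 < W" using elim(2) by (cases "w x") auto
    from ev1 have ev: "eventually (\<lambda>k. norm (G (Suc k) x - G k x) \<le> 1 / W * (1 / 2) ^ k) sequentially"
    proof eventually_elim
      case (elim k)
      then have "u k x < 1" by (subst fin) (simp add: ennreal_less_one_iff)
      then have "d k x / ennreal ((1 / 2) ^ k) < 1"
        unfolding u_def by (rule less_one_if_epowr_less_one) simp
      moreover have "d k x / ennreal ((1 / 2) ^ k) = ennreal (norm (G (Suc k) x - G k x) * W / (1 / 2) ^ k)"
        using W by (simp add: d_def divide_ennreal flip: ennreal_mult)
      ultimately have "norm (G (Suc k) x - G k x) * W / (1 / 2) ^ k < 1"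
        by (simp only: ennreal_less_one_iff)
      then show ?case using W by (simp add: field_simps)
    qed
    have "summable (\<lambda>k. 1 / W * (1 / 2) ^ k)"
      by (intro summable_mult summable_geometric) auto
    then have "summable (\<lambda>k. G (Suc k) x - G k x)"
      by (rule summable_comparison_test_ev[OF ev])
    then obtain l where "(\<lambda>n. \<Sum>k<n. G (Suc k) x - G k x) \<longlonglongrightarrow> l"
      by (auto simp: summable_def sums_def)
    then have "(\<lambda>n. (G n x - G 0 x) + G 0 x) \<longlonglongrightarrow> l + G 0 x"
      using sum_lessThan_telescope[of "\<lambda>k. G k x"] by (intro tendsto_add tendsto_const) simp
    then show ?case by (auto simp: convergent_def)
  qed
qed

text \<open>The Riesz-Fischer argument: a fast subsequence converges almost everywhere, and Fatou's
  lemma for the modular transfers the Cauchy estimate to the limit.\<close>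

lemma wnorm_complete:
  assumes w: "weight w" and F [measurable]: "\<And>k. F k \<in> borel_measurable lebesgue"
    and cauchy: "\<And>e. 0 < e \<Longrightarrow> \<exists>N. \<forall>m\<ge>N. \<forall>n\<ge>N. wnorm p w (\<lambda>x. F m x - F n x) < ennreal e"
  shows "\<exists>h\<in>borel_measurable lebesgue. (\<lambda>k::nat. wnorm p w (\<lambda>x. F k x - h x)) \<longlonglongrightarrow> 0"
proof -
  have wm [measurable]: "w \<in> borel_measurable lebesgue" using w by (simp add: weight_def)
  have "\<exists>N. \<forall>m\<ge>N. \<forall>n\<ge>N. wnorm p w (\<lambda>x. F m x - F n x) < ennreal ((1 / 4) ^ k)" for k
    by (intro cauchy) simp
  then obtain N where N: "\<And>k m n. N k \<le> m \<Longrightarrow> N k \<le> n \<Longrightarrow> wnorm p w (\<lambda>x. F m x - F n x) < ennreal ((1 / 4) ^ k)"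
    by metis
  \<comment> \<open>The sum makes \<open>n\<close> monotone and at least \<open>N k\<close>; the
    summand \<open>k\<close> makes it unbounded, so that the subsequence passes every index in the
    Fatou step.\<close>
  define n where "n k = (\<Sum>i\<le>k. N i) + k" for k
  have n: "N k \<le> n k" "n k \<le> n (Suc k)" "k \<le> n k" for k
    by (auto simp: n_def intro: trans_le_add1 member_le_sum)
  define G where "G k = F (n k)" for k
  have G [measurable]: "G k \<in> borel_measurable lebesgue" for k by (simp add: G_def)
  have "AE x in lebesgue. convergent (\<lambda>k. G k x)"
  proof (rule AE_convergent_if_fast_cauchy[OF w G])
    fix k
    show "wnorm p w (\<lambda>x. G (Suc k) x - G k x) < ennreal ((1 / 4) ^ k)"
      unfolding G_def using n[of k] by (intro N) auto
  qed
  define h where "h x = lim (\<lambda>k. G k x)" for x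
  have h [measurable]: "h \<in> borel_measurable lebesgue"
    unfolding h_def by (intro borel_measurable_lim_metric) measurable
  have lim: "AE x in lebesgue. (\<lambda>k. G k x) \<longlonglongrightarrow> h x"
    using \<open>AE x in lebesgue. convergent (\<lambda>k. G k x)\<close> by eventually_elim (simp add: h_def convergent_LIMSEQ_iff)
  have "((\<lambda>k. wnorm p w (\<lambda>x. F k x - h x)) \<longlongrightarrow> 0) sequentially"
  proof (rule tendsto_zero_ennrealI)
    fix e :: real assume e: "0 < e"
    obtain M where M: "\<And>m n. M \<le> m \<Longrightarrow> M \<le> n \<Longrightarrow> wnorm p w (\<lambda>x. F m x - F n x) < ennreal e"
      using cauchy[OF e] by blast
    show "eventually (\<lambda>m. wnorm p w (\<lambda>x. F m x - h x) \<le> ennreal e) sequentially"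
      using eventually_ge_at_top[of M]
    proof eventually_elim
      case (elim m)
      define u where "u k x = epowr (ennreal (norm (F m x - G k x)) * w x / ennreal e) (enn2real (p x))" for k x
      have um [measurable]: "u k \<in> borel_measurable lebesgue" for k unfolding u_def by measurable
      have "modular p (\<lambda>x. ennreal (norm (F m x - h x)) * w x / ennreal e) \<le> (\<integral>\<^sup>+x. liminf (\<lambda>k. u k x) \<partial>lebesgue)"
        unfolding modular_def
      proof (rule nn_integral_mono_AE)
        have "AE x in lebesgue. 0 < w x \<and> w x < \<infinity>" using w by (simp add: weight_def)
        then show "AE x in lebesgue. epowr (ennreal (norm (F m x - h x)) * w x / ennreal e) (enn2real (p x)) \<le> liminf (\<lambda>k. u k x)"
          using lim real_range
        proof eventually_elim
          case (elim x)
          obtain W where W: "w x = ennreal W" "0 < W" using elim(1) by (cases "w x") auto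
          have eq: "epowr (ennreal (norm y) * w x / ennreal e) (enn2real (p x)) = ennreal ((norm y * W / e) powr enn2real (p x))" for y :: complex
            using W e by (simp add: divide_ennreal epowr_ennreal flip: ennreal_mult)
          have "((\<lambda>k. (norm (F m x - G k x) * W / e) powr enn2real (p x)) \<longlongrightarrow> (norm (F m x - h x) * W / e) powr enn2real (p x)) sequentially"
          \<comment> \<open>The base may tend to 0; a positive exponent keeps the power continuous
            there.\<close>
          proof (rule tendsto_powr')
            show "((\<lambda>k. norm (F m x - G k x) * W / e) \<longlongrightarrow> norm (F m x - h x) * W / e) sequentially"
              using elim(2) e by (intro tendsto_intros) auto
            show "norm (F m x - h x) * W / e \<noteq> 0 \<or> 0 < enn2real (p x) \<and> eventually (\<lambda>k. 0 \<le> norm (F m x - G k x) * W / e) sequentially"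
              using elim(3) a W e by auto
          qed (rule tendsto_const)
          then have "(\<lambda>k. u k x) \<longlonglongrightarrow> epowr (ennreal (norm (F m x - h x)) * w x / ennreal e) (enn2real (p x))"
            unfolding u_def eq by (rule tendsto_ennrealI)
          then show ?case by (simp add: lim_imp_Liminf)
        qed
      qed
      also have "\<dots> \<le> liminf (\<lambda>k. \<integral>\<^sup>+x. u k x \<partial>lebesgue)"
        by (intro nn_integral_liminf um)
      also have "\<dots> \<le> limsup (\<lambda>k. \<integral>\<^sup>+x. u k x \<partial>lebesgue)"
        by (intro Liminf_le_Limsup) simp
      also have "\<dots> \<le> 1"
      proof (rule Limsup_bounded)
        show "eventually (\<lambda>k. (\<integral>\<^sup>+x. u k x \<partial>lebesgue) \<le> 1) sequentially"
          using eventually_ge_at_top[of M]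
        proof eventually_elim
          case (elim k)
          then have "wnorm p w (\<lambda>x. F m x - G k x) < ennreal e"
            unfolding G_def using \<open>M \<le> m\<close> n(3)[of k] by (intro M) auto
          then show ?case
            unfolding wnorm_def u_def using modular_le_if_var_norm_less by (simp add: modular_def)
        qed
      qed
      finally show ?case
        unfolding wnorm_def using e by (intro var_norm_le_if_modular_le) auto
    qed
  qed
  then show ?thesis using h by blast
qed

text \<open>On bounded sets the maximal function of a single positive function is bounded below.\<close>

lemma Linf_c_subset_wLp:
  assumes w: "weight w" and M: "maximal_bounded p w" and f: "f \<in> Linf_c"
  shows "f \<in> wLp p w"
proof -
  have wm [measurable]: "w \<in> borel_measurable lebesgue" using w by (simp add: weight_def)
  have fm [measurable]: "f \<in> borel_measurable lebesgue" using f by (simp add: Linf_c_def)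
  obtain C where C: "\<forall>f\<in>wLp p w. var_norm p (\<lambda>x. maximal f x * w x) \<le> ennreal C * wnorm p w f"
    using M by (auto simp: maximal_bounded_def)
  \<comment> \<open>Positive almost everywhere with v w \<le> 1. Cut off to the unit ball it has
    finite norm, which provides an element of the space before any prescribed bounded function is
    known to lie in it.\<close>
  define v where "v x = min 1 (1 / enn2real (w x))" for x
  have v [measurable]: "v \<in> borel_measurable lebesgue" unfolding v_def by measurable
  have v0: "0 \<le> v x" "v x \<le> 1" for x by (auto simp: v_def)
  have v_AE: "AE x in lebesgue. 0 < v x \<and> ennreal (v x) * w x \<le> 1"
  proof -
    have "AE x in lebesgue. 0 < w x \<and> w x < \<infinity>" using w by (simp add: weight_def)
    then show ?thesis
    proof eventually_elim
      case (elim x)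
      obtain W where W: "w x = ennreal W" "0 < W" using elim by (cases "w x") auto
      have "v x * W \<le> 1" using W by (auto simp: v_def min_def field_simps)
      moreover have "0 < v x" using W by (simp add: v_def)
      ultimately show ?case using W by (simp flip: ennreal_mult)
    qed
  qed
  define f0 where "f0 x = complex_of_real (v x * indicator (ball 0 1) x)" for x
  have f0m [measurable]: "f0 \<in> borel_measurable lebesgue" unfolding f0_def by measurable
  have f0L: "f0 \<in> Linf_c"
    using v0 by (intro Linf_cI[of _ 1 1]) (auto simp: f0_def indicator_def)
  have f0W: "f0 \<in> wLp p w"
  proof -
    obtain B where B: "0 < B" "emeasure lebesgue (ball (0::'a) 1) = ennreal B"
      using emeasure_lebesgue_ball_pos[OF zero_less_one, of "0::'a"] by metis
    define l where "l = max 1 B"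
    have l: "1 \<le> l" "B \<le> l" by (auto simp: l_def)
    have "modular p (\<lambda>x. ennreal (norm (f0 x)) * w x / ennreal l) \<le> (\<integral>\<^sup>+x. ennreal (1 / l) * indicator (ball (0::'a) 1) x \<partial>lebesgue)"
      unfolding modular_def
    proof (rule nn_integral_mono_AE)
      show "AE x in lebesgue. epowr (ennreal (norm (f0 x)) * w x / ennreal l) (enn2real (p x)) \<le> ennreal (1 / l) * indicator (ball 0 1) x"
        using v_AE real_range
      proof eventually_elim
        case (elim x)
        show ?case
        proof (cases "x \<in> ball 0 1")
          case True
          then have "ennreal (norm (f0 x)) * w x / ennreal l \<le> 1 / ennreal l"
            using elim v0[of x] by (intro divide_right_mono_ennreal) (simp add: f0_def norm_mult)
          also have "\<dots> = ennreal (1 / l) * ennreal 1"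
            using l divide_ennreal[of 1 l] by simp
          finally have "epowr (ennreal (norm (f0 x)) * w x / ennreal l) (enn2real (p x)) \<le> epowr (ennreal (1 / l) * ennreal 1) (enn2real (p x))"
            by (intro epowr_mono) auto
          also have "\<dots> \<le> ennreal (1 / l) * epowr (ennreal 1) (enn2real (p x))"
            using l elim a by (intro epowr_scale_le) auto
          also have "epowr (ennreal 1) (enn2real (p x)) = 1"
            by (subst epowr_ennreal) auto
          finally show ?thesis using True by simp
        qed (simp add: f0_def)
      qed
    qed
    also have "\<dots> = ennreal (1 / l) * ennreal B"
      using B by (simp add: nn_integral_cmult_indicator)
    also have "\<dots> = ennreal (1 / l * B)" using B l by (intro ennreal_mult[symmetric]) auto
    also have "\<dots> \<le> ennreal 1" using B l by (intro ennreal_leI) (auto simp: field_simps)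
    finally have "wnorm p w f0 \<le> ennreal l"
      unfolding wnorm_def using l by (intro var_norm_le_if_modular_le) auto
    then show ?thesis using f0m by (auto simp: wLp_def intro: le_less_trans)
  qed
  have Mfin: "var_norm p (\<lambda>x. maximal f0 x * w x) < \<infinity>"
  proof (rule le_less_trans)
    show "var_norm p (\<lambda>x. maximal f0 x * w x) \<le> ennreal C * wnorm p w f0" using C f0W by blast
    show "ennreal C * wnorm p w f0 < \<infinity>" using f0W by (simp add: wLp_def ennreal_mult_less_top)
  qed
  obtain B R where B: "0 \<le> B" "\<And>x. norm (f x) \<le> B" and R: "0 < R" "\<And>x. f x \<noteq> 0 \<Longrightarrow> norm x < R"
    using Linf_cD[OF f] by metis
  define I where "I = (\<integral>\<^sup>+x. norm (f0 x) \<partial>lebesgue)"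
  have "I \<noteq> 0"
  proof
    assume "I = 0"
    then have "AE x in lebesgue. f0 x = 0"
      unfolding I_def by (simp add: nn_integral_0_iff_AE)
    then have "AE x in lebesgue. x \<notin> ball (0::'a) 1"
      using v_AE by eventually_elim (auto simp: f0_def)
    then have "ball (0::'a) 1 \<in> null_sets lebesgue"
      by (simp add: AE_iff_null_sets)
    then have "emeasure lebesgue (ball (0::'a) 1) = 0" by auto
    moreover obtain B where "0 < B" "emeasure lebesgue (ball (0::'a) 1) = ennreal B"
      using emeasure_lebesgue_ball_pos[OF zero_less_one, of "0::'a"] by metis
    ultimately show False by simp
  qed
  moreover have "I < \<infinity>" unfolding I_def by (rule nn_integral_norm_Linf_c[OF f0L])
  ultimately obtain i where i: "I = ennreal i" "0 < i" by (cases I) (auto simp: less_le)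
  define S where "S = max R 1"
  have S: "0 < S" "R \<le> S" "1 \<le> S" by (auto simp: S_def)
  obtain m where m: "0 < m" "emeasure lebesgue (ball (0::'a) S) = ennreal m"
    using emeasure_lebesgue_ball_pos[OF S(1)] by metis
  \<comment> \<open>On the ball of radius \<open>S\<close> the maximal function of \<open>f0\<close>
    is at least i/m. The summand 1 keeps \<open>c\<close> positive when B = 0.\<close>
  define c where "c = (B + 1) * m / i"
  have c: "0 < c" using B m i by (simp add: c_def)
  have le: "ennreal (norm (f x)) \<le> ennreal c * maximal f0 x" for x
  proof (cases "f x = 0")
    case False
    then have x: "x \<in> ball 0 S" using R(2)[of x] S by simp
    have "I = (\<integral>\<^sup>+y\<in>ball 0 S. norm (f0 y) \<partial>lebesgue)"
      unfolding I_def using S by (intro nn_integral_cong) (auto simp: f0_def indicator_def)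
    also have "\<dots> \<le> maximal f0 x * ennreal m"
      using nn_integral_ball_le_maximal[OF x, of f0] m by simp
    finally have "ennreal ((B + 1) / i) * ennreal i \<le> ennreal ((B + 1) / i) * (ennreal m * maximal f0 x)"
      using i by (intro mult_left_mono) (auto simp: mult.commute)
    also have "\<dots> = ennreal c * maximal f0 x"
      using B i m by (subst ennreal_mult_mult) (auto simp: c_def)
    also have "ennreal ((B + 1) / i) * ennreal i = ennreal ((B + 1) / i * i)"
      using B i by (intro ennreal_mult[symmetric]) auto
    also have "(B + 1) / i * i = B + 1" using i by simp
    finally have "ennreal (B + 1) \<le> ennreal c * maximal f0 x" .
    moreover have "ennreal (norm (f x)) \<le> ennreal (B + 1)" using B(2)[of x] by (intro ennreal_leI) simp
    ultimately show ?thesis by (rule order_trans[rotated])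
  qed simp
  have "wnorm p w f \<le> var_norm p (\<lambda>x. ennreal c * (maximal f0 x * w x))"
    unfolding wnorm_def
  proof (rule var_norm_mono_AE[OF _ AE_I2])
    fix x
    show "ennreal (norm (f x)) * w x \<le> ennreal c * (maximal f0 x * w x)"
      using mult_right_mono[OF le[of x], of "w x"] by (simp add: mult.assoc)
  qed measurable
  also have "\<dots> < \<infinity>"
    by (intro var_norm_cmult_less_top c Mfin) measurable
  finally show ?thesis using fm by (simp add: wLp_def)
qed

end

section \<open>Extension by density\<close>

lemma exponent_conj:
  assumes "exponent p"
  shows "exponent (conj_exponent p)"
proof -
  have [measurable]: "p \<in> borel_measurable lebesgue" using assms by (simp add: exponent_def)
  have "(\<lambda>x. inverse (1 - inverse (p x))) \<in> borel_measurable lebesgue" by measurable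
  moreover have "1 \<le> conj_exponent p x" for x
  proof -
    have "inverse t \<ge> 1" if "t \<le> 1" for t :: ennreal
      using that by (cases t; cases "t = 0") (auto simp: inverse_ennreal one_le_inverse_iff top_unique)
    moreover have "1 - inverse (p x) \<le> 1" by (rule diff_le_self_ennreal)
    ultimately show ?thesis by (simp add: conj_exponent_def)
  qed
  ultimately show ?thesis by (simp add: exponent_def conj_exponent_def[abs_def])
qed

lemma weight_inverse:
  assumes "weight w"
  shows "weight (\<lambda>x. inverse (w x))"
proof -
  have [measurable]: "w \<in> borel_measurable lebesgue" using assms by (simp add: weight_def)
  have "AE x in lebesgue. 0 < w x \<and> w x < \<infinity>" using assms by (simp add: weight_def)
  then have "AE x in lebesgue. 0 < inverse (w x) \<and> inverse (w x) < \<infinity>"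
  proof eventually_elim
    case (elim x)
    then show ?case by (cases "w x") (auto simp: inverse_ennreal)
  qed
  then show ?thesis by (simp add: weight_def)
qed

text \<open>Solves t/(t-1) \<ge> 1 + \<delta> for t: a lower bound for the conjugate exponent
  becomes an upper bound for \<open>p\<close>.\<close>

lemma le_if_conj_exponent_ge:
  assumes "exponent p" "0 < \<delta>" "ennreal (1 + \<delta>) \<le> conj_exponent p x"
  shows "p x \<le> ennreal ((1 + \<delta>) / \<delta>)"
proof (cases "p x")
  case top
  then have "conj_exponent p x = 1" by (simp add: conj_exponent_def)
  then have "ennreal (1 + \<delta>) \<le> ennreal 1" using assms(3) by simp
  then have "1 + \<delta> \<le> 1" by (subst (asm) ennreal_le_iff) auto
  then show ?thesis using assms(2) by simp
next
  case (real t)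
  then have "1 \<le> t" using assms(1) by (metis exponent_def ennreal_1 ennreal_le_iff)
  show ?thesis
  proof (cases "t = 1")
    case True
    then show ?thesis using real assms(2) by (simp add: field_simps)
  next
    case False
    then have t: "1 < t" using \<open>1 \<le> t\<close> by simp
    then have "ennreal (1 + \<delta>) \<le> ennreal (t / (t - 1))"
      using assms(3) conj_exponent_ennreal[of p x t] real by simp
    then have "1 + \<delta> \<le> t / (t - 1)" using t by (subst (asm) ennreal_le_iff) auto
    then have "t \<le> (1 + \<delta>) / \<delta>" using t assms(2) by (simp add: field_simps)
    then show ?thesis using real by (simp add: ennreal_leI)
  qed
qed

text \<open>The hypotheses are symmetric under conjugation, so the result on exponents near 1
  applies twice, the second time to the conjugate exponent and the inverse weight.\<close>

lemma M_pair_nice_exponent: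
  assumes "M_pair p w"
  obtains a b where "nice_exponent p a b"
proof -
  have p: "exponent p" and w: "weight w" and M: "maximal_bounded p w" "maximal_bounded (conj_exponent p) (\<lambda>x. inverse (w x))"
    using assms by (auto simp: M_pair_def)
  obtain \<delta> where \<delta>: "0 < \<delta>" "AE x in lebesgue. ennreal (1 + \<delta>) \<le> p x"
    using maximal_bounded_exponent_gt_1[OF p w M(1)] by blast
  obtain \<delta>' where \<delta>': "0 < \<delta>'" "AE x in lebesgue. ennreal (1 + \<delta>') \<le> conj_exponent p x"
    using maximal_bounded_exponent_gt_1[OF exponent_conj[OF p] weight_inverse[OF w] M(2)] by blast
  have "nice_exponent p (1 + \<delta>) ((1 + \<delta>') / \<delta>')"
  proof
    show "p \<in> borel_measurable lebesgue" using p by (simp add: exponent_def)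
    show "1 < 1 + \<delta>" using \<delta>(1) by simp
    show "AE x in lebesgue. ennreal (1 + \<delta>) \<le> p x \<and> p x \<le> ennreal ((1 + \<delta>') / \<delta>')"
      using \<delta>(2) \<delta>'(2)
    proof eventually_elim
      case (elim x)
      then show ?case using le_if_conj_exponent_ge[OF p \<delta>'(1)] by blast
    qed
  qed
  then show ?thesis by (rule that)
qed

text \<open>Inserting \<open>w\<close> and its inverse into the product of the two maximal functions
  lets Hoelder's inequality separate them. Duality tests only with bounded functions of bounded
  support, which is the class covered by the bilinear estimate.\<close>

lemma (in cz_operator) wnorm_T_le:
  assumes pair: "M_pair p w"
  obtains \<Lambda> where "0 \<le> \<Lambda>" "\<And>f. f \<in> Linf_c \<Longrightarrow> wnorm p w (T f) \<le> ennreal \<Lambda> * wnorm p w f"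
proof -
  have p: "exponent p" and w: "weight w" and M: "maximal_bounded p w" "maximal_bounded (conj_exponent p) (\<lambda>x. inverse (w x))"
    using pair by (auto simp: M_pair_def)
  obtain a b where "nice_exponent p a b" by (rule M_pair_nice_exponent[OF pair])
  then interpret nice_exponent p a b .
  have wm [measurable]: "w \<in> borel_measurable lebesgue" using w by (simp add: weight_def)
  obtain C1 where C1: "\<And>f. f \<in> wLp p w \<Longrightarrow> var_norm p (\<lambda>x. maximal f x * w x) \<le> ennreal C1 * wnorm p w f"
    using M(1) by (auto simp: maximal_bounded_def)
  obtain C2 where C2: "\<And>f. f \<in> wLp (conj_exponent p) (\<lambda>x. inverse (w x)) \<Longrightarrow>
      var_norm (conj_exponent p) (\<lambda>x. maximal f x * inverse (w x)) \<le> ennreal C2 * wnorm (conj_exponent p) (\<lambda>x. inverse (w x)) f"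
    using M(2) by (auto simp: maximal_bounded_def)
  obtain D where D: "0 \<le> D"
    "\<And>f g B R. f \<in> Linf_c \<Longrightarrow> g \<in> borel_measurable lebesgue \<Longrightarrow> \<forall>y. 0 \<le> g y \<Longrightarrow> \<forall>y. g y \<le> B \<Longrightarrow>
      \<forall>y. g y \<noteq> 0 \<longrightarrow> norm y < R \<Longrightarrow>
      (\<integral>\<^sup>+y. ennreal (norm (T f y) * g y) \<partial>lebesgue)
        \<le> ennreal D * (\<integral>\<^sup>+y. maximal f y * maximal (\<lambda>y. complex_of_real (g y)) y \<partial>lebesgue)"
    by (rule T_bilinear_bound) (rule that)
  define \<Lambda> where "\<Lambda> = 2 * D * \<bar>C1\<bar> * \<bar>C2\<bar>"
  have \<Lambda>0: "0 \<le> \<Lambda>" using D(1) by (simp add: \<Lambda>_def)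
  show ?thesis
  proof (rule that[OF \<Lambda>0])
    fix f :: "'a \<Rightarrow> complex" assume f: "f \<in> Linf_c"
    have Tm [measurable]: "T f \<in> borel_measurable lebesgue" using f by (auto intro!: T_measurable Linf_c_subset_L2)
    have fW: "f \<in> wLp p w" by (rule Linf_c_subset_wLp[OF w M(1) f])
    then obtain l where l: "wnorm p w f = ennreal l" "0 \<le> l"
      by (cases "wnorm p w f") (auto simp: wLp_def)
    have Mf: "var_norm p (\<lambda>x. maximal f x * w x) \<le> ennreal (\<bar>C1\<bar> * l)"
    proof -
      have "var_norm p (\<lambda>x. maximal f x * w x) \<le> ennreal C1 * ennreal l" using C1[OF fW] l by simp
      also have "\<dots> \<le> ennreal \<bar>C1\<bar> * ennreal l" by (intro mult_right_mono ennreal_leI) auto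
      also have "\<dots> = ennreal (\<bar>C1\<bar> * l)" using l by (intro ennreal_mult[symmetric]) auto
      finally show ?thesis .
    qed
    have "wnorm p w (T f) \<le> ennreal (\<Lambda> * l)"
      unfolding wnorm_def
    proof (rule var_norm_le_by_duality[OF w])
      fix g :: "'a \<Rightarrow> real" and B R :: real
      assume g [measurable]: "g \<in> borel_measurable lebesgue" and g0: "\<And>y. 0 \<le> g y" and gB: "\<And>y. g y \<le> B"
        and gR: "\<And>y. g y \<noteq> 0 \<Longrightarrow> norm y < R"
        and fin: "var_norm (conj_exponent p) (\<lambda>x. ennreal (g x) * inverse (w x)) < \<infinity>"
      define gc where "gc y = complex_of_real (g y)" for y
      have gcm [measurable]: "gc \<in> borel_measurable lebesgue" unfolding gc_def by measurable
      have gcn: "wnorm (conj_exponent p) (\<lambda>x. inverse (w x)) gc = var_norm (conj_exponent p) (\<lambda>x. ennreal (g x) * inverse (w x))"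
        using g0 by (simp add: wnorm_def gc_def)
      have gcW: "gc \<in> wLp (conj_exponent p) (\<lambda>x. inverse (w x))"
        using fin gcm gcn by (simp add: wLp_def)
      obtain l' where l': "var_norm (conj_exponent p) (\<lambda>x. ennreal (g x) * inverse (w x)) = ennreal l'" "0 \<le> l'"
        using fin by (cases "var_norm (conj_exponent p) (\<lambda>x. ennreal (g x) * inverse (w x))") auto
      have Mg: "var_norm (conj_exponent p) (\<lambda>x. maximal gc x * inverse (w x)) \<le> ennreal (\<bar>C2\<bar> * l')"
      proof -
        have "var_norm (conj_exponent p) (\<lambda>x. maximal gc x * inverse (w x)) \<le> ennreal C2 * ennreal l'" using C2[OF gcW] l' gcn by simp
        also have "\<dots> \<le> ennreal \<bar>C2\<bar> * ennreal l'" by (intro mult_right_mono ennreal_leI) auto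
        also have "\<dots> = ennreal (\<bar>C2\<bar> * l')" using l' by (intro ennreal_mult[symmetric]) auto
        finally show ?thesis .
      qed
      have "(\<integral>\<^sup>+y. ennreal (norm (T f y) * g y) \<partial>lebesgue) \<le> ennreal D * (\<integral>\<^sup>+y. maximal f y * maximal gc y \<partial>lebesgue)"
        unfolding gc_def using f g g0 gB gR by (intro D(2)) blast+
      also have "(\<integral>\<^sup>+y. maximal f y * maximal gc y \<partial>lebesgue) = (\<integral>\<^sup>+y. (maximal f y * w y) * (maximal gc y * inverse (w y)) \<partial>lebesgue)"
      proof (rule nn_integral_cong_AE)
        have "AE y in lebesgue. 0 < w y \<and> w y < \<infinity>" using w by (simp add: weight_def)
        then show "AE y in lebesgue. maximal f y * maximal gc y = (maximal f y * w y) * (maximal gc y * inverse (w y))"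
        proof eventually_elim
          case (elim y)
          then obtain W where W: "w y = ennreal W" "0 < W" by (cases "w y") auto
          then have one: "w y * inverse (w y) = 1" by (simp add: inverse_ennreal flip: ennreal_mult)
          have "(maximal f y * w y) * (maximal gc y * inverse (w y)) = (maximal f y * maximal gc y) * (w y * inverse (w y))"
            by (simp only: mult_ac)
          then show ?case unfolding one by simp
        qed
      qed
      also have "\<dots> \<le> 2 * var_norm p (\<lambda>x. maximal f x * w x) * var_norm (conj_exponent p) (\<lambda>x. maximal gc x * inverse (w x))"
        using Mf Mg by (intro hoelder) (measurable, auto intro: le_less_trans)
      also have "\<dots> \<le> 2 * ennreal (\<bar>C1\<bar> * l) * ennreal (\<bar>C2\<bar> * l')"
        by (intro mult_mono Mf Mg) auto
      also have "\<dots> = ennreal (2 * (\<bar>C1\<bar> * l) * (\<bar>C2\<bar> * l'))"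
        using l l' by (simp add: ennreal_mult)
      finally have "(\<integral>\<^sup>+y. ennreal (norm (T f y) * g y) \<partial>lebesgue) \<le> ennreal D * ennreal (2 * (\<bar>C1\<bar> * l) * (\<bar>C2\<bar> * l'))"
        by (simp add: mult_left_mono)
      also have "\<dots> = ennreal (D * (2 * (\<bar>C1\<bar> * l) * (\<bar>C2\<bar> * l')))"
        using D(1) l l' by (intro ennreal_mult[symmetric]) auto
      also have "D * (2 * (\<bar>C1\<bar> * l) * (\<bar>C2\<bar> * l')) = \<Lambda> * l * l'" by (simp add: \<Lambda>_def)
      also have "ennreal (\<Lambda> * l * l') = ennreal (\<Lambda> * l) * ennreal l'"
        using \<Lambda>0 l l' by (intro ennreal_mult) auto
      finally show "(\<integral>\<^sup>+y. ennreal (norm (T f y) * g y) \<partial>lebesgue) \<le> ennreal (\<Lambda> * l) * var_norm (conj_exponent p) (\<lambda>x. ennreal (g x) * inverse (w x))"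
        using l' by simp
    qed (use \<Lambda>0 l in auto)
    then show "wnorm p w (T f) \<le> ennreal \<Lambda> * wnorm p w f"
      using \<Lambda>0 l by (simp add: ennreal_mult)
  qed
qed

theorem corollary3p5:
  fixes T :: "('a::euclidean_space \<Rightarrow> complex) \<Rightarrow> 'a \<Rightarrow> complex"
    and p w :: "'a \<Rightarrow> ennreal"
  assumes "calderon_zygmund T" and "M_pair p w"
  shows "\<exists>S. extension_by_density p w T S \<and>
           (\<exists>C::real. \<forall>f\<in>wLp p w. wnorm p w (S f) \<le> ennreal C * wnorm p w f)"
proof -
  obtain K A C0 \<epsilon> where "cz_operator T K A C0 \<epsilon>"
    by (rule calderon_zygmund_imp_cz_operator[OF assms(1)])
  then interpret cz_operator T K A C0 \<epsilon> .
  obtain a b where "nice_exponent p a b" by (rule M_pair_nice_exponent[OF assms(2)])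
  then interpret nice_exponent p a b .
  have w: "weight w" and M: "maximal_bounded p w" using assms(2) by (auto simp: M_pair_def)
  obtain C where C: "0 \<le> C" "\<And>f. f \<in> Linf_c \<Longrightarrow> wnorm p w (T f) \<le> ennreal C * wnorm p w f"
    by (rule wnorm_T_le[OF assms(2)]) (rule that)
  have Tm: "T f \<in> borel_measurable lebesgue" if "f \<in> Linf_c" for f
    using that by (auto intro!: T_measurable Linf_c_subset_L2)
  have Lm: "f \<in> borel_measurable lebesgue" if "f \<in> Linf_c" for f :: "'a \<Rightarrow> complex"
    using that by (simp add: Linf_c_def)
  \<comment> \<open>\<open>T\<close> is linear up to null sets only, so the two norms are compared
    through equality almost everywhere.\<close>
  have T_diff: "wnorm p w (\<lambda>x. T f x - T g x) \<le> ennreal C * wnorm p w (\<lambda>x. f x - g x)"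
    if f: "f \<in> Linf_c" and g: "g \<in> Linf_c" for f g
  proof -
    have [measurable]: "f \<in> borel_measurable lebesgue" "g \<in> borel_measurable lebesgue" using f g Lm by auto
    have ng: "(\<lambda>y. - 1 * g y) \<in> Linf_c"
      using g by (rule Linf_c_dominated[where c = 1]) auto
    have fg: "(\<lambda>y. f y + - 1 * g y) \<in> Linf_c" by (rule Linf_c_add[OF f ng])
    have "AE x in lebesgue. T (\<lambda>y. f y + - 1 * g y) x = T f x + T (\<lambda>y. - 1 * g y) x"
      by (intro T_add Linf_c_subset_L2 f ng)
    moreover have "AE x in lebesgue. T (\<lambda>y. - 1 * g y) x = - 1 * T g x"
      by (intro T_cmult Linf_c_subset_L2 g)
    ultimately have "AE x in lebesgue. T f x - T g x = T (\<lambda>y. f y + - 1 * g y) x"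
      by eventually_elim simp
    then have "wnorm p w (\<lambda>x. T f x - T g x) = wnorm p w (T (\<lambda>y. f y + - 1 * g y))"
      using f g fg by (intro wnorm_cong_AE w borel_measurable_diff Tm)
    also have "\<dots> \<le> ennreal C * wnorm p w (\<lambda>y. f y + - 1 * g y)" by (rule C(2)[OF fg])
    finally show ?thesis by simp
  qed
  \<comment> \<open>Two sequences are treated at once: with \<phi> = \<psi> this gives the Cauchy
    property, with different ones that they share their limit.\<close>
  have approx_diff: "wnorm p w (\<lambda>x. T (\<phi> m) x - T (\<psi> n) x) \<le>
      ennreal (2 * C) * (wnorm p w (\<lambda>x. \<phi> m x - f x) + wnorm p w (\<lambda>x. \<psi> n x - f x))"
    if "approximates p w \<phi> f" "approximates p w \<psi> f" "f \<in> wLp p w" for \<phi> \<psi> f m n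
  proof -
    have L: "\<phi> m \<in> Linf_c" "\<psi> n \<in> Linf_c" using that by (auto simp: approximates_def)
    have fm: "f \<in> borel_measurable lebesgue" using that(3) by (simp add: wLp_def)
    have "wnorm p w (\<lambda>x. T (\<phi> m) x - T (\<psi> n) x) \<le> ennreal C * wnorm p w (\<lambda>x. \<phi> m x - \<psi> n x)"
      by (rule T_diff[OF L])
    also have "\<dots> \<le> ennreal C * (2 * (wnorm p w (\<lambda>x. \<phi> m x - f x) + wnorm p w (\<lambda>x. f x - \<psi> n x)))"
      by (intro mult_left_mono wnorm_diff_triangle w Lm L fm) auto
    also have "\<dots> = ennreal (2 * C) * (wnorm p w (\<lambda>x. \<phi> m x - f x) + wnorm p w (\<lambda>x. \<psi> n x - f x))"
      using C(1) by (simp add: wnorm_minus_commute[of p w f] ennreal_mult mult_ac)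
    finally show ?thesis .
  qed
  \<comment> \<open>The order of quantifiers matters: one \<open>h\<close> has to serve all
    approximating sequences of \<open>f\<close>.\<close>
  have ex: "\<exists>h\<in>wLp p w. \<forall>\<phi>. approximates p w \<phi> f \<longrightarrow> (\<lambda>k. wnorm p w (\<lambda>x. T (\<phi> k) x - h x)) \<longlonglongrightarrow> 0"
    if f: "f \<in> wLp p w" for f
  proof -
    obtain \<psi> where \<psi>: "approximates p w \<psi> f" using exists_truncation_approximates[OF w f] by blast
    then have \<psi>L: "\<psi> k \<in> Linf_c" for k by (simp add: approximates_def)
    have lim\<psi>: "(\<lambda>k. wnorm p w (\<lambda>x. \<psi> k x - f x)) \<longlonglongrightarrow> 0" using \<psi> by (simp add: approximates_def)
    have "\<exists>N. \<forall>m\<ge>N. \<forall>n\<ge>N. wnorm p w (\<lambda>x. T (\<psi> m) x - T (\<psi> n) x) < ennreal e" if e: "0 < e" for e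
    proof -
      \<comment> \<open>Then 4 C e' < e, also for C = 0.\<close>
      define e' where "e' = e / (4 * C + 1)"
      have e': "0 < e'" using e C(1) by (simp add: e'_def)
      have "eventually (\<lambda>k. wnorm p w (\<lambda>x. \<psi> k x - f x) < ennreal e') sequentially"
        using lim\<psi> by (rule order_tendstoD(2)) (use e' in simp)
      then obtain N where N: "\<And>k. N \<le> k \<Longrightarrow> wnorm p w (\<lambda>x. \<psi> k x - f x) < ennreal e'"
        by (auto simp: eventually_sequentially)
      have "wnorm p w (\<lambda>x. T (\<psi> m) x - T (\<psi> n) x) < ennreal e" if "N \<le> m" "N \<le> n" for m n
      proof -
        have "wnorm p w (\<lambda>x. T (\<psi> m) x - T (\<psi> n) x) \<le> ennreal (2 * C) * (wnorm p w (\<lambda>x. \<psi> m x - f x) + wnorm p w (\<lambda>x. \<psi> n x - f x))"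
          by (rule approx_diff[OF \<psi> \<psi> f])
        also have "\<dots> \<le> ennreal (2 * C) * (ennreal e' + ennreal e')"
          using N that by (intro mult_left_mono add_mono) (auto intro: less_imp_le)
        also have "ennreal e' + ennreal e' = ennreal (e' + e')"
          using e' by (intro ennreal_plus[symmetric]) auto
        also have "ennreal (2 * C) * ennreal (e' + e') = ennreal (2 * C * (e' + e'))"
          using C(1) e' by (intro ennreal_mult[symmetric]) auto
        also have "\<dots> < ennreal e"
        proof (rule ennreal_lessI)
          have "4 * C * e / (4 * C + 1) < e"
            using C(1) e by (simp add: pos_divide_less_eq algebra_simps)
          then show "2 * C * (e' + e') < e" by (simp add: e'_def)
        qed (rule e)
        finally show ?thesis .
      qed
      then show ?thesis by blast
    qed
    from wnorm_complete[OF w Tm[OF \<psi>L] this]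
    obtain h where h: "h \<in> borel_measurable lebesgue" "(\<lambda>k. wnorm p w (\<lambda>x. T (\<psi> k) x - h x)) \<longlonglongrightarrow> 0"
      by blast
    have "eventually (\<lambda>k. wnorm p w (\<lambda>x. T (\<psi> k) x - h x) < 1) sequentially"
      using h(2) by (rule order_tendstoD(2)) simp
    then obtain k where k: "wnorm p w (\<lambda>x. T (\<psi> k) x - h x) < 1" by (auto simp: eventually_sequentially)
    have "wnorm p w h \<le> 2 * (wnorm p w (\<lambda>x. h x - T (\<psi> k) x) + wnorm p w (T (\<psi> k)))"
      using wnorm_add[OF w, of "\<lambda>x. h x - T (\<psi> k) x" "T (\<psi> k)"] h(1) Tm[OF \<psi>L[of k]] by simp
    also have "\<dots> < \<infinity>"
    proof -
      have "wnorm p w (\<psi> k) < \<infinity>" using Linf_c_subset_wLp[OF w M \<psi>L[of k]] by (simp add: wLp_def)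
      then have "ennreal C * wnorm p w (\<psi> k) < \<infinity>" by (simp add: ennreal_mult_less_top)
      then have "wnorm p w (T (\<psi> k)) < \<infinity>" using C(2)[OF \<psi>L[of k]] by (rule le_less_trans[rotated])
      moreover have "wnorm p w (\<lambda>x. h x - T (\<psi> k) x) < \<infinity>"
        using k unfolding wnorm_minus_commute[of p w h] by (rule less_trans) simp
      ultimately show ?thesis by (simp add: ennreal_mult_less_top)
    qed
    finally have hW: "h \<in> wLp p w" using h(1) by (simp add: wLp_def)
    have "(\<lambda>k. wnorm p w (\<lambda>x. T (\<phi> k) x - h x)) \<longlonglongrightarrow> 0" if \<phi>: "approximates p w \<phi> f" for \<phi>
    proof -
      have \<phi>L: "\<phi> k \<in> Linf_c" for k using \<phi> by (simp add: approximates_def)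
      have lim\<phi>: "(\<lambda>k. wnorm p w (\<lambda>x. \<phi> k x - f x)) \<longlonglongrightarrow> 0" using \<phi> by (simp add: approximates_def)
      let ?u = "\<lambda>k. 2 * (ennreal (2 * C) * (wnorm p w (\<lambda>x. \<phi> k x - f x) + wnorm p w (\<lambda>x. \<psi> k x - f x)) + wnorm p w (\<lambda>x. T (\<psi> k) x - h x))"
      have le: "wnorm p w (\<lambda>x. T (\<phi> k) x - h x) \<le> ?u k" for k
      proof -
        have "wnorm p w (\<lambda>x. T (\<phi> k) x - h x) \<le> 2 * (wnorm p w (\<lambda>x. T (\<phi> k) x - T (\<psi> k) x) + wnorm p w (\<lambda>x. T (\<psi> k) x - h x))"
          by (intro wnorm_diff_triangle w Tm \<phi>L \<psi>L h(1))
        also have "\<dots> \<le> ?u k"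
          by (intro mult_left_mono add_mono approx_diff \<phi> \<psi> f) auto
        finally show ?thesis .
      qed
      have "?u \<longlonglongrightarrow> 2 * (ennreal (2 * C) * (0 + 0) + 0)"
        by (intro tendsto_add ennreal_tendsto_cmult lim\<phi> lim\<psi> h(2)) auto
      then have lim0: "?u \<longlonglongrightarrow> 0" by simp
      show ?thesis
      proof (rule tendsto_sandwich[OF _ _ tendsto_const lim0])
        show "eventually (\<lambda>k. wnorm p w (\<lambda>x. T (\<phi> k) x - h x) \<le> ?u k) sequentially"
          using le by (rule always_eventually[OF allI])
      qed simp
    qed
    then show ?thesis using hW by blast
  qed
  have "\<forall>f\<in>wLp p w. \<exists>h. h \<in> wLp p w \<and>
      (\<forall>\<phi>. approximates p w \<phi> f \<longrightarrow> (\<lambda>k. wnorm p w (\<lambda>x. T (\<phi> k) x - h x)) \<longlonglongrightarrow> 0)"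
    using ex by blast
  from bchoice[OF this] obtain S where S0: "\<forall>f\<in>wLp p w. S f \<in> wLp p w \<and>
      (\<forall>\<phi>. approximates p w \<phi> f \<longrightarrow> (\<lambda>k. wnorm p w (\<lambda>x. T (\<phi> k) x - S f x)) \<longlonglongrightarrow> 0)"
    by (rule exE)
  then have S: "S f \<in> wLp p w"
    "approximates p w \<phi> f \<Longrightarrow> (\<lambda>k. wnorm p w (\<lambda>x. T (\<phi> k) x - S f x)) \<longlonglongrightarrow> 0" if "f \<in> wLp p w" for f \<phi>
    using that by simp_all
  have "extension_by_density p w T S"
    unfolding extension_by_density_def
    using S0 exists_truncation_approximates[OF w] Linf_c_subset_wLp[OF w M] by blast
  \<comment> \<open>The 4 comes from using the triangle inequality with constant 2 twice, once
    around \<open>T (\<phi> k)\<close> and once around \<open>\<phi> k\<close>.\<close>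
  moreover have "wnorm p w (S f) \<le> ennreal (4 * C) * wnorm p w f" if f: "f \<in> wLp p w" for f
  proof -
    obtain \<phi> where \<phi>: "approximates p w \<phi> f" using exists_truncation_approximates[OF w f] by blast
    have \<phi>L: "\<phi> k \<in> Linf_c" for k using \<phi> by (simp add: approximates_def)
    have lim\<phi>: "(\<lambda>k. wnorm p w (\<lambda>x. \<phi> k x - f x)) \<longlonglongrightarrow> 0" using \<phi> by (simp add: approximates_def)
    have fm: "f \<in> borel_measurable lebesgue" and Sm: "S f \<in> borel_measurable lebesgue"
      using f S(1)[OF f] by (auto simp: wLp_def)
    let ?u = "\<lambda>k. 2 * (wnorm p w (\<lambda>x. T (\<phi> k) x - S f x) + ennreal C * (2 * (wnorm p w (\<lambda>x. \<phi> k x - f x) + wnorm p w f)))"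
    have "wnorm p w (S f) \<le> ?u k" for k
    proof -
      have "wnorm p w (S f) \<le> 2 * (wnorm p w (\<lambda>x. S f x - T (\<phi> k) x) + wnorm p w (T (\<phi> k)))"
        using wnorm_add[OF w, of "\<lambda>x. S f x - T (\<phi> k) x" "T (\<phi> k)"] Sm Tm[OF \<phi>L[of k]] by simp
      also have "wnorm p w (T (\<phi> k)) \<le> ennreal C * wnorm p w (\<phi> k)" by (rule C(2)[OF \<phi>L])
      also have "wnorm p w (\<phi> k) \<le> 2 * (wnorm p w (\<lambda>x. \<phi> k x - f x) + wnorm p w f)"
        using wnorm_add[OF w, of "\<lambda>x. \<phi> k x - f x" f] fm Lm[OF \<phi>L[of k]] by simp
      finally show ?thesis
        by (simp add: wnorm_minus_commute[of p w "S f"] add_left_mono mult_left_mono)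
    qed
    moreover have "?u \<longlonglongrightarrow> 2 * (0 + ennreal C * (2 * (0 + wnorm p w f)))"
      by (intro tendsto_add ennreal_tendsto_cmult lim\<phi> S(2)[OF f \<phi>] tendsto_const) auto
    ultimately have "wnorm p w (S f) \<le> 2 * (0 + ennreal C * (2 * (0 + wnorm p w f)))"
      by (intro tendsto_lowerbound[where F = sequentially]) auto
    also have "\<dots> = ennreal (4 * C) * wnorm p w f"
    proof -
      have "2 * (ennreal C * (2 * x)) = (2 * 2) * ennreal C * x" for x by (simp only: mult_ac)
      then show ?thesis using C(1) by (simp add: ennreal_mult)
    qed
    finally show ?thesis .
  qed
  ultimately show ?thesis by blast
qed

end
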